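(* For every integer $n\ge 2$, every Belavin-Drinfeld triple $(T,\Gamma_1,\Gamma_2)$ of type $A_{n-1}$, and every $s\in\mathfrak h\wedge\mathfrak h$ satisfying $[(\alpha-T\alpha)\otimes 1]s=\frac12[(\alpha+T\alpha)\otimes 1]P^0$ for all $\alpha\in\Gamma_1$, one has $R_J=R_{\mathrm{GGS}}$.
   Context: **Roots and triples.** Let $e_1,\dots,e_n$ be the standard basis of $\mathbb C^n$, orthonormal for $(\,,)$; $\alpha_i=e_i-e_{i+1}$; $\Gamma=\{\alpha_1,\dots,\alpha_{n-1}\}$. A Belavin-Drinfeld triple of type $A_{n-1}$ is $(T,\Gamma_1,\Gamma_2)$ with $\Gamma_1,\Gamma_2\subset\Gamma$ and $T:\Gamma_1\to\Gamma_2$ a bijection such that (a) $(T\alpha,T\beta)=(\alpha,\beta)$ for $\alpha,\beta\in\Gamma_1$; (b) for each $\alpha\in\Gamma_1$ there is $k\in\mathbb N$ with $T^k\alpha\notin\Gamma_1$. For $Y\subset\Gamma$, $\tilde Y=\{\alpha\in\mathrm{Span}(Y):\alpha=e_i-e_j,\ i<j\}$. For $\alpha=e_i-e_j$ ($i\ne j$), $e_\alpha=e_{ij}$ (matrix unit; so $e_{-\alpha}=e_{ji}$) and $|\alpha|=|j-i|$. Extend $T$ additively to $\tilde\Gamma_1\to\tilde\Gamma_2$; $T^k$ denotes the $k$-fold iterate where defined. For $\alpha,\beta\in\tilde\Gamma$, $\alpha\prec\beta$ means $T^k\alpha=\beta$ for some $k\ge1$ (such $k$ is unique). **Orientation.**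 If $T^k\alpha=\beta$, $\alpha=e_i-e_j$, $\beta=e_l-e_m$, there are two possibilities: either $T^k\alpha_i=\alpha_l$ and $T^k\alpha_{j-1}=\alpha_{m-1}$ ($T^k$ is orientation-preserving on $\alpha$), or $T^k\alpha_i=\alpha_{m-1}$ and $T^k\alpha_{j-1}=\alpha_l$ ($T^k$ is orientation-reversing on $\alpha$). $C_{\alpha,\beta}=1$ if $T^k$ reverses orientation on $\alpha$, and $C_{\alpha,\beta}=0$ if $T^k$ preserves orientation on $\alpha$. **Passing.** A positive $T$-pair is $(T^k\alpha,-\alpha)$ with $k\ge1$, of order $\mathrm{Ord}(T^k\alpha,-\alpha)=k$; $TP_+$ is the set of these. For $\alpha=e_i-e_j\in\tilde\Gamma_1$: $PO^r(\alpha)=k$ if $T^k\alpha=e_j-e_{2j-i}$ for some $k>0$ ($\infty$ if none); $PO^l(\alpha)=k$ if $T^k\alpha=e_{2i-j}-e_i$ for some $k>0$ ($\infty$ if none). For $*\in\{r,l\}$, $x=(\beta,-\alpha)\in TP_+$ is half $*$-passed if $\mathrm{Ord}(x)=PO^*(\alpha)$, and $*$-passed if $\mathrm{Ord}(x)>k_0:=PO^*(\alpha)$ and $C_{\alpha,\beta}=C_{\alpha,T^{k_0}\alpha}$. $P^*(x)=1$ if $x$ is $*$-passed, $\frac12$ if half $*$-passed, $0$ otherwise; $P^s=P^r+P^l$, $P^a=P^r-P^l$. **Classical data.** $\mathfrak h\subset\mathfrak{gl}(n)$ is the space of diagonal matrices; $(\sum\lambda_ie_i)(\sum a_ie_{ii})=\sum\lambda_ia_i$;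 for $\lambda\in\mathbb C^n$, $(\lambda\otimes1)(x\otimes y)=\lambda(x)y$. $P=\sum_{i,j}e_{ij}\otimes e_{ji}$, $P^0=\sum_ie_{ii}\otimes e_{ii}$; $\mathfrak h\wedge\mathfrak h$ is the space of antisymmetric tensors in $\mathfrak h\otimes\mathfrak h$. Set $a=\sum_{\alpha\prec\beta}(-1)^{C_{\alpha,\beta}(|\alpha|-1)}(e_{-\alpha}\otimes e_\beta-e_\beta\otimes e_{-\alpha})$, $r_{st}=\frac12\sum_ie_{ii}\otimes e_{ii}+\sum_{\alpha\in\tilde\Gamma}e_{-\alpha}\otimes e_\alpha$, $r=s+a+r_{st}$. **Quantum data.** $\hbar$ is a formal parameter, $q=e^\hbar$, $q^s=\exp(\hbar s)$, $q^y=e^{\hbar y}$, $(x\otimes y)^{21}=y\otimes x$. $R_{\mathrm{GGS}}=\sum P_{i,j,k,l}\,e_{ij}\otimes e_{kl}$, where $P_{i,j,k,l}$ are the unique expressions of the form $xq^y(q-q^{-1})^z$ ($x,y\in\mathbb C$, $z\in\{0,1\}$) such that $R_{\mathrm{GGS}}\equiv1+2\hbar r+2\hbar^2r^2\pmod{\hbar^3}$. $R_{st}=q\sum_ie_{ii}\otimes e_{ii}+\sum_{i\ne j}e_{ii}\otimes e_{jj}+(q-q^{-1})\sum_{i>j}e_{ij}\otimes e_{ji}$. With $m=\max_{x\in TP_+}\mathrm{Ord}(x)$, set $$J_k=1+\sum_{\beta=T^k\alpha}(-q)^{-C_{\alpha,\beta}(|\alpha|-1)}q^{P^a(\beta,-\alpha)}(q-q^{-1})\,e_\beta\otimes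 e_{-\alpha},\qquad J=J_1J_2\cdots J_m$$ ($J=1$ if $TP_+=\emptyset$), and $R_J=q^sJ^{-1}R_{st}J^{21}q^s$.
   Formalization: For |α|=1 both orientation alternatives hold, so C_{α,β} is undefined there. It is taken as the parity of the steps at which T reverses the connected component of Γ_1 containing the current simple root (isolated roots: preserved). A constant C on simple roots would make the claim false. *)

theory Defs
  imports "HOL-Analysis.Analysis" "HOL-Computational_Algebra.Formal_Power_Series"
begin

text \<open>
  The finite index type \<open>'n\<close> plays the role of \<open>{1, \<dots>, n}\<close> with \<open>n = CARD('n)\<close>; the standard basis
  \<open>e\<^sub>1, \<dots>, e\<^sub>n\<close> is the basis of unit vectors, numbered by a fixed bijection \<open>idx\<close>.
  \<open>End(\<complex>\<^sup>n \<otimes> \<complex>\<^sup>n)\<close> is the space of matrices indexed by \<open>'n \<times> 'n\<close>, where \<open>x \<otimes> y\<close> is the Kronecker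
  product; the matrix product is \<open>**\<close> (the product \<open>*\<close> on \<open>vec\<close> is entrywise).
\<close>

definition idx :: "nat \<Rightarrow> 'n::finite" where
  "idx = (SOME f. bij_betw f {1..CARD('n)} UNIV)"

type_synonym 'n cvec = "complex ^ 'n"
type_synonym ('a, 'n) tmat = "'a ^ ('n \<times> 'n) ^ ('n \<times> 'n)"

definition mat_unit :: "nat \<Rightarrow> nat \<Rightarrow> 'a::zero_neq_one ^ 'n::finite ^ 'n" where
  "mat_unit i j = (\<chi> r c. if r = idx i \<and> c = idx j then 1 else 0)"

definition tensor :: "'a::times ^ 'n::finite ^ 'n \<Rightarrow> 'a ^ 'n ^ 'n \<Rightarrow> ('a, 'n) tmat" (infixl "\<otimes>" 75) where
  "x \<otimes> y = (\<chi> r c. x $ fst r $ fst c * y $ snd r $ snd c)"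

text \<open>The linear map with \<open>(x \<otimes> y)\<^sup>2\<^sup>1 = y \<otimes> x\<close>.\<close>

definition flip :: "('a, 'n::finite) tmat \<Rightarrow> ('a, 'n) tmat" where
  "flip X = (\<chi> r c. X $ prod.swap r $ prod.swap c)"

lemma flip_tensor: "flip (x \<otimes> y) = y \<otimes> (x :: 'a::comm_semiring_1 ^ 'n::finite ^ 'n)"
  by (simp add: flip_def tensor_def vec_eq_iff mult.commute)

definition mscale :: "'a::times \<Rightarrow> 'a ^ 'm ^ 'k \<Rightarrow> 'a ^ 'm ^ 'k" (infixr "*\<^sub>m" 75) where
  "c *\<^sub>m A = (\<chi> r k. c * A $ r $ k)"

primrec mpow :: "'a::semiring_1 ^ 'm ^ 'm \<Rightarrow> nat \<Rightarrow> 'a ^ 'm ^ 'm" where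
  "mpow A 0 = mat 1"
| "mpow A (Suc k) = A ** mpow A k"

definition basis_vec :: "nat \<Rightarrow> 'n::finite cvec" where
  "basis_vec i = axis (idx i) 1"

definition simple_root :: "nat \<Rightarrow> 'n::finite cvec" where
  "simple_root i = basis_vec i - basis_vec (i + 1)"

definition simple_roots :: "'n::finite cvec set" where
  "simple_roots = {simple_root i | i. 1 \<le> i \<and> i < CARD('n)}"

definition pos_roots_in :: "'n::finite cvec set \<Rightarrow> 'n cvec set" where
  "pos_roots_in Y = {\<alpha> \<in> vec.span Y. \<exists>i j. 1 \<le> i \<and> i < j \<and> j \<le> CARD('n) \<and> \<alpha> = basis_vec i - basis_vec j}"

text \<open>
  \<open>T\<close> is a total function of which only the values on \<open>\<Gamma>\<^sub>1\<close> matter. In the last clause, the least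
  \<open>k\<close> with \<open>(T ^^ k) \<alpha> \<notin> \<Gamma>\<^sub>1\<close> only involves such values. The real inner product of
  \<^typ>\<open>complex ^ 'n\<close> makes the \<open>e\<^sub>i\<close> orthonormal and coincides on the real vectors in
  \<^term>\<open>simple_roots\<close> with the complex bilinear form.
\<close>

definition BD_triple ::
  "('n::finite cvec \<Rightarrow> 'n cvec) \<Rightarrow> 'n cvec set \<Rightarrow> 'n cvec set \<Rightarrow> bool" where
  "BD_triple T \<Gamma>1 \<Gamma>2 \<longleftrightarrow>
     \<Gamma>1 \<subseteq> simple_roots \<and> \<Gamma>2 \<subseteq> simple_roots \<and> bij_betw T \<Gamma>1 \<Gamma>2 \<and>
     (\<forall>\<alpha>\<in>\<Gamma>1. \<forall>\<beta>\<in>\<Gamma>1. T \<alpha> \<bullet> T \<beta> = \<alpha> \<bullet> \<beta>) \<and>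
     (\<forall>\<alpha>\<in>\<Gamma>1. \<exists>k. (T ^^ k) \<alpha> \<notin> \<Gamma>1)"

text \<open>The pair \<open>(i, j)\<close> with \<open>\<alpha> = e\<^sub>i - e\<^sub>j\<close>, for a positive or negative root \<open>\<alpha>\<close>.\<close>

definition root_ix :: "'n::finite cvec \<Rightarrow> nat \<times> nat" where
  "root_ix \<alpha> = (THE (i, j). i \<in> {1..CARD('n)} \<and> j \<in> {1..CARD('n)} \<and> i \<noteq> j \<and> \<alpha> = basis_vec i - basis_vec j)"

definition root_mat :: "'n::finite cvec \<Rightarrow> 'a::zero_neq_one ^ 'n ^ 'n" where
  "root_mat \<alpha> = (case root_ix \<alpha> of (i, j) \<Rightarrow> mat_unit i j)"

definition root_len :: "'n::finite cvec \<Rightarrow> nat" where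
  "root_len \<alpha> = (case root_ix \<alpha> of (i, j) \<Rightarrow> nat \<bar>int j - int i\<bar>)"

definition ext ::
  "('n::finite cvec \<Rightarrow> 'n cvec) \<Rightarrow> 'n cvec set \<Rightarrow> 'n cvec \<Rightarrow> 'n cvec" where
  "ext T \<Gamma>1 \<alpha> = (THE \<beta>. \<exists>c. \<alpha> = (\<Sum>\<gamma>\<in>\<Gamma>1. c \<gamma> *s \<gamma>) \<and> \<beta> = (\<Sum>\<gamma>\<in>\<Gamma>1. c \<gamma> *s T \<gamma>))"

text \<open>\<open>maps_to T \<Gamma>1 k \<alpha> \<beta>\<close>: the \<open>k\<close>-fold iterate of the extension \<open>\<Gamma>1~ \<rightarrow> \<Gamma>2~\<close> of \<open>T\<close> is defined
  at \<open>\<alpha>\<close> and has the value \<open>\<beta>\<close>.\<close>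

definition maps_to ::
  "('n::finite cvec \<Rightarrow> 'n cvec) \<Rightarrow> 'n cvec set \<Rightarrow> nat \<Rightarrow> 'n cvec \<Rightarrow> 'n cvec \<Rightarrow> bool" where
  "maps_to T \<Gamma>1 k \<alpha> \<beta> \<longleftrightarrow>
     \<alpha> \<in> pos_roots_in simple_roots \<and> (\<alpha>, \<beta>) \<in> {(\<gamma>, ext T \<Gamma>1 \<gamma>) | \<gamma>. \<gamma> \<in> pos_roots_in \<Gamma>1} ^^ k"

definition prec ::
  "('n::finite cvec \<Rightarrow> 'n cvec) \<Rightarrow> 'n cvec set \<Rightarrow> 'n cvec \<Rightarrow> 'n cvec \<Rightarrow> bool" where
  "prec T \<Gamma>1 \<alpha> \<beta> \<longleftrightarrow> (\<exists>k\<ge>1. maps_to T \<Gamma>1 k \<alpha> \<beta>)"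

definition reverses ::
  "('n::finite cvec \<Rightarrow> 'n cvec) \<Rightarrow> 'n cvec set \<Rightarrow> nat \<Rightarrow> 'n cvec \<Rightarrow> bool" where
  "reverses T \<Gamma>1 k \<alpha> \<longleftrightarrow> (\<exists>\<beta> i j l m. maps_to T \<Gamma>1 k \<alpha> \<beta> \<and> root_ix \<alpha> = (i, j) \<and> root_ix \<beta> = (l, m) \<and>
     maps_to T \<Gamma>1 k (simple_root i) (simple_root (m - 1)) \<and>
     maps_to T \<Gamma>1 k (simple_root (j - 1)) (simple_root l))"

text \<open>
  If \<open>|\<alpha>| = 1\<close>, both alternatives in the definition of orientation hold, and a convention is
  needed. A step \<open>\<gamma> \<mapsto> T \<gamma>\<close> with \<open>\<gamma>\<close> simple counts as reversing if \<open>T\<close> reverses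
  the orientation of a root \<open>\<delta> \<in> \<Gamma>1~\<close> of length 2 that has \<open>\<gamma>\<close> as an end, that is, if
  \<open>T\<close> reverses the connected component of \<open>\<Gamma>1\<close> containing \<open>\<gamma>\<close>; a step on an isolated simple root
  preserves orientation. \<open>T\<^sup>k\<close> reverses orientation on a simple root
  if an odd number of its \<open>k\<close> steps do. For \<open>|\<alpha>| \<ge> 2\<close> orientations compose in the same way.
  The choice only affects the notion of being passed. The simpler convention
  that all \<open>T\<^sup>k\<close> preserve orientation on simple roots is not adequate: for \<open>n = 6\<close> and
  \<open>T: \<alpha>\<^sub>1 \<mapsto> \<alpha>\<^sub>5, \<alpha>\<^sub>2 \<mapsto> \<alpha>\<^sub>4, \<alpha>\<^sub>4 \<mapsto> \<alpha>\<^sub>1\<close> it would make \<open>(\<alpha>\<^sub>5, -\<alpha>\<^sub>2)\<close> left-passed, and then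
  \<open>R_J\<close> and \<open>R_GGS\<close> differ at order \<open>\<hbar>\<^sup>2\<close>.
\<close>

definition simple_step_reverses ::
  "('n::finite cvec \<Rightarrow> 'n cvec) \<Rightarrow> 'n cvec set \<Rightarrow> 'n cvec \<Rightarrow> bool" where
  "simple_step_reverses T \<Gamma>1 \<gamma> \<longleftrightarrow>
     (\<exists>\<delta>\<in>pos_roots_in \<Gamma>1. \<exists>i. root_ix \<delta> = (i, i + 2) \<and> \<gamma> \<in> {simple_root i, simple_root (i + 1)} \<and>
        reverses T \<Gamma>1 1 \<delta>)"

definition orient_reversing ::
  "('n::finite cvec \<Rightarrow> 'n cvec) \<Rightarrow> 'n cvec set \<Rightarrow> nat \<Rightarrow> 'n cvec \<Rightarrow> bool" where
  "orient_reversing T \<Gamma>1 k \<alpha> \<longleftrightarrow>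
     (if root_len \<alpha> = 1
      then odd (card {t. t < k \<and> (\<exists>\<gamma>. maps_to T \<Gamma>1 t \<alpha> \<gamma> \<and> simple_step_reverses T \<Gamma>1 \<gamma>)})
      else reverses T \<Gamma>1 k \<alpha>)"

definition orient_C ::
  "('n::finite cvec \<Rightarrow> 'n cvec) \<Rightarrow> 'n cvec set \<Rightarrow> 'n cvec \<Rightarrow> 'n cvec \<Rightarrow> nat" where
  "orient_C T \<Gamma>1 \<alpha> \<beta> = (if \<exists>k\<ge>1. maps_to T \<Gamma>1 k \<alpha> \<beta> \<and> orient_reversing T \<Gamma>1 k \<alpha> then 1 else 0)"

definition TP_plus ::
  "('n::finite cvec \<Rightarrow> 'n cvec) \<Rightarrow> 'n cvec set \<Rightarrow> ('n cvec \<times> 'n cvec) set" where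
  "TP_plus T \<Gamma>1 = {(\<beta>, - \<alpha>) | \<alpha> \<beta>. \<exists>k\<ge>1. maps_to T \<Gamma>1 k \<alpha> \<beta>}"

definition Ord ::
  "('n::finite cvec \<Rightarrow> 'n cvec) \<Rightarrow> 'n cvec set \<Rightarrow> 'n cvec \<times> 'n cvec \<Rightarrow> nat" where
  "Ord T \<Gamma>1 x = (THE k. 1 \<le> k \<and> maps_to T \<Gamma>1 k (- snd x) (fst x))"

text \<open>The value \<open>None\<close> stands for \<open>\<infinity>\<close>. The side conditions on the indices \<open>2j - i\<close> and \<open>2i - j\<close>
  say that they lie in \<open>{1, \<dots>, n}\<close>.\<close>

definition PO_r ::
  "('n::finite cvec \<Rightarrow> 'n cvec) \<Rightarrow> 'n cvec set \<Rightarrow> 'n cvec \<Rightarrow> nat option" where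
  "PO_r T \<Gamma>1 \<alpha> = (case root_ix \<alpha> of (i, j) \<Rightarrow>
     let Q = (\<lambda>k. k > 0 \<and> 2 * j - i \<le> CARD('n) \<and> maps_to T \<Gamma>1 k \<alpha> (basis_vec j - basis_vec (2 * j - i)))
     in if \<exists>k. Q k then Some (THE k. Q k) else None)"

definition PO_l ::
  "('n::finite cvec \<Rightarrow> 'n cvec) \<Rightarrow> 'n cvec set \<Rightarrow> 'n cvec \<Rightarrow> nat option" where
  "PO_l T \<Gamma>1 \<alpha> = (case root_ix \<alpha> of (i, j) \<Rightarrow>
     let Q = (\<lambda>k. k > 0 \<and> j < 2 * i \<and> maps_to T \<Gamma>1 k \<alpha> (basis_vec (2 * i - j) - basis_vec i))
     in if \<exists>k. Q k then Some (THE k. Q k) else None)"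

definition half_passed ::
  "('n::finite cvec \<Rightarrow> 'n cvec) \<Rightarrow> 'n cvec set \<Rightarrow> ('n cvec \<Rightarrow> nat option) \<Rightarrow>
   'n cvec \<times> 'n cvec \<Rightarrow> bool" where
  "half_passed T \<Gamma>1 PO x \<longleftrightarrow> PO (- snd x) = Some (Ord T \<Gamma>1 x)"

definition passed ::
  "('n::finite cvec \<Rightarrow> 'n cvec) \<Rightarrow> 'n cvec set \<Rightarrow> ('n cvec \<Rightarrow> nat option) \<Rightarrow>
   'n cvec \<times> 'n cvec \<Rightarrow> bool" where
  "passed T \<Gamma>1 PO x \<longleftrightarrow> (case x of (\<beta>, \<alpha>') \<Rightarrow> let \<alpha> = - \<alpha>' in
     \<exists>k0 \<gamma>. PO \<alpha> = Some k0 \<and> Ord T \<Gamma>1 x > k0 \<and> maps_to T \<Gamma>1 k0 \<alpha> \<gamma> \<and> orient_C T \<Gamma>1 \<alpha> \<beta> = orient_C T \<Gamma>1 \<alpha> \<gamma>)"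

definition Pval ::
  "('n::finite cvec \<Rightarrow> 'n cvec) \<Rightarrow> 'n cvec set \<Rightarrow> ('n cvec \<Rightarrow> nat option) \<Rightarrow>
   'n cvec \<times> 'n cvec \<Rightarrow> complex" where
  "Pval T \<Gamma>1 PO x = (if passed T \<Gamma>1 PO x then 1 else if half_passed T \<Gamma>1 PO x then 1 / 2 else 0)"

definition P_a ::
  "('n::finite cvec \<Rightarrow> 'n cvec) \<Rightarrow> 'n cvec set \<Rightarrow> 'n cvec \<times> 'n cvec \<Rightarrow> complex" where
  "P_a T \<Gamma>1 x = Pval T \<Gamma>1 (PO_r T \<Gamma>1) x - Pval T \<Gamma>1 (PO_l T \<Gamma>1) x"

definition P0 :: "(complex, 'n::finite) tmat" where
  "P0 = (\<Sum>i=1..CARD('n). mat_unit i i \<otimes> mat_unit i i)"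

definition hh :: "(complex, 'n::finite) tmat set" where
  "hh = {(\<Sum>i=1..CARD('n). \<Sum>j=1..CARD('n). c i j *\<^sub>m (mat_unit i i \<otimes> mat_unit j j)) | c. True}"

definition h_wedge_h :: "(complex, 'n::finite) tmat set" where
  "h_wedge_h = {s \<in> hh. flip s = - s}"

text \<open>The action of \<open>\<mu> \<in> \<complex>\<^sup>n\<close> on diagonal matrices, and \<open>(\<mu> \<otimes> 1) X\<close> for \<open>X\<close> in
  \<open>\<hh> \<otimes> \<hh>\<close>, i.e. the linear extension of \<open>x \<otimes> y \<mapsto> \<mu>(x) y\<close>.\<close>

definition hfun :: "'n::finite cvec \<Rightarrow> complex ^ 'n ^ 'n \<Rightarrow> complex" where
  "hfun \<mu> x = (\<Sum>a\<in>UNIV. \<mu> $ a * x $ a $ a)"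

definition hfun_tensor1 :: "'n::finite cvec \<Rightarrow> (complex, 'n) tmat \<Rightarrow> complex ^ 'n ^ 'n" where
  "hfun_tensor1 \<mu> X = (\<chi> b d. hfun \<mu> (\<chi> a c. X $ (a, b) $ (c, d)))"

lemma hfun_tensor1_tensor: "hfun_tensor1 \<mu> (x \<otimes> y) = hfun \<mu> x *\<^sub>m y"
  by (simp add: hfun_tensor1_def hfun_def tensor_def mscale_def vec_eq_iff sum_distrib_right mult.assoc)

definition a_cl ::
  "('n::finite cvec \<Rightarrow> 'n cvec) \<Rightarrow> 'n cvec set \<Rightarrow> (complex, 'n) tmat" where
  "a_cl T \<Gamma>1 = (\<Sum>(\<alpha>, \<beta>) | prec T \<Gamma>1 \<alpha> \<beta>.
     (-1) ^ (orient_C T \<Gamma>1 \<alpha> \<beta> * (root_len \<alpha> - 1)) *\<^sub>m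
       (root_mat (- \<alpha>) \<otimes> root_mat \<beta> - root_mat \<beta> \<otimes> root_mat (- \<alpha>)))"

definition r_st :: "(complex, 'n::finite) tmat" where
  "r_st = (1 / 2) *\<^sub>m (\<Sum>i=1..CARD('n). mat_unit i i \<otimes> mat_unit i i)
     + (\<Sum>\<alpha>\<in>pos_roots_in simple_roots. root_mat (- \<alpha>) \<otimes> root_mat \<alpha>)"

definition r_cl ::
  "('n::finite cvec \<Rightarrow> 'n cvec) \<Rightarrow> 'n cvec set \<Rightarrow> (complex, 'n) tmat \<Rightarrow> (complex, 'n) tmat" where
  "r_cl T \<Gamma>1 s = s + a_cl T \<Gamma>1 + r_st"

text \<open>The formal parameter \<open>\<hbar>\<close> is \<^term>\<open>fps_X :: complex fps\<close>.\<close>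

definition qpow :: "complex \<Rightarrow> complex fps" where
  "qpow y = fps_exp y"

definition q :: "complex fps" where
  "q = qpow 1"

definition to_fps :: "complex ^ 'm ^ 'm \<Rightarrow> complex fps ^ 'm ^ 'm" where
  "to_fps A = (\<chi> r c. fps_const (A $ r $ c))"

text \<open>\<open>q\<^sup>s = exp(\<hbar>s) = \<Sum>\<^sub>m \<hbar>\<^sup>m s\<^sup>m / m!\<close>.\<close>

definition q_pow_mat :: "complex ^ 'm ^ 'm \<Rightarrow> complex fps ^ 'm::finite ^ 'm" where
  "q_pow_mat s = (\<chi> r c. Abs_fps (\<lambda>m. mpow s m $ r $ c / fact m))"

definition GGS_form :: "complex fps \<Rightarrow> bool" where
  "GGS_form f \<longleftrightarrow> (\<exists>x y. \<exists>z\<in>{0, 1::nat}. f = fps_const x * qpow y * (q - inverse q) ^ z)"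

lemma GGS_form_unique:
  assumes "GGS_form f" "GGS_form g" "fps_X ^ 3 dvd f - g"
  shows "f = g"
proof -
  obtain x y z where f: "f = fps_const x * qpow y * (q - inverse q) ^ z" "z \<in> {0, 1}"
    using assms(1) unfolding GGS_form_def by blast
  obtain x' y' z' where g: "g = fps_const x' * qpow y' * (q - inverse q) ^ z'" "z' \<in> {0, 1}"
    using assms(2) unfolding GGS_form_def by blast
  have coeff: "fps_nth f m = fps_nth g m" if m: "m < 3" for m
  proof -
    from assms(3) obtain h where "f - g = fps_X ^ 3 * h" by (elim dvdE)
    then have "fps_nth (f - g) m = 0" using m by (simp add: fps_X_power_mult_nth)
    then show ?thesis by simp
  qed
  have d: "q - inverse q = fps_exp 1 - fps_exp (- 1)"
    by (simp add: q_def qpow_def fps_exp_neg)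
  have n0: "fps_nth (fps_const x * qpow y) 0 = x" "fps_nth (fps_const x * qpow y) 1 = x * y"
    "fps_nth (fps_const x * qpow y * (q - inverse q)) 0 = 0"
    "fps_nth (fps_const x * qpow y * (q - inverse q)) 1 = 2 * x"
    "fps_nth (fps_const x * qpow y * (q - inverse q)) 2 = 2 * x * y" for x y
    unfolding d qpow_def
    by (simp_all add: fps_mult_nth numeral_2_eq_2 mult.assoc)
  show ?thesis
    using f g coeff[of 0] coeff[of 1] coeff[of 2] n0[of x y] n0[of x' y']
    by (cases "x = 0"; cases "x' = 0") auto
qed

definition R_GGS :: "(complex, 'n::finite) tmat \<Rightarrow> (complex fps, 'n) tmat" where
  "R_GGS r = (THE R.
     (\<exists>P. (\<forall>i\<in>{1..CARD('n)}. \<forall>j\<in>{1..CARD('n)}. \<forall>k\<in>{1..CARD('n)}. \<forall>l\<in>{1..CARD('n)}. GGS_form (P i j k l)) \<and>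
          R = (\<Sum>i=1..CARD('n). \<Sum>j=1..CARD('n). \<Sum>k=1..CARD('n). \<Sum>l=1..CARD('n).
                 P i j k l *\<^sub>m (mat_unit i j \<otimes> mat_unit k l))) \<and>
     (\<forall>u v. fps_X ^ 3 dvd
        (R - (mat 1 + (2 * fps_X) *\<^sub>m to_fps r + (2 * fps_X ^ 2) *\<^sub>m to_fps (r ** r))) $ u $ v))"

definition R_st :: "(complex fps, 'n::finite) tmat" where
  "R_st = q *\<^sub>m (\<Sum>i=1..CARD('n). mat_unit i i \<otimes> mat_unit i i)
     + (\<Sum>(i, j) \<in> {(i, j). i \<in> {1..CARD('n)} \<and> j \<in> {1..CARD('n)} \<and> i \<noteq> j}. mat_unit i i \<otimes> mat_unit j j)
     + (q - inverse q) *\<^sub>m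
         (\<Sum>(i, j) \<in> {(i, j). i \<in> {1..CARD('n)} \<and> j \<in> {1..CARD('n)} \<and> i > j}. mat_unit i j \<otimes> mat_unit j i)"

definition J_factor ::
  "('n::finite cvec \<Rightarrow> 'n cvec) \<Rightarrow> 'n cvec set \<Rightarrow> nat \<Rightarrow> (complex fps, 'n) tmat" where
  "J_factor T \<Gamma>1 k = mat 1 + (\<Sum>(\<alpha>, \<beta>) | maps_to T \<Gamma>1 k \<alpha> \<beta>.
     ((- q) powi (- int (orient_C T \<Gamma>1 \<alpha> \<beta> * (root_len \<alpha> - 1))) * qpow (P_a T \<Gamma>1 (\<beta>, - \<alpha>)) * (q - inverse q)) *\<^sub>m
       (root_mat \<beta> \<otimes> root_mat (- \<alpha>)))"

definition max_ord :: "('n::finite cvec \<Rightarrow> 'n cvec) \<Rightarrow> 'n cvec set \<Rightarrow> nat" where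
  "max_ord T \<Gamma>1 = (if TP_plus T \<Gamma>1 = {} then 0 else Max (Ord T \<Gamma>1 ` TP_plus T \<Gamma>1))"

definition J_prod ::
  "('n::finite cvec \<Rightarrow> 'n cvec) \<Rightarrow> 'n cvec set \<Rightarrow> (complex fps, 'n) tmat" where
  "J_prod T \<Gamma>1 = foldr (\<lambda>k X. J_factor T \<Gamma>1 k ** X) [1..<Suc (max_ord T \<Gamma>1)] (mat 1)"

definition R_J ::
  "('n::finite cvec \<Rightarrow> 'n cvec) \<Rightarrow> 'n cvec set \<Rightarrow> (complex, 'n) tmat \<Rightarrow> (complex fps, 'n) tmat" where
  "R_J T \<Gamma>1 s = q_pow_mat s ** matrix_inv (J_prod T \<Gamma>1) ** R_st ** flip (J_prod T \<Gamma>1) ** q_pow_mat s"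

end

theory Submission
  imports Defs
begin

text \<open>
  Put \<open>X = J\<^sup>-\<^sup>1 R\<^sub>s\<^sub>t J\<^sup>2\<^sup>1\<close>, so that \<open>R\<^sub>J = q\<^sup>s X q\<^sup>s\<close>, where \<open>q\<^sup>s\<close> is diagonal. An expression
  \<open>x q\<^sup>y (q - q\<^sup>-\<^sup>1)\<^sup>z\<close> is determined by its terms up to order \<open>\<hbar>\<^sup>2\<close>, so the theorem says that every
  entry of \<open>R\<^sub>J\<close> is such an expression and that \<open>R\<^sub>J \<equiv> 1 + 2\<hbar>r + 2\<hbar>\<^sup>2r\<^sup>2\<close>. The outer factors \<open>q\<^sup>s\<close>
  multiply entries by powers of \<open>q\<close> and replace \<open>\<rho> = a + r\<^sub>s\<^sub>t\<close> by \<open>s + \<rho>\<close> in the expansion; what has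
  to be shown is that the entries of \<open>X\<close> have the required form and that
  \<open>X \<equiv> 1 + 2\<hbar>\<rho> + 2\<hbar>\<^sup>2\<rho>\<^sup>2\<close> (\<open>twisted_matrix_expansion\<close>).

  A root \<open>e\<^sub>i - e\<^sub>j\<close> is a segment of the path \<open>1, \<dots>, n\<close>, and \<open>T\<close> is a partial injection of the
  vertices which is a translation or a reflection on every component of \<open>\<Gamma>\<^sub>1\<close>. Here \<open>iter p x y u v\<close>
  says that \<open>T\<^sup>p\<close>, for any integer \<open>p\<close>, carries the segment from \<open>x\<close> to \<open>y\<close> to the segment from \<open>u\<close>
  to \<open>v\<close>, with \<open>x \<mapsto> u\<close> and \<open>y \<mapsto> v\<close>; reversal of orientation is reversal of the order of the end
  points. The pair \<open>(T\<^sup>k\<alpha>, -\<alpha>)\<close> is passed on the right exactly if some \<open>T\<^sup>t\<close> with \<open>1 \<le> t < k\<close> carries the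
  right end of \<open>\<alpha>\<close> to the left end of \<open>T\<^sup>k\<alpha>\<close> without a reflection at that vertex, and on the left
  exactly if the same holds for the other two ends (\<open>straight_r_iff\<close>, \<open>straight_l_iff\<close>). Thus \<open>q\<^sup>P\<close> is a
  product of diagonal weights, one for each power \<open>T\<^sup>t\<close>, and in the product \<open>J\<close> these weights
  telescope: up to conjugation by a diagonal matrix, \<open>J\<^sup>2\<^sup>1\<close> is \<open>Jtail 1\<close>, where
  \<open>Jtail p = (D\<^sub>p + Tmat p) Jtail (p + 1) D\<^sub>p\<^sup>-\<^sup>1\<close>, the matrix \<open>Tmat p\<close> collects the root vectors
  belonging to \<open>T\<^sup>p\<close>, and \<open>D\<^sub>p\<close> is diagonal. The matrix \<open>R\<^sub>s\<^sub>t\<close> is \<open>D\<^sub>0 + Tmat 0\<close>, the level \<open>p = 0\<close> of the same family.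

  The core is \<open>lower_identity\<close>: for \<open>k \<ge> 0\<close>, the part of \<open>(Jtail (1 - k))\<^sup>2\<^sup>1 Stail k\<close> that is strictly
  lower triangular in the first tensor factor is that of \<open>Jtail k\<close>, where \<open>Stail k\<close> is the sum of the levels \<open>Tmat j\<close>,
  \<open>j \<ge> k\<close>, with diagonal weights. It is proved by downward induction on \<open>k\<close>. Where \<open>T\<^sup>k\<close> is a
  translation, conjugation by it turns \<open>Jtail (1 - k)\<close> into \<open>Jtail (1 + k)\<close>, and the
  terms match because \<open>(q - q\<^sup>-\<^sup>1) + q\<^sup>-\<^sup>1 = q\<close>; where it is a reflection, all terms but one are
  excluded by a grading of the edges which \<open>T\<close> raises by one. For \<open>k = 0\<close> the identity gives the
  entries of \<open>X\<close> below the diagonal: they are the entries of \<open>Stail 0\<close> up to powers of \<open>q\<close>, and the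
  same grading shows that only one level contributes to each of them, so they have the required
  form.

  The entries above the diagonal follow by symmetry. Reversing the path, transposing and substituting
  \<open>-\<hbar>\<close> for \<open>\<hbar>\<close> takes the twist of the reversed triple to \<open>J\<^sup>-\<^sup>1\<close>, and its matrix \<open>X\<close> to \<open>X\<^sup>-\<^sup>1\<close>. Together with \<open>X\<^sup>2\<^sup>1 = X\<^sup>-\<^sup>1 + (q - q\<^sup>-\<^sup>1) P\<close>, which \<open>X\<close> inherits from \<open>R\<^sub>s\<^sub>t\<close>, this
  expresses an entry above the diagonal by the mirror entry below it with \<open>-\<hbar>\<close> in place of \<open>\<hbar>\<close>
  (\<open>twisted_matrix_properties\<close>).

  For the expansion, the term \<open>X\<^sub>1 = 2\<rho>\<close> is read off from \<open>J X = R\<^sub>s\<^sub>t J\<^sup>2\<^sup>1\<close>. The relation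
  \<open>X\<^sup>2\<^sup>1 X = 1 + (q - q\<^sup>-\<^sup>1) P X\<close> gives \<open>X\<^sub>2 + X\<^sub>2\<^sup>2\<^sup>1 = X\<^sub>1\<^sup>2\<close> at order two, and \<open>X\<^sub>2\<close> is symmetric since the
  substitution of \<open>-\<hbar>\<close> does not change coefficients of \<open>\<hbar>\<^sup>2\<close>. Hence \<open>X\<^sub>2 = 2\<rho>\<^sup>2\<close>.
\<close>

section \<open>Straight maps of segments\<close>

lemma converse_relpow:
  fixes r :: "('a \<times> 'a) set"
  shows "(a, b) \<in> (r\<inverse>) ^^ k \<longleftrightarrow> (b, a) \<in> r ^^ k"
proof (induction k arbitrary: a b)
  case (Suc k)
  have "(a, b) \<in> (r\<inverse>) ^^ Suc k \<longleftrightarrow> (\<exists>c. (a, c) \<in> (r\<inverse>) ^^ k \<and> (b, c) \<in> r)"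
    by (simp add: relcomp_unfold)
  also have "\<dots> \<longleftrightarrow> (b, a) \<in> r ^^ Suc k"
    unfolding Suc.IH by (meson relpow_Suc_D2 relpow_Suc_I2)
  finally show ?case .
qed auto

lemma sum_eq_single:
  assumes "finite S" "\<And>u. u \<in> S \<Longrightarrow> u \<noteq> a \<Longrightarrow> f u = 0" "a \<notin> S \<Longrightarrow> f a = 0"
  shows "sum f S = f a"
proof (cases "a \<in> S")
  case True
  have "sum f S = f a + sum f (S - {a})" using assms True by (simp add: sum.remove)
  moreover have "sum f (S - {a}) = 0" using assms(2) by (intro sum.neutral) auto
  ultimately show ?thesis by simp
next
  case False
  then have "sum f S = 0" using assms(2) by (intro sum.neutral) auto
  then show ?thesis using assms(3) False by simp
qed

text \<open>
  The positions \<open>1, \<dots>, N\<close> are the vertices of a path, in which the edge \<open>e\<close> joins \<open>e\<close> and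
  \<open>e + 1\<close> and represents the simple root \<open>\<alpha>\<^sub>e\<close>. A map of simple roots that preserves inner
  products moves each component of its domain \<open>G\<close> rigidly and is therefore induced by a vertex map
  \<open>s\<close>; working with vertices makes the orientation visible. Below, \<open>T\<close> denotes the
  partial map of segments induced by \<open>s\<close>. The grading \<open>ht\<close> expresses that \<open>T\<close> is nilpotent.
\<close>

locale bd_map =
  fixes N :: int and G :: "int set" and s :: "int \<Rightarrow> int" and ht :: "int \<Rightarrow> int"
  assumes G_sub: "G \<subseteq> {1..<N}"
    and s_range: "e \<in> G \<Longrightarrow> s e \<in> {1..N} \<and> s (e + 1) \<in> {1..N}"
    and s_step: "e \<in> G \<Longrightarrow> \<bar>s (e + 1) - s e\<bar> = 1"
    and s_straight: "e \<in> G \<Longrightarrow> e + 1 \<in> G \<Longrightarrow> s (e + 2) - s (e + 1) = s (e + 1) - s e"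
    and s_inj: "inj_on s (G \<union> (\<lambda>e. e + 1) ` G)"
    and ht_step: "e \<in> G \<Longrightarrow> ht (min (s e) (s (e + 1))) = ht e + 1"
begin

definition seg :: "int \<Rightarrow> int \<Rightarrow> bool" where
  "seg x y \<longleftrightarrow> x \<noteq> y \<and> {min x y..<max x y} \<subseteq> G"

definition seg_step :: "((int \<times> int) \<times> (int \<times> int)) set" where
  "seg_step = {((x, y), (s x, s y)) | x y. seg x y}"

text \<open>
  A negative \<open>p\<close> stands for powers of the inverse of the partial injection. The order of the
  end points records the orientation of \<open>T\<^sup>p\<close> on the segment.
\<close>

definition iter :: "int \<Rightarrow> int \<Rightarrow> int \<Rightarrow> int \<Rightarrow> int \<Rightarrow> bool" where
  "iter p x y u v \<longleftrightarrow> x \<in> {1..N} \<and> y \<in> {1..N} \<and> x \<noteq> y \<and>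
     ((x, y), (u, v)) \<in> (if p \<ge> 0 then seg_step ^^ nat p else (seg_step\<inverse>) ^^ nat (- p))"

definition height_sum :: "int \<Rightarrow> int \<Rightarrow> int" where
  "height_sum x y = (\<Sum>e\<in>{min x y..<max x y}. ht e)"

lemma seg_swap: "seg x y \<longleftrightarrow> seg y x"
  by (auto simp: seg_def min.commute max.commute)

lemma seg_trans: "seg x y \<Longrightarrow> seg y z \<Longrightarrow> x \<noteq> z \<Longrightarrow> seg x z"
proof -
  assume a: "seg x y" "seg y z" "x \<noteq> z"
  have "e \<in> {min x y..<max x y} \<or> e \<in> {min y z..<max y z}" if "e \<in> {min x z..<max x z}" for e
    using that by auto
  then show ?thesis using a unfolding seg_def by blast
qed

lemma seg_sub: "seg x y \<Longrightarrow> z \<in> {min x y..max x y} \<Longrightarrow> z \<noteq> x \<Longrightarrow> seg x z"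
  unfolding seg_def by (auto simp: min_def max_def subset_iff split: if_splits)

lemma seg_vertex:
  assumes "seg x y"
  shows "x \<in> G \<union> (\<lambda>e. e + 1) ` G"
proof (cases "x < y")
  case True
  then have "x \<in> {min x y..<max x y}" by auto
  then show ?thesis using assms unfolding seg_def by blast
next
  case False
  then have "x - 1 \<in> {min x y..<max x y}" using assms unfolding seg_def by auto
  then have "x - 1 \<in> G" using assms unfolding seg_def by blast
  then have "x - 1 + 1 \<in> (\<lambda>e. e + 1) ` G" by blast
  then show ?thesis by simp
qed

lemma vertex_range: "x \<in> G \<union> (\<lambda>e. e + 1) ` G \<Longrightarrow> x \<in> {1..N} \<and> s x \<in> {1..N}"
  using G_sub s_range by fastforce

lemma seg_range: "seg x y \<Longrightarrow> x \<in> {1..N} \<and> y \<in> {1..N} \<and> s x \<in> {1..N} \<and> s y \<in> {1..N}"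
  using seg_vertex vertex_range seg_swap by meson

lemma seg_s_inj: "seg x y \<Longrightarrow> seg x' y' \<Longrightarrow> s x = s x' \<Longrightarrow> x = x'"
  using s_inj seg_vertex by (meson inj_onD)

text \<open>
  The first edge decides between a translation and a reflection; straightness at the inner
  vertices propagates the choice along the segment.
\<close>

lemma seg_affine_up:
  assumes "x < y" "{x..<y} \<subseteq> G"
  shows "\<exists>\<epsilon>\<in>{1, -1}. \<forall>z\<in>{x..y}. s z = s x + \<epsilon> * (z - x)"
proof -
  define \<epsilon> where "\<epsilon> = s (x + 1) - s x"
  have "x \<in> G" using assms by auto
  then have e: "\<epsilon> \<in> {1, -1}" using s_step[of x] by (auto simp: \<epsilon>_def)
  have "s (x + int n + 1) - s (x + int n) = \<epsilon>" if "x + int n < y" for n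
    using that
  proof (induction n)
    case 0 then show ?case by (simp add: \<epsilon>_def)
  next
    case (Suc n)
    then have "x + int n \<in> G" "x + int n + 1 \<in> G" using assms(2) by auto
    from s_straight[OF this] Suc show ?case by (simp add: algebra_simps)
  qed note d = this
  have "s (x + int n) = s x + \<epsilon> * int n" if "x + int n \<le> y" for n
    using that
  proof (induction n)
    case (Suc n)
    then show ?case using d[of n] by (simp add: algebra_simps)
  qed simp
  then have "s z = s x + \<epsilon> * (z - x)" if "z \<in> {x..y}" for z
  proof -
    have "z = x + int (nat (z - x))" using that by auto
    then show ?thesis using \<open>\<And>n. x + int n \<le> y \<Longrightarrow> s (x + int n) = s x + \<epsilon> * int n\<close>[of "nat (z - x)"] that by simp
  qed
  with e show ?thesis by blast
qed

lemma seg_affine: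
  assumes "seg x y"
  shows "\<exists>\<epsilon>\<in>{1, -1}. \<forall>z\<in>{min x y..max x y}. s z = s x + \<epsilon> * (z - x)"
proof (cases "x < y")
  case True
  then have "min x y = x" "max x y = y" by auto
  then show ?thesis using seg_affine_up[OF True] assms unfolding seg_def by metis
next
  case False
  then have "y < x" "{y..<x} \<subseteq> G" using assms unfolding seg_def by (auto simp: min_def max_def)
  from seg_affine_up[OF this] obtain \<epsilon> where e: "\<epsilon> \<in> {1, -1}" "\<And>z. z \<in> {y..x} \<Longrightarrow> s z = s y + \<epsilon> * (z - y)"
    by blast
  have "s z = s x + \<epsilon> * (z - x)" if "z \<in> {y..x}" for z
    using e(2)[OF that] e(2)[of x] \<open>y < x\<close> by (simp add: algebra_simps)
  moreover have "min x y = y" "max x y = x" using \<open>y < x\<close> by auto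
  ultimately have "\<forall>z\<in>{min x y..max x y}. s z = s x + \<epsilon> * (z - x)" by metis
  then show ?thesis using e(1) by blast
qed

text \<open>
  The edges of the image of a segment are the images of its edges, each taken once, so the
  vertex map computes the additive extension of the edge map.
\<close>

lemma seg_image:
  assumes "seg x y"
  shows "{min (s x) (s y)..<max (s x) (s y)} = (\<lambda>e. min (s e) (s (e + 1))) ` {min x y..<max x y}" (is ?img)
    and "inj_on (\<lambda>e. min (s e) (s (e + 1))) {min x y..<max x y}" (is ?inj)
proof -
  obtain \<epsilon> where e: "\<epsilon> \<in> {1, -1}" "\<And>z. z \<in> {min x y..max x y} \<Longrightarrow> s z = s x + \<epsilon> * (z - x)"
    using seg_affine[OF assms] by blast
  have sub: "{min x y..<max x y} \<subseteq> G" and "x \<noteq> y" using assms unfolding seg_def by auto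
  let ?f = "\<lambda>e. min (s e) (s (e + 1))"
  have se: "s z = s x + \<epsilon> * (z - x)" "s (z + 1) = s x + \<epsilon> * (z + 1 - x)" if "z \<in> {min x y..<max x y}" for z
    using that e(2)[of z] e(2)[of "z + 1"] by auto
  have sy: "s y = s x + \<epsilon> * (y - x)" using e(2)[of y] by auto
  show ?img
  proof (cases "\<epsilon> = 1")
    case True
    have "?f z = z + (s x - x)" if "z \<in> {min x y..<max x y}" for z using se[OF that] True by auto
    then have "?f ` {min x y..<max x y} = (\<lambda>z. z + (s x - x)) ` {min x y..<max x y}" by auto
    also have "\<dots> = {min x y + (s x - x)..<max x y + (s x - x)}" by (simp add: image_add_atLeastLessThan')
    also have "\<dots> = {min (s x) (s y)..<max (s x) (s y)}" using sy True by (auto simp: min_def max_def)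
    finally show ?thesis ..
  next
    case False
    then have m: "\<epsilon> = -1" using e(1) by auto
    have "?f z = (s x + x - 1) - z" if "z \<in> {min x y..<max x y}" for z using se[OF that] m by auto
    then have *: "?f ` {min x y..<max x y} = (\<lambda>z. (s x + x - 1) - z) ` {min x y..<max x y}" by auto
    have "z \<in> {min (s x) (s y)..<max (s x) (s y)} \<longleftrightarrow> (s x + x - 1) - z \<in> {min x y..<max x y}" for z
      using sy m by (auto simp: min_def max_def)
    then show ?thesis unfolding * by (force simp: image_iff)
  qed
  show ?inj
  proof (rule inj_onI)
    fix a b assume ab: "a \<in> {min x y..<max x y}" "b \<in> {min x y..<max x y}" "?f a = ?f b"
    show "a = b" using se[OF ab(1)] se[OF ab(2)] ab(3) e(1) by (auto simp: min_def split: if_splits)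
  qed
qed

lemma seg_height:
  assumes "seg x y"
  shows "height_sum (s x) (s y) = height_sum x y + \<bar>x - y\<bar>"
proof -
  let ?f = "\<lambda>e. min (s e) (s (e + 1))"
  note img = seg_image(1)[OF assms] and inj = seg_image(2)[OF assms]
  have sub: "{min x y..<max x y} \<subseteq> G" using assms unfolding seg_def by auto
  have "height_sum (s x) (s y) = (\<Sum>e\<in>{min x y..<max x y}. ht (?f e))"
    unfolding height_sum_def img by (simp add: sum.reindex[OF inj])
  also have "\<dots> = (\<Sum>e\<in>{min x y..<max x y}. ht e + 1)"
    using sub ht_step by (intro sum.cong) auto
  also have "\<dots> = height_sum x y + \<bar>x - y\<bar>"
    by (auto simp: height_sum_def sum.distrib min_def max_def)
  finally show ?thesis .
qed

lemma height_sum_swap: "height_sum x y = height_sum y x" by (simp add: height_sum_def min.commute max.commute)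

lemma height_sum_add: "x \<le> y \<Longrightarrow> y \<le> z \<Longrightarrow> height_sum x z = height_sum x y + height_sum y z"
proof -
  assume a: "x \<le> y" "y \<le> z"
  have "{min x z..<max x z} = {x..<y} \<union> {y..<z}" using a by auto
  then show ?thesis unfolding height_sum_def using a by (simp add: sum.union_disjoint)
qed

lemma seg_step_iff: "((x, y), (u, v)) \<in> seg_step \<longleftrightarrow> seg x y \<and> u = s x \<and> v = s y"
  unfolding seg_step_def by auto

lemma seg_steps_vertex: "((x, y), (u, v)) \<in> seg_step ^^ k \<Longrightarrow> u = (s ^^ k) x \<and> v = (s ^^ k) y"
  by (induction k arbitrary: u v) (auto simp: seg_step_iff)

lemma seg_steps_swap: "((x, y), (u, v)) \<in> seg_step ^^ k \<Longrightarrow> ((y, x), (v, u)) \<in> seg_step ^^ k"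
proof (induction k arbitrary: u v)
  case (Suc k)
  then obtain p r where "((x, y), (p, r)) \<in> seg_step ^^ k" "((p, r), (u, v)) \<in> seg_step" by auto
  then have "((y, x), (r, p)) \<in> seg_step ^^ k" "((r, p), (v, u)) \<in> seg_step" using Suc seg_swap by (auto simp: seg_step_iff)
  then show ?case by auto
qed auto

lemma seg_steps_inj: "((x, y), (u, v)) \<in> seg_step ^^ k \<Longrightarrow> ((x', y'), (u, v')) \<in> seg_step ^^ k \<Longrightarrow> x = x'"
proof (induction k arbitrary: u v v')
  case (Suc k)
  then obtain p r p' r' where a: "((x, y), (p, r)) \<in> seg_step ^^ k" "((p, r), (u, v)) \<in> seg_step"
    "((x', y'), (p', r')) \<in> seg_step ^^ k" "((p', r'), (u, v')) \<in> seg_step" by auto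
  then have "p = p'" using seg_s_inj by (auto simp: seg_step_iff)
  then show ?case using a Suc.IH by blast
qed auto

lemma seg_steps_ne: "((x, y), (u, v)) \<in> seg_step ^^ k \<Longrightarrow> x \<noteq> y \<Longrightarrow> u \<noteq> v"
proof (induction k arbitrary: u v)
  case (Suc k)
  then obtain p r where "((x, y), (p, r)) \<in> seg_step ^^ k" "((p, r), (u, v)) \<in> seg_step" by auto
  then have "p \<noteq> r" "seg p r" "seg r p" "u = s p" "v = s r" using Suc seg_swap by (auto simp: seg_step_iff)
  then show ?case using seg_s_inj[of p r r p] by auto
qed auto

lemma seg_steps_concat:
  assumes "((x, y), (u, v)) \<in> seg_step ^^ k" "((y, z), (v', w)) \<in> seg_step ^^ k" "x \<noteq> z"
  shows "((x, z), (u, w)) \<in> seg_step ^^ k"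
  using assms(1,2)
proof (induction k arbitrary: u v v' w)
  case (Suc k)
  then obtain p r r' t where a: "((x, y), (p, r)) \<in> seg_step ^^ k" "((p, r), (u, v)) \<in> seg_step"
    "((y, z), (r', t)) \<in> seg_step ^^ k" "((r', t), (v', w)) \<in> seg_step" by auto
  have "r = r'" using seg_steps_vertex[OF a(1)] seg_steps_vertex[OF a(3)] by simp
  have "((x, z), (p, t)) \<in> seg_step ^^ k" using Suc.IH[OF a(1,3)] .
  moreover have "p \<noteq> t" using seg_steps_ne[OF calculation assms(3)] .
  ultimately show ?case using a \<open>r = r'\<close> seg_trans[of p r t] by (auto simp: seg_step_iff)
qed (use assms in auto)

text \<open>
  On a segment where it is defined, every iterate is a translation (\<open>\<epsilon> = 1\<close>) or a reflection
  (\<open>\<epsilon> = -1\<close>), since these are closed under composition.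
\<close>

lemma seg_steps_affine:
  assumes "((x, y), (u, v)) \<in> seg_step ^^ k"
  shows "\<exists>\<epsilon>\<in>{1, -1}. v = u + \<epsilon> * (y - x) \<and>
     (\<forall>z\<in>{min x y..max x y}. z \<noteq> x \<longrightarrow> ((x, z), (u, u + \<epsilon> * (z - x))) \<in> seg_step ^^ k)"
  using assms
proof (induction k arbitrary: u v)
  case 0 then show ?case by auto
next
  case (Suc k)
  then obtain p r where a: "((x, y), (p, r)) \<in> seg_step ^^ k" "((p, r), (u, v)) \<in> seg_step" by auto
  obtain \<epsilon> where e: "\<epsilon> \<in> {1, -1}" "r = p + \<epsilon> * (y - x)"
    "\<And>z. z \<in> {min x y..max x y} \<Longrightarrow> z \<noteq> x \<Longrightarrow> ((x, z), (p, p + \<epsilon> * (z - x))) \<in> seg_step ^^ k"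
    using Suc.IH[OF a(1)] by blast
  have seg: "seg p r" and uv: "u = s p" "v = s r" using a(2) by (auto simp: seg_step_iff)
  obtain \<delta> where d: "\<delta> \<in> {1, -1}" "\<And>z. z \<in> {min p r..max p r} \<Longrightarrow> s z = s p + \<delta> * (z - p)"
    using seg_affine[OF seg] by blast
  have in_r: "p + \<epsilon> * (z - x) \<in> {min p r..max p r}" if "z \<in> {min x y..max x y}" for z
    using that e(1,2) by (auto simp: min_def max_def split: if_splits)
  have v: "v = u + (\<delta> * \<epsilon>) * (y - x)" using d(2)[of r] uv e(2) by auto
  have "((x, z), (u, u + (\<delta> * \<epsilon>) * (z - x))) \<in> seg_step ^^ Suc k" if z: "z \<in> {min x y..max x y}" "z \<noteq> x" for z
  proof -
    have "seg p (p + \<epsilon> * (z - x))" using seg_sub[OF seg in_r[OF z(1)]] z(2) e(1) by auto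
    moreover have "s (p + \<epsilon> * (z - x)) = u + (\<delta> * \<epsilon>) * (z - x)" using d(2)[OF in_r[OF z(1)]] uv by simp
    ultimately show ?thesis using e(3)[OF z] uv by (auto simp: seg_step_iff intro!: relcompI)
  qed
  moreover have "\<delta> * \<epsilon> \<in> {1, -1}" using d(1) e(1) by auto
  ultimately show ?case using v by blast
qed

lemma seg_steps_height: "((x, y), (u, v)) \<in> seg_step ^^ k \<Longrightarrow> height_sum u v = height_sum x y + int k * \<bar>x - y\<bar>"
proof (induction k arbitrary: u v)
  case (Suc k)
  then obtain p r where a: "((x, y), (p, r)) \<in> seg_step ^^ k" "((p, r), (u, v)) \<in> seg_step" by auto
  have "\<bar>p - r\<bar> = \<bar>x - y\<bar>" using seg_steps_affine[OF a(1)] by auto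
  then show ?case using Suc.IH[OF a(1)] seg_height[of p r] a(2) by (auto simp: seg_step_iff algebra_simps)
qed simp

lemma seg_steps_range: "((x, y), (u, v)) \<in> seg_step ^^ k \<Longrightarrow> k > 0 \<Longrightarrow> x \<in> {1..N} \<and> y \<in> {1..N} \<and> u \<in> {1..N} \<and> v \<in> {1..N} \<and> x \<noteq> y \<and> u \<noteq> v"
proof -
  assume a: "((x, y), (u, v)) \<in> seg_step ^^ k" "k > 0"
  then obtain j where k: "k = Suc j" using gr0_implies_Suc by blast
  have "((x, y), (u, v)) \<in> seg_step ^^ j O seg_step" using a k by simp
  then obtain p r where b: "((p, r), (u, v)) \<in> seg_step" by auto
  obtain p' r' where c: "((x, y), (p', r')) \<in> seg_step" using relpow_Suc_D2[of "(x, y)" "(u, v)" j seg_step] a k by auto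
  have "x \<noteq> y" using c by (auto simp: seg_step_iff seg_def)
  then show ?thesis using b c seg_range[of p r] seg_range[of x y] seg_steps_ne[OF a(1)] by (auto simp: seg_step_iff)
qed

lemma conv_pow: "((x, y), (u, v)) \<in> (seg_step\<inverse>) ^^ k \<longleftrightarrow> ((u, v), (x, y)) \<in> seg_step ^^ k"
  by (simp add: converse_relpow)

lemma iter_nonneg: "iter (int k) x y u v \<longleftrightarrow> x \<in> {1..N} \<and> y \<in> {1..N} \<and> x \<noteq> y \<and> ((x, y), (u, v)) \<in> seg_step ^^ k"
  by (simp add: iter_def)

lemma iter_range: "iter p x y u v \<Longrightarrow> x \<in> {1..N} \<and> y \<in> {1..N} \<and> u \<in> {1..N} \<and> v \<in> {1..N} \<and> x \<noteq> y \<and> u \<noteq> v"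
proof (cases "p > 0")
  case True
  then show "iter p x y u v \<Longrightarrow> ?thesis" using seg_steps_range[of x y u v "nat p"] by (auto simp: iter_def)
next
  case False
  show "iter p x y u v \<Longrightarrow> ?thesis"
  proof (cases "p = 0")
    case True then show "iter p x y u v \<Longrightarrow> ?thesis" by (auto simp: iter_def)
  next
    case f: False
    assume "iter p x y u v"
    then have "((u, v), (x, y)) \<in> seg_step ^^ nat (- p)" using False f by (auto simp: iter_def conv_pow)
    from seg_steps_range[OF this] show ?thesis using False f by auto
  qed
qed

lemma iter_inv: "iter p x y u v \<longleftrightarrow> iter (- p) u v x y"
proof -
  have "iter p x y u v \<Longrightarrow> iter (- p) u v x y" for p x y u v
    using iter_range[of p x y u v] unfolding iter_def by (cases "p = 0") (auto simp: conv_pow split: if_splits)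
  from this[of p x y u v] this[of "- p" u v x y] show ?thesis by auto
qed

lemma iter_swap: "iter p x y u v \<longleftrightarrow> iter p y x v u"
proof -
  have "iter p x y u v \<Longrightarrow> iter p y x v u" for p x y u v
    unfolding iter_def using seg_steps_swap by (auto simp: conv_pow split: if_splits)
  from this[of p x y u v] this[of p y x v u] show ?thesis by blast
qed

lemma iter_0: "iter 0 x y u v \<longleftrightarrow> x \<in> {1..N} \<and> y \<in> {1..N} \<and> x \<noteq> y \<and> u = x \<and> v = y"
  by (auto simp: iter_def)

lemma iter_cases:
  assumes "iter p x y u v"
  obtains k where "p = int k" "((x, y), (u, v)) \<in> seg_step ^^ k" | k where "p = - int k" "((u, v), (x, y)) \<in> seg_step ^^ k"
proof (cases "p \<ge> 0")
  case True
  then show ?thesis using assms that(1)[of "nat p"] by (simp add: iter_def)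
next
  case False
  then show ?thesis using assms that(2)[of "nat (- p)"] by (simp add: iter_def conv_pow)
qed

lemma iter_neg: "iter (- int k) x y u v \<longleftrightarrow> iter (int k) u v x y"
  using iter_inv[of "- int k"] by simp

lemma iter_vertex: 
  assumes "iter p x y u v" "iter p x z u' w" 
  shows "u = u'"
  using assms(1)
proof (cases rule: iter_cases)
  case (1 k)
  then have "((x, z), (u', w)) \<in> seg_step ^^ k" using assms(2) by (simp add: iter_nonneg)
  then show ?thesis using seg_steps_vertex[of x z u' w k] seg_steps_vertex[OF 1(2)] by simp
next
  case (2 k)
  then have "((u', w), (x, z)) \<in> seg_step ^^ k" using assms(2) by (simp add: iter_neg iter_nonneg)
  then show ?thesis using 2 seg_steps_inj by blast
qed

lemma iter_concat:
  assumes "iter p x y u v" "iter p y z v' w" "x \<noteq> z"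
  shows "iter p x z u w"
  using assms(1)
proof (cases rule: iter_cases)
  case (1 k)
  then show ?thesis using assms seg_steps_concat[of x y u v k z v' w] by (auto simp: iter_nonneg)
next
  case (2 k)
  have "v = v'" using iter_vertex[of p y x v u z v' w] assms(1,2) iter_swap[of p x y u v] by simp
  have m: "iter (int k) u v x y" "iter (int k) v w y z" using assms(1,2) 2 \<open>v = v'\<close> by (auto simp: iter_neg)
  have "x = (s ^^ k) u" "z = (s ^^ k) w" using m seg_steps_vertex unfolding iter_nonneg by blast+
  then have "u \<noteq> w" using assms(3) by auto
  then show ?thesis using m seg_steps_concat[of u v x y k w y z] 2 by (auto simp: iter_neg iter_nonneg)
qed

lemma iter_affine:
  assumes "iter p x y u v"
  shows "\<exists>\<epsilon>\<in>{1, -1}. v = u + \<epsilon> * (y - x) \<and>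
     (\<forall>z\<in>{min x y..max x y}. z \<noteq> x \<longrightarrow> iter p x z u (u + \<epsilon> * (z - x)))"
  using assms
proof (cases rule: iter_cases)
  case (1 k)
  have "z \<in> {1..N}" if "z \<in> {min x y..max x y}" for z
    using that assms by (auto simp: iter_def)
  then show ?thesis using seg_steps_affine[OF 1(2)] assms unfolding 1(1) iter_nonneg by fastforce
next
  case (2 k)
  obtain \<epsilon> where e: "\<epsilon> \<in> {1, -1}" "y = x + \<epsilon> * (v - u)"
    "\<And>z. z \<in> {min u v..max u v} \<Longrightarrow> z \<noteq> u \<Longrightarrow> ((u, z), (x, x + \<epsilon> * (z - u))) \<in> seg_step ^^ k"
    using seg_steps_affine[OF 2(2)] by blast
  have ee: "\<epsilon> * \<epsilon> = 1" using e(1) by auto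
  have v: "v = u + \<epsilon> * (y - x)" using e(1,2) by auto
  have "iter p x z u (u + \<epsilon> * (z - x))" if z: "z \<in> {min x y..max x y}" "z \<noteq> x" for z
  proof -
    have 1: "u + \<epsilon> * (z - x) \<in> {min u v..max u v}" using z e(1) v by (auto simp: min_def max_def split: if_splits)
    have 2: "u + \<epsilon> * (z - x) \<noteq> u" using z e(1) by auto
    have 3: "x + \<epsilon> * (u + \<epsilon> * (z - x) - u) = z" using ee by (simp add: mult.assoc[symmetric])
    have "u + \<epsilon> * (z - x) \<in> {1..N}" using 1 iter_range[OF assms] by auto
    then have "iter (int k) u (u + \<epsilon> * (z - x)) x z"
      using e(3)[OF 1 2] 3 2 iter_range[OF assms] z by (auto simp: iter_nonneg)
    then show ?thesis using \<open>p = - int k\<close> by (simp add: iter_neg)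
  qed
  then show ?thesis using e(1) v by blast
qed

text \<open>
  This determines \<open>p\<close> by a segment and its image. It is the numerical reason why different
  levels of the twist do not interfere.
\<close>

lemma iter_height: "iter p x y u v \<Longrightarrow> height_sum u v = height_sum x y + p * \<bar>x - y\<bar>"
proof -
  assume m: "iter p x y u v"
  then show ?thesis
  proof (cases rule: iter_cases)
    case (1 k) then show ?thesis using seg_steps_height by simp
  next
    case (2 k)
    have "\<bar>u - v\<bar> = \<bar>x - y\<bar>" using iter_affine[OF m] by auto
    then show ?thesis using seg_steps_height[OF 2(2)] 2(1) by simp
  qed
qed

lemma iter_seg_step:
  assumes "((x, y), (p, r)) \<in> seg_step"
  shows "iter j p r u v \<longleftrightarrow> iter (j + 1) x y u v"
proof -
  have s: "seg x y" "p = s x" "r = s y" using assms by (auto simp: seg_step_iff)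
  have rg: "x \<in> {1..N}" "y \<in> {1..N}" "p \<in> {1..N}" "r \<in> {1..N}" "x \<noteq> y" "p \<noteq> r"
    using seg_range[OF s(1)] s seg_steps_ne[of x y p r 1] assms by (auto simp: seg_def)
  show ?thesis
  proof (cases "j \<ge> 0")
    case True
    then obtain k where k: "j = int k" using nonneg_eq_int by blast
    have "((x, y), (u, v)) \<in> seg_step ^^ Suc k \<longleftrightarrow> ((p, r), (u, v)) \<in> seg_step ^^ k"
    proof
      assume "((x, y), (u, v)) \<in> seg_step ^^ Suc k"
      then obtain c where "((x, y), c) \<in> seg_step" "(c, (u, v)) \<in> seg_step ^^ k" by (meson relpow_Suc_D2)
      then show "((p, r), (u, v)) \<in> seg_step ^^ k" using s by (cases c) (auto simp: seg_step_iff)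
    next
      assume "((p, r), (u, v)) \<in> seg_step ^^ k"
      then show "((x, y), (u, v)) \<in> seg_step ^^ Suc k" using assms by (meson relpow_Suc_I2)
    qed
    then show ?thesis using rg k iter_nonneg[of k p r u v] iter_nonneg[of "Suc k" x y u v] by (simp add: add.commute)
  next
    case False
    then have k: "j = - int (Suc (nat (- j - 1)))" by simp
    define k where "k = nat (- j - 1)"
    note k = k[folded k_def]
    have *: "((u, v), (p, r)) \<in> seg_step ^^ Suc k \<longleftrightarrow> ((u, v), (x, y)) \<in> seg_step ^^ k"
    proof
      assume "((u, v), (p, r)) \<in> seg_step ^^ Suc k"
      then obtain c d where c: "((u, v), (c, d)) \<in> seg_step ^^ k" "((c, d), (p, r)) \<in> seg_step" by auto
      then have cd: "seg c d" "s c = s x" "s d = s y" using s by (auto simp: seg_step_iff)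
      have "c = x" using seg_s_inj[OF cd(1) s(1) cd(2)] .
      moreover have "d = y" using seg_s_inj[OF _ _ cd(3)] cd(1) s(1) seg_swap by blast
      ultimately have "c = x \<and> d = y" ..
      then show "((u, v), (x, y)) \<in> seg_step ^^ k" using c by simp
    next
      assume "((u, v), (x, y)) \<in> seg_step ^^ k"
      then show "((u, v), (p, r)) \<in> seg_step ^^ Suc k" using assms by auto
    qed
    have "iter j p r u v \<longleftrightarrow> iter (int (Suc k)) u v p r" unfolding k by (rule iter_neg)
    also have "\<dots> \<longleftrightarrow> iter (int k) u v x y"
    proof
      assume "iter (int (Suc k)) u v p r" then show "iter (int k) u v x y" unfolding iter_nonneg * by simp
    next
      assume "iter (int k) u v x y" then show "iter (int (Suc k)) u v p r" unfolding iter_nonneg * by simp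
    qed
    also have "\<dots> \<longleftrightarrow> iter (j + 1) x y u v" using iter_neg[of k x y u v] k by simp
    finally show ?thesis .
  qed
qed

lemma seg_steps_compose: "((x, y), (p, r)) \<in> seg_step ^^ k \<Longrightarrow> iter j p r u v \<longleftrightarrow> iter (j + int k) x y u v"
proof (induction k arbitrary: p r j)
  case (Suc k)
  then obtain c d where c: "((x, y), (c, d)) \<in> seg_step ^^ k" "((c, d), (p, r)) \<in> seg_step" by auto
  have "iter j p r u v \<longleftrightarrow> iter (j + 1) c d u v" using iter_seg_step[OF c(2)] .
  also have "\<dots> \<longleftrightarrow> iter (j + 1 + int k) x y u v" using Suc.IH[OF c(1)] .
  finally show ?case by (simp add: algebra_simps)
qed auto

text \<open>
  Along an orbit, powers compose like integers, also when the exponents have opposite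
  signs: the partial map is injective.
\<close>

lemma iter_compose:
  assumes "iter k x y p r"
  shows "iter j p r u v \<longleftrightarrow> iter (j + k) x y u v"
  using assms
proof (cases rule: iter_cases)
  case (1 i) then show ?thesis using seg_steps_compose by simp
next
  case (2 i) then show ?thesis using seg_steps_compose[OF 2(2), of "j + k" u v] by simp
qed

lemma iter_defined_at_mono:
  assumes "iter (int (i + j)) x y u v"
  shows "\<exists>p r. iter (int i) x y p r"
proof -
  have "((x, y), (u, v)) \<in> seg_step ^^ i O seg_step ^^ j" using assms unfolding iter_nonneg relpow_add by blast
  then obtain p r where "((x, y), (p, r)) \<in> seg_step ^^ i" by auto
  then show ?thesis using iter_range[OF assms] unfolding iter_nonneg by blast
qed

lemma iter_im_mono:
  assumes "iter (int (i + j)) x y u v"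
  shows "\<exists>p r. iter (int j) p r u v"
proof -
  obtain p r where "iter (int i) x y p r" using iter_defined_at_mono assms by blast
  then show ?thesis using assms iter_compose[of "int i" x y p r "int j" u v] by (metis add.commute of_nat_add)
qed

text \<open>
  Height sums lie between plus and minus half this number, and each application of \<open>T\<close> raises
  them by at least one.
\<close>

definition order_bound :: int where "order_bound = 2 * (\<Sum>e\<in>{1..<N}. \<bar>ht e\<bar>)"

lemma order_bound_nonneg: "order_bound \<ge> 0" unfolding order_bound_def by (simp add: sum_nonneg)

lemma iter_le_order_bound: "iter p x y u v \<Longrightarrow> p \<le> order_bound"
proof -
  assume m: "iter p x y u v"
  have bd: "\<bar>height_sum a b\<bar> \<le> (\<Sum>e\<in>{1..<N}. \<bar>ht e\<bar>)" if "a \<in> {1..N}" "b \<in> {1..N}" for a b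
  proof -
    have "\<bar>height_sum a b\<bar> \<le> (\<Sum>e\<in>{min a b..<max a b}. \<bar>ht e\<bar>)" unfolding height_sum_def by (rule sum_abs)
    also have "\<dots> \<le> (\<Sum>e\<in>{1..<N}. \<bar>ht e\<bar>)" using that by (intro sum_mono2) auto
    finally show ?thesis .
  qed
  have "p * \<bar>x - y\<bar> \<le> order_bound" using iter_height[OF m] bd[of u v] bd[of x y] iter_range[OF m] unfolding order_bound_def by auto
  have "\<bar>x - y\<bar> \<ge> 1" using iter_range[OF m] by auto
  show ?thesis
  proof (cases "p \<le> 0")
    case False
    then have "p * 1 \<le> p * \<bar>x - y\<bar>" using \<open>\<bar>x - y\<bar> \<ge> 1\<close> by (intro mult_left_mono) auto
    then show ?thesis using \<open>p * \<bar>x - y\<bar> \<le> order_bound\<close> by simp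
  qed (use order_bound_nonneg in auto)
qed


section \<open>Straight vertices\<close>

definition defined_at :: "int \<Rightarrow> int \<Rightarrow> int \<Rightarrow> bool" where
  "defined_at p x y \<longleftrightarrow> (\<exists>u v. iter p x y u v)"

text \<open>
  \<open>T\<^sup>p\<close> carries \<open>x\<close> to \<open>y\<close> and is a translation on some segment that ends in \<open>x\<close>, hence on every
  such segment where it is defined (\<open>straight_iter\<close>).
\<close>

definition straight :: "int \<Rightarrow> int \<Rightarrow> int \<Rightarrow> bool" where
  "straight p x y \<longleftrightarrow> (\<exists>b d. iter p x b y d \<and> d - y = b - x)"

lemma iter_dich:
  assumes "iter p x y u v"
  obtains "v - u = y - x" | "v - u = x - y"
  using iter_affine[OF assms] by auto

lemma iter_shift_sub1:
  assumes "iter p x y u v" "v - u = y - x" "z \<in> {min x y..max x y}" "z \<noteq> x"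
  shows "iter p x z u (u + (z - x))"
proof -
  obtain \<epsilon> where e: "\<epsilon> \<in> {1, -1}" "v = u + \<epsilon> * (y - x)" "iter p x z u (u + \<epsilon> * (z - x))"
    using iter_affine[OF assms(1)] assms by blast
  have "\<epsilon> = 1" using e assms(2) iter_range[OF assms(1)] by auto
  then show ?thesis using e by simp
qed

lemma iter_refl_sub1:
  assumes "iter p x y u v" "v - u = x - y" "z \<in> {min x y..max x y}" "z \<noteq> x"
  shows "iter p x z u (u - (z - x))"
proof -
  obtain \<epsilon> where e: "\<epsilon> \<in> {1, -1}" "v = u + \<epsilon> * (y - x)" "iter p x z u (u + \<epsilon> * (z - x))"
    using iter_affine[OF assms(1)] assms by blast
  have "\<epsilon> = -1" using e assms(2) iter_range[OF assms(1)] by auto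
  then show ?thesis using e by (simp add: algebra_simps)
qed

lemma iter_shift_sub:
  assumes "iter p l t (l + \<delta>) (t + \<delta>)" "l < t" "a \<in> {l..t}" "b \<in> {l..t}" "a \<noteq> b"
  shows "iter p a b (a + \<delta>) (b + \<delta>)"
proof -
  have l: "iter p l z (l + \<delta>) (z + \<delta>)" if "z \<in> {l..t}" "z \<noteq> l" for z
    using iter_shift_sub1[OF assms(1), of z] that assms(2) by (auto simp: algebra_simps)
  consider "a = l" | "b = l" | "a \<noteq> l" "b \<noteq> l" "a < b" | "a \<noteq> l" "b \<noteq> l" "b < a" using assms by linarith
  then show ?thesis
  proof cases
    case 1 then show ?thesis using l[of b] assms by auto
  next
    case 2 then show ?thesis using l[of a] assms iter_swap by auto
  next
    case 3
    have "iter p b l (b + \<delta>) (l + \<delta>)" using l[of b] assms 3 iter_swap by auto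
    from iter_shift_sub1[OF this, of a] 3 assms have "iter p b a (b + \<delta>) (a + \<delta>)" by (auto simp: algebra_simps)
    then show ?thesis using iter_swap by blast
  next
    case 4
    have "iter p a l (a + \<delta>) (l + \<delta>)" using l[of a] assms 4 iter_swap by auto
    from iter_shift_sub1[OF this, of b] 4 assms show "iter p a b (a + \<delta>) (b + \<delta>)" by (auto simp: algebra_simps)
  qed
qed

lemma iter_refl_sub:
  assumes "iter p l t (\<kappa> - l) (\<kappa> - t)" "l < t" "a \<in> {l..t}" "b \<in> {l..t}" "a \<noteq> b"
  shows "iter p a b (\<kappa> - a) (\<kappa> - b)"
proof -
  have l: "iter p l z (\<kappa> - l) (\<kappa> - z)" if "z \<in> {l..t}" "z \<noteq> l" for z
    using iter_refl_sub1[OF assms(1), of z] that assms(2) by (auto simp: algebra_simps)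
  consider "a = l" | "b = l" | "a \<noteq> l" "b \<noteq> l" "a < b" | "a \<noteq> l" "b \<noteq> l" "b < a" using assms by linarith
  then show ?thesis
  proof cases
    case 1 then show ?thesis using l[of b] assms by auto
  next
    case 2 then show ?thesis using l[of a] assms iter_swap by auto
  next
    case 3
    have "iter p b l (\<kappa> - b) (\<kappa> - l)" using l[of b] assms 3 iter_swap by auto
    from iter_refl_sub1[OF this, of a] 3 assms have "iter p b a (\<kappa> - b) (\<kappa> - a)" by (auto simp: algebra_simps)
    then show ?thesis using iter_swap by blast
  next
    case 4
    have "iter p a l (\<kappa> - a) (\<kappa> - l)" using l[of a] assms 4 iter_swap by auto
    from iter_refl_sub1[OF this, of b] 4 assms show "iter p a b (\<kappa> - a) (\<kappa> - b)" by (auto simp: algebra_simps)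
  qed
qed

lemma iter_inj: "iter p x y u v \<Longrightarrow> iter p x' z u w \<Longrightarrow> x = x'"
  using iter_vertex[of "- p" u v x y w x' z] iter_inv by blast

lemma M_inj': "iter p y x v u \<Longrightarrow> iter p z x' w u \<Longrightarrow> x = x'"
  using iter_inj[of p x y u v x' z w] iter_swap by blast

lemma M_vertex': "iter p y x v u \<Longrightarrow> iter p z x w u' \<Longrightarrow> u = u'"
  using iter_vertex[of p x y u v z u' w] iter_swap by blast

text \<open>
  Consider the two edges at \<open>x\<close> that begin the two segments. If they are equal, the values
  at their other end disagree; if they are opposite, both are mapped to the same edge at \<open>y\<close>,
  against injectivity.
\<close>

lemma iter_no_mixed:
  assumes "iter p x b y d" "d - y = b - x" "iter p x c y' e" "e - y' = x - c"
  shows False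
proof -
  have yy: "y = y'" using iter_vertex assms(1,3) by blast
  define i where "i = (if x < b then x + 1 else x - 1)"
  define j where "j = (if x < c then x + 1 else x - 1)"
  have ne: "x \<noteq> b" "x \<noteq> c" using iter_range assms(1,3) by blast+
  have 1: "iter p x i y (y + (i - x))"
    using iter_shift_sub1[OF assms(1,2), of i] ne unfolding i_def by (auto split: if_splits)
  have 2: "iter p x j y (y - (j - x))"
    using iter_refl_sub1[OF assms(3,4), of j] ne yy unfolding j_def by (auto split: if_splits)
  show False
  proof (cases "i = j")
    case True
    then have "y + (i - x) = y - (i - x)" using M_vertex'[of p x i y _ x y] 1 2 by blast
    then show False unfolding i_def by (auto split: if_splits)
  next
    case False
    then have "j - x = - (i - x)" unfolding i_def j_def by (auto split: if_splits)
    then have "y - (j - x) = y + (i - x)" by simp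
    then have "iter p x j y (y + (i - x))" using 2 by metis
    then have "i = j" using M_inj'[OF 1] by blast
    then show False using False by simp
  qed
qed

lemma straight_vertex: "straight p x y \<Longrightarrow> straight p x y' \<Longrightarrow> y = y'"
  unfolding straight_def using iter_vertex by blast

lemma straight_iter: "straight p x y \<Longrightarrow> iter p x c u v \<Longrightarrow> u = y \<and> v - u = c - x"
proof -
  assume a: "straight p x y" "iter p x c u v"
  then obtain b d where b: "iter p x b y d" "d - y = b - x" unfolding straight_def by blast
  have "u = y" using iter_vertex a(2) b(1) by blast
  then show ?thesis using iter_dich[OF a(2)] iter_no_mixed[OF b a(2)] by metis
qed

lemma straight_inv: "straight p x y \<longleftrightarrow> straight (- p) y x"
proof -
  have "straight p x y \<Longrightarrow> straight (- p) y x" for p x y unfolding straight_def using iter_inv by (metis)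
  from this[of p x y] this[of "- p" y x] show ?thesis by auto
qed

lemma straight_inj: "straight p x y \<Longrightarrow> straight p x' y \<Longrightarrow> x = x'"
  using straight_inv straight_vertex by blast

lemma defined_at_swap: "defined_at p x y \<Longrightarrow> defined_at p y x" unfolding defined_at_def using iter_swap by blast

lemma defined_at_concat: "defined_at p x y \<Longrightarrow> defined_at p y z \<Longrightarrow> x \<noteq> z \<Longrightarrow> defined_at p x z"
  unfolding defined_at_def using iter_concat by blast

lemma defined_at_sub: "defined_at p l t \<Longrightarrow> l < t \<Longrightarrow> a \<in> {l..t} \<Longrightarrow> b \<in> {l..t} \<Longrightarrow> a \<noteq> b \<Longrightarrow> defined_at p a b"
proof -
  assume a: "defined_at p l t" "l < t" "a \<in> {l..t}" "b \<in> {l..t}" "a \<noteq> b"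
  then obtain u v where m: "iter p l t u v" unfolding defined_at_def by blast
  from m show "defined_at p a b"
  proof (cases rule: iter_dich)
    case 1
    then have e: "l + (u - l) = u" "t + (u - l) = v" by auto
    have "iter p l t (l + (u - l)) (t + (u - l))" unfolding e by (rule m)
    from iter_shift_sub[OF this a(2-)] show ?thesis unfolding defined_at_def by blast
  next
    case 2
    then have e: "(u + l) - l = u" "(u + l) - t = v" by auto
    have "iter p l t ((u + l) - l) ((u + l) - t)" unfolding e by (rule m)
    from iter_refl_sub[OF this a(2-)] show ?thesis unfolding defined_at_def by blast
  qed
qed

lemma defined_at_mono: "defined_at p x y \<Longrightarrow> 0 \<le> i \<Longrightarrow> i \<le> p \<Longrightarrow> defined_at i x y"
  unfolding defined_at_def using iter_defined_at_mono[of "nat i" "nat (p - i)" x y] by auto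

lemma defined_at_neg_mono: "defined_at (- p) x y \<Longrightarrow> 0 \<le> i \<Longrightarrow> i \<le> p \<Longrightarrow> defined_at (- i) x y"
proof -
  assume a: "defined_at (- p) x y" "0 \<le> i" "i \<le> p"
  then obtain u v where "iter p u v x y" unfolding defined_at_def using iter_inv by (metis add.inverse_inverse)
  then have "iter (int (nat (p - i) + nat i)) u v x y" using a by simp
  then obtain u' v' where "iter i u' v' x y" using iter_im_mono a(2) by fastforce
  then show ?thesis unfolding defined_at_def using iter_inv by blast
qed

end

section \<open>Matrices indexed by pairs of positions\<close>

text \<open>
  The numbering \<open>vx\<close> identifies positions with tensor indices; \<open>entry A x y z w\<close> is the
  coefficient of \<open>e\<^sub>x\<^sub>z \<otimes> e\<^sub>y\<^sub>w\<close>. Entries outside the range are \<open>0\<close>, so that identities between entries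
  need no range conditions.
\<close>

locale bd_mat = bd_map N G s ht for N G s ht +
  fixes vx :: "int \<Rightarrow> 'n::finite"
  assumes vx_bij: "bij_betw vx {1..N} UNIV"
begin

definition pos :: "'n \<Rightarrow> int" where "pos x = inv_into {1..N} vx x"

definition pairs_ix :: "(int \<times> int) set" where "pairs_ix = {1..N} \<times> {1..N}"

definition entry :: "('a::zero, 'n) tmat \<Rightarrow> int \<Rightarrow> int \<Rightarrow> int \<Rightarrow> int \<Rightarrow> 'a" where
  "entry A x y z w = (if (x, y) \<in> pairs_ix \<and> (z, w) \<in> pairs_ix then A $ (vx x, vx y) $ (vx z, vx w) else 0)"

definition of_entries :: "(int \<Rightarrow> int \<Rightarrow> int \<Rightarrow> int \<Rightarrow> 'a::zero) \<Rightarrow> ('a, 'n) tmat" where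
  "of_entries f = (\<chi> r c. f (pos (fst r)) (pos (snd r)) (pos (fst c)) (pos (snd c)))"

lemma pos_vx: "x \<in> {1..N} \<Longrightarrow> pos (vx x) = x"
  unfolding pos_def using vx_bij by (simp add: bij_betw_def)

lemma vx_pos: "vx (pos x) = x" and pos_range: "pos x \<in> {1..N}"
proof -
  have "x \<in> vx ` {1..N}" using vx_bij by (simp add: bij_betw_def)
  then show "vx (pos x) = x" "pos x \<in> {1..N}"
    unfolding pos_def by (rule f_inv_into_f, rule inv_into_into)
qed

lemma entry_out: "(x, y) \<notin> pairs_ix \<Longrightarrow> entry A x y z w = 0" "(z, w) \<notin> pairs_ix \<Longrightarrow> entry A x y z w = 0"
  by (auto simp: entry_def)

lemma finite_pairs_ix: "finite pairs_ix" unfolding pairs_ix_def by simp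

lemma pos_pairs_ix: "(pos x, pos y) \<in> pairs_ix" unfolding pairs_ix_def using pos_range by simp

lemma entry_pos: "A $ (x, y) $ (z, w) = entry A (pos x) (pos y) (pos z) (pos w)"
  by (simp add: entry_def pos_pairs_ix vx_pos)

lemma entry_of_entries: "entry (of_entries f) x y z w = (if (x, y) \<in> pairs_ix \<and> (z, w) \<in> pairs_ix then f x y z w else 0)"
  by (auto simp: entry_def of_entries_def pairs_ix_def pos_vx)

lemma mat_eqI:
  assumes "\<And>x y z w. (x, y) \<in> pairs_ix \<Longrightarrow> (z, w) \<in> pairs_ix \<Longrightarrow> entry A x y z w = entry B x y z w"
  shows "A = B"
  unfolding vec_eq_iff
proof (intro allI)
  fix r c :: "'n \<times> 'n"
  obtain x y z w where "r = (x, y)" "c = (z, w)" by (cases r; cases c) auto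
  then show "A $ r $ c = B $ r $ c" using assms[OF pos_pairs_ix pos_pairs_ix] by (simp add: entry_pos)
qed

lemma entry_add: "entry (A + B) x y z w = entry A x y z w + entry (B :: ('a::monoid_add, 'n) tmat) x y z w"
  by (simp add: entry_def)

lemma entry_zero: "entry 0 x y z w = 0" by (simp add: entry_def)

lemma vx_bij2: "bij_betw (\<lambda>(b, d). (vx b, vx d)) pairs_ix (UNIV :: ('n \<times> 'n) set)"
proof -
  have "bij_betw (map_prod vx vx) ({1..N} \<times> {1..N}) (UNIV \<times> UNIV)"
    using vx_bij by (intro bij_betw_map_prod)
  then show ?thesis unfolding pairs_ix_def map_prod_def by simp
qed

lemma entry_mult:
  "entry (A ** B) x y z w = (\<Sum>(b, d)\<in>pairs_ix. entry A x y b d * entry (B :: ('a::semiring_1, 'n) tmat) b d z w)"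
proof (cases "(x, y) \<in> pairs_ix \<and> (z, w) \<in> pairs_ix")
  case True
  have "entry (A ** B) x y z w = (\<Sum>u\<in>UNIV. A $ (vx x, vx y) $ u * B $ u $ (vx z, vx w))"
    using True by (simp add: entry_def matrix_matrix_mult_def)
  also have "\<dots> = (\<Sum>(b, d)\<in>pairs_ix. A $ (vx x, vx y) $ (vx b, vx d) * B $ (vx b, vx d) $ (vx z, vx w))"
    by (subst sum.reindex_bij_betw[OF vx_bij2, symmetric]) (simp add: case_prod_beta)
  also have "\<dots> = (\<Sum>(b, d)\<in>pairs_ix. entry A x y b d * entry B b d z w)"
    using True by (intro sum.cong) (auto simp: entry_def)
  finally show ?thesis .
next
  case False
  then have "(\<Sum>(b, d)\<in>pairs_ix. entry A x y b d * entry B b d z w) = 0"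
    by (intro sum.neutral) (auto simp: entry_def)
  moreover have "entry (A ** B) x y z w = 0" using False by (auto simp: entry_def)
  ultimately show ?thesis by simp
qed

lemma entry_mult_single:
  assumes "\<And>b d. (b, d) \<noteq> (b0, d0) \<Longrightarrow> entry A x y b d * entry B b d z w = 0"
  shows "entry (A ** B) x y z w = entry A x y b0 d0 * entry (B :: ('a::semiring_1, 'n) tmat) b0 d0 z w"
proof -
  have "entry (A ** B) x y z w = (case (b0, d0) of (b, d) \<Rightarrow> entry A x y b d * entry B b d z w)"
    unfolding entry_mult
    by (rule sum_eq_single) (use assms in \<open>auto simp: finite_pairs_ix\<close>, auto simp: entry_def)
  then show ?thesis by simp
qed

lemma entry_mult_nz:
  assumes "entry (A ** B) x y z w \<noteq> 0"
  obtains b d where "entry A x y b d \<noteq> 0" "entry (B :: ('a::semiring_1, 'n) tmat) b d z w \<noteq> 0"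
proof -
  have "\<exists>u\<in>pairs_ix. (case u of (b, d) \<Rightarrow> entry A x y b d * entry B b d z w) \<noteq> 0"
    using assms unfolding entry_mult by (meson sum.neutral)
  then obtain b d where "entry A x y b d * entry B b d z w \<noteq> 0" by auto
  then show ?thesis using that[of b d] by (metis mult_zero_left mult_zero_right)
qed

lemma entry_flip: "entry (flip A) x y z w = entry A y x w z"
  by (auto simp: entry_def flip_def pairs_ix_def)

lemma entry_one: "entry (mat 1 :: ('a::zero_neq_one, 'n) tmat) x y z w = (if x = z \<and> y = w \<and> (x, y) \<in> pairs_ix then 1 else 0)"
proof -
  have "vx a = vx b \<longleftrightarrow> a = b" if "a \<in> {1..N}" "b \<in> {1..N}" for a b
    using vx_bij that by (auto simp: bij_betw_def inj_on_def)
  then show ?thesis by (auto simp: entry_def mat_def pairs_ix_def)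
qed

lemma flip_mult: "flip (A ** B) = flip A ** flip (B :: ('a::comm_semiring_1, 'n) tmat)"
proof (rule mat_eqI)
  fix x y z w
  have "(\<Sum>(b, d)\<in>pairs_ix. entry A y x b d * entry B b d w z) = (\<Sum>(d, b)\<in>pairs_ix. entry A y x b d * entry B b d w z)"
    by (rule sum.reindex_bij_witness[of _ prod.swap prod.swap]) (auto simp: pairs_ix_def)
  then show "entry (flip (A ** B)) x y z w = entry (flip A ** flip B) x y z w"
    by (simp add: entry_flip entry_mult)
qed

definition dmat :: "(int \<Rightarrow> int \<Rightarrow> 'a::zero) \<Rightarrow> ('a, 'n) tmat" where
  "dmat f = of_entries (\<lambda>x y z w. if x = z \<and> y = w then f x y else 0)"

lemma entry_dmat: "entry (dmat f) x y z w = (if x = z \<and> y = w \<and> (x, y) \<in> pairs_ix then f x y else 0)"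
  by (auto simp: dmat_def entry_of_entries)

lemma entry_dmat_left: "entry (dmat f ** A) x y z w = f x y * entry (A :: ('a::semiring_1, 'n) tmat) x y z w"
proof -
  have "entry (dmat f ** A) x y z w = entry (dmat f) x y x y * entry A x y z w"
    by (rule entry_mult_single) (auto simp: entry_dmat)
  then show ?thesis by (cases "(x, y) \<in> pairs_ix") (simp_all add: entry_dmat entry_out)
qed

lemma entry_dmat_right: "entry (A ** dmat f) x y z w = entry (A :: ('a::semiring_1, 'n) tmat) x y z w * f z w"
proof -
  have "entry (A ** dmat f) x y z w = entry A x y z w * entry (dmat f) z w z w"
    by (rule entry_mult_single) (auto simp: entry_dmat)
  then show ?thesis by (cases "(z, w) \<in> pairs_ix") (simp_all add: entry_dmat entry_out)
qed

end

section \<open>The levels of the twist and their products\<close>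

lemma matrix_add_rdistrib: "(A + B) ** C = A ** C + B ** (C :: 'a::semiring_1 ^ 'm ^ 'k)"
  by (simp add: matrix_matrix_mult_def vec_eq_iff sum.distrib distrib_right)

abbreviation hq :: "complex fps" where "hq \<equiv> q - inverse q"

lemma q_inverse: "q * inverse q = 1" "inverse q * q = 1"
proof -
  have "fps_nth q 0 \<noteq> 0" by (simp add: q_def qpow_def)
  then show "q * inverse q = 1" "inverse q * q = 1"
    by (simp_all add: inverse_mult_eq_1 inverse_mult_eq_1')
qed

context bd_mat
begin

text \<open>
  For \<open>z < x\<close> and \<open>\<alpha> = e\<^sub>z - e\<^sub>x\<close> this is the sum of the \<open>e\<^sub>-\<^sub>\<alpha> \<otimes> e\<^sub>\<beta>\<close>, where \<open>\<beta> = e\<^sub>y - e\<^sub>w\<close> is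
  \<open>T\<^sup>p\<alpha>\<close>, with coefficient \<open>q - q\<^sup>-\<^sup>1\<close>, multiplied by \<open>(-q)\<close> to the power \<open>-(|\<alpha>| - 1)\<close> if \<open>T\<^sup>p\<close>
  reverses \<open>\<alpha>\<close>. All integers \<open>p\<close> are allowed: \<open>p = 0\<close> gives the triangular part of
  \<open>R\<^sub>s\<^sub>t\<close>, and negative \<open>p\<close> occur in \<open>lower_identity\<close>.
\<close>

definition Tmat :: "int \<Rightarrow> (complex fps, 'n) tmat" where
  "Tmat p = of_entries (\<lambda>x y z w. if z < x \<and> y < w then
     (if iter p z x y w then hq else if iter p z x w y then hq * (- inverse q) ^ (nat (x - z) - 1) else 0) else 0)"

text \<open>The diagonal matrix \<open>D\<^sub>p\<close> with these entries carries the powers of \<open>q\<close> that come from passing.\<close>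

definition swt :: "int \<Rightarrow> int \<Rightarrow> int \<Rightarrow> complex fps" where
  "swt p x y = (if straight p x y then q else 1)"

definition swti :: "int \<Rightarrow> int \<Rightarrow> int \<Rightarrow> complex fps" where
  "swti p x y = (if straight p x y then inverse q else 1)"

lemma swt_swti: "swt p x y * swti p x y = 1" "swti p x y * swt p x y = 1"
  by (simp_all add: swt_def swti_def q_inverse)

text \<open>
  The levels vanish above \<open>order_bound\<close>, so the recursion of \<open>Jtail_rec\<close>, which increases \<open>p\<close>,
  is well-founded; here \<open>j\<close> counts the levels and the last one treated is
  \<open>p = order_bound - j\<close>. The same holds for \<open>Stail_aux\<close>.
\<close>

primrec Jtail_aux :: "nat \<Rightarrow> (complex fps, 'n) tmat" where
  "Jtail_aux 0 = mat 1"
| "Jtail_aux (Suc j) = (dmat (swt (order_bound - int j)) + Tmat (order_bound - int j)) ** Jtail_aux j ** dmat (swti (order_bound - int j))"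

definition Jtail :: "int \<Rightarrow> (complex fps, 'n) tmat" where "Jtail p = Jtail_aux (nat (order_bound + 1 - p))"

primrec Stail_aux :: "nat \<Rightarrow> (complex fps, 'n) tmat" where
  "Stail_aux 0 = 0"
| "Stail_aux (Suc j) = dmat (swti (order_bound - int j)) ** (Tmat (order_bound - int j) + Stail_aux j) ** dmat (swti (order_bound - int j))"

definition Stail :: "int \<Rightarrow> (complex fps, 'n) tmat" where "Stail p = Stail_aux (nat (order_bound + 1 - p))"

lemma entry_Tmat: "entry (Tmat p) x y z w = (if z < x \<and> y < w then
     (if iter p z x y w then hq else if iter p z x w y then hq * (- inverse q) ^ (nat (x - z) - 1) else 0) else 0)"
  using iter_range by (fastforce simp: Tmat_def entry_of_entries pairs_ix_def)

lemma Tmat_big: "p > order_bound \<Longrightarrow> Tmat p = 0"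
proof (rule mat_eqI)
  fix x y z w assume "p > order_bound"
  then have "\<not> iter p z x y w" "\<not> iter p z x w y" using iter_le_order_bound by fastforce+
  then show "entry (Tmat p) x y z w = entry 0 x y z w" by (simp add: entry_Tmat entry_zero)
qed

lemma straight_big: "p > order_bound \<Longrightarrow> \<not> straight p x y"
  using iter_le_order_bound unfolding straight_def by fastforce

lemma swt_big: "p > order_bound \<Longrightarrow> swt p x y = 1" "p > order_bound \<Longrightarrow> swti p x y = 1"
  using straight_big by (simp_all add: swt_def swti_def)

lemma dmat_big: "p > order_bound \<Longrightarrow> dmat (swt p) = mat 1" "p > order_bound \<Longrightarrow> dmat (swti p) = mat 1"
  by (rule mat_eqI, simp add: entry_dmat entry_one swt_big)+

lemma Jtail_big: "p > order_bound \<Longrightarrow> Jtail p = mat 1" by (simp add: Jtail_def)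

lemma Stail_big: "p > order_bound \<Longrightarrow> Stail p = 0" by (simp add: Stail_def)

lemma Jtail_rec: "Jtail p = (dmat (swt p) + Tmat p) ** Jtail (p + 1) ** dmat (swti p)"
proof (cases "p > order_bound")
  case True
  then show ?thesis by (simp add: Jtail_big Tmat_big dmat_big)
next
  case False
  then have "nat (order_bound + 1 - p) = Suc (nat (order_bound + 1 - (p + 1)))" "order_bound - int (nat (order_bound + 1 - (p + 1))) = p" by auto
  then show ?thesis unfolding Jtail_def by (metis Jtail_aux.simps(2))
qed

lemma Stail_rec: "Stail p = dmat (swti p) ** (Tmat p + Stail (p + 1)) ** dmat (swti p)"
proof (cases "p > order_bound")
  case True
  then show ?thesis by (simp add: Stail_big Tmat_big dmat_big)
next
  case False
  then have "nat (order_bound + 1 - p) = Suc (nat (order_bound + 1 - (p + 1)))" "order_bound - int (nat (order_bound + 1 - (p + 1))) = p" by auto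
  then show ?thesis unfolding Stail_def by (metis Stail_aux.simps(2))
qed

lemma down_induct [case_names big step]:
  assumes "\<And>p. p > k \<Longrightarrow> P p" "\<And>p. p \<le> k \<Longrightarrow> P (p + 1) \<Longrightarrow> P p"
  shows "P (p :: int)"
proof (cases "p > k")
  case False
  then have "p \<le> k" by simp
  then show ?thesis
  proof (induction p rule: int_le_induct)
    case base then show ?case using assms(1)[of "k + 1"] assms(2)[of k] by simp
  next
    case (step i) then show ?case using assms(2)[of "i - 1"] by simp
  qed
qed (use assms in auto)

lemma entry_Jtail: "entry (Jtail p) x y z w =
  (swt p x y * entry (Jtail (p + 1)) x y z w + entry (Tmat p ** Jtail (p + 1)) x y z w) * swti p z w"
  by (subst Jtail_rec) (simp only: entry_dmat_right matrix_add_rdistrib[of _ _ "Jtail (p + 1)"] entry_add entry_dmat_left)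

lemma entry_Stail: "entry (Stail p) x y z w = swti p x y * (entry (Tmat p) x y z w + entry (Stail (p + 1)) x y z w) * swti p z w"
  by (subst Stail_rec) (simp only: entry_dmat_right entry_add entry_dmat_left)

text \<open>
  Entries of \<open>Jtail p\<close> outside the diagonal satisfy this (\<open>Jtail_supp\<close>), because every factor
  of the product does and the conditions are transitive. The inequality between height sums
  separates levels; the conditions on domains show where powers of \<open>T\<close> may be
  applied; the last clause provides, for the last edge of \<open>y..w\<close>, an edge inside \<open>z..x\<close> of which
  it is an image, which is needed at the ends of a block in \<open>straight_conj_end\<close>.
\<close>

definition supp_bound :: "int \<Rightarrow> int \<Rightarrow> int \<Rightarrow> int \<Rightarrow> int \<Rightarrow> bool" where
  "supp_bound p x y z w \<longleftrightarrow> z < x \<and> y < w \<and> w - y = x - z \<and> height_sum y w \<ge> height_sum z x + p * (x - z) \<and>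
     (p \<ge> 0 \<longrightarrow> defined_at p z x \<and> defined_at (- p) y w) \<and>
     (\<exists>j\<ge>p. \<exists>a\<in>{z..x}. \<exists>b\<in>{z..x}. iter j a b (w - 1) w)"

lemma Tmat_cases:
  assumes "entry (Tmat p) x y z w \<noteq> 0"
  shows "z < x \<and> y < w \<and> w - y = x - z \<and> (iter p z x y w \<or> iter p z x w y)"
proof -
  have a: "z < x" "y < w" "iter p z x y w \<or> iter p z x w y" using assms by (auto simp: entry_Tmat split: if_splits)
  have "w - y = x - z"
    using a(3)
  proof
    assume "iter p z x y w" then show ?thesis by (cases rule: iter_dich) (use a in auto)
  next
    assume "iter p z x w y" then show ?thesis by (cases rule: iter_dich) (use a in auto)
  qed
  then show ?thesis using a by auto
qed

lemma iter_im_defined_at: "iter p x y u v \<Longrightarrow> defined_at (- p) u v" "iter p x y u v \<Longrightarrow> defined_at p x y"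
  unfolding defined_at_def using iter_inv by blast+

lemma Tmat_supp_bound:
  assumes "entry (Tmat p) x y z w \<noteq> 0"
  shows "supp_bound p x y z w"
proof -
  note c = Tmat_cases[OF assms]
  from c consider "iter p z x y w" | "iter p z x w y" by blast
  then show ?thesis
  proof cases
    case 1
    have e: "z + (y - z) = y" "x + (y - z) = w" using c by auto
    have "iter p z x (z + (y - z)) (x + (y - z))" unfolding e by (rule 1)
    then have "iter p (x - 1) x (x - 1 + (y - z)) (x + (y - z))" using c iter_shift_sub[of p z x "y - z" "x - 1" x] by auto
    moreover have "x - 1 + (y - z) = w - 1" using c by auto
    ultimately have "iter p (x - 1) x (w - 1) w" using e by metis
    then have "\<exists>j\<ge>p. \<exists>a\<in>{z..x}. \<exists>b\<in>{z..x}. iter j a b (w - 1) w"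
      using c by (intro exI[of _ p] conjI bexI[where x = "x - 1"] bexI[where x = x]) auto
    then show ?thesis unfolding supp_bound_def using c iter_height[OF 1] iter_im_defined_at[OF 1] by simp
  next
    case 2
    have e: "(w + z) - z = w" "(w + z) - x = y" using c by auto
    have "iter p z x ((w + z) - z) ((w + z) - x)" unfolding e by (rule 2)
    then have "iter p (z + 1) z ((w + z) - (z + 1)) ((w + z) - z)" using c iter_refl_sub[of p z x "w + z" "z + 1" z] by auto
    moreover have "(w + z) - (z + 1) = w - 1" by auto
    ultimately have "iter p (z + 1) z (w - 1) w" using e by metis
    then have "\<exists>j\<ge>p. \<exists>a\<in>{z..x}. \<exists>b\<in>{z..x}. iter j a b (w - 1) w"
      using c by (intro exI[of _ p] conjI bexI[where x = "z + 1"] bexI[where x = z]) auto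
    then show ?thesis unfolding supp_bound_def
      using c iter_height[OF 2] iter_im_defined_at[OF 2] defined_at_swap[of "- p" w y] height_sum_swap[of w y] by simp
  qed
qed

lemma supp_bound_trans:
  assumes "supp_bound p x y b d" "supp_bound (p + 1) b d z w"
  shows "supp_bound p x y z w"
proof -
  note a = assms(1)[unfolded supp_bound_def] and b = assms(2)[unfolded supp_bound_def]
  have h: "height_sum y w = height_sum y d + height_sum d w" "height_sum z x = height_sum z b + height_sum b x" using a b by (auto intro!: height_sum_add)
  have m: "p * (x - b) + (p + 1) * (b - z) \<ge> p * (x - z)" using b by (simp add: algebra_simps)
  have "defined_at p z x \<and> defined_at (- p) y w" if p: "p \<ge> 0"
  proof -
    have "defined_at p z b" using b p defined_at_mono[of "p + 1" z b p] by auto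
    moreover have "defined_at (- p) d w" using b p defined_at_neg_mono[of "p + 1" d w p] by auto
    ultimately show ?thesis using a b p defined_at_concat[of p z b x] defined_at_concat[of "- p" y d w] by auto
  qed
  moreover obtain j a' b' where "j \<ge> p + 1" "a' \<in> {z..b}" "b' \<in> {z..b}" "iter j a' b' (w - 1) w" using b by blast
  then have "\<exists>j\<ge>p. \<exists>a\<in>{z..x}. \<exists>b\<in>{z..x}. iter j a b (w - 1) w" using a
    by (intro exI[of _ j] conjI bexI[of _ a'] bexI[of _ b']) auto
  moreover have "height_sum y w \<ge> height_sum z x + p * (x - z)" using a b h m by linarith
  ultimately show ?thesis unfolding supp_bound_def using a b by simp
qed

lemma supp_bound_mono: "supp_bound (p + 1) x y z w \<Longrightarrow> supp_bound p x y z w"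
proof -
  assume b: "supp_bound (p + 1) x y z w"
  note b = b[unfolded supp_bound_def]
  have "(p + 1) * (x - z) \<ge> p * (x - z)" using b by (simp add: algebra_simps)
  then have "height_sum y w \<ge> height_sum z x + p * (x - z)" using b by linarith
  moreover have "defined_at p z x \<and> defined_at (- p) y w" if p: "p \<ge> 0"
    using b p defined_at_mono[of "p + 1" z x p] defined_at_neg_mono[of "p + 1" y w p] by auto
  moreover have "\<exists>j\<ge>p. \<exists>a\<in>{z..x}. \<exists>b\<in>{z..x}. iter j a b (w - 1) w" 
  proof -
    obtain j where "j \<ge> p + 1" "\<exists>a\<in>{z..x}. \<exists>b\<in>{z..x}. iter j a b (w - 1) w" using b by blast
    then show ?thesis by (intro exI[of _ j]) auto
  qed
  ultimately show ?thesis unfolding supp_bound_def using b by blast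
qed

lemma Jtail_supp: "entry (Jtail p) x y z w \<noteq> 0 \<Longrightarrow> (x = z \<and> y = w) \<or> supp_bound p x y z w"
proof (induction p arbitrary: x y z w rule: down_induct[where k = order_bound])
  case (big p)
  then show ?case by (auto simp: Jtail_big entry_one split: if_splits)
next
  case (step p)
  from step.prems have "entry (Jtail (p + 1)) x y z w \<noteq> 0 \<or> entry (Tmat p ** Jtail (p + 1)) x y z w \<noteq> 0"
    unfolding entry_Jtail[of p] by auto
  then show ?case
  proof
    assume "entry (Jtail (p + 1)) x y z w \<noteq> 0"
    then show ?thesis using step.IH supp_bound_mono by blast
  next
    assume "entry (Tmat p ** Jtail (p + 1)) x y z w \<noteq> 0"
    then obtain b d where bd: "entry (Tmat p) x y b d \<noteq> 0" "entry (Jtail (p + 1)) b d z w \<noteq> 0" by (rule entry_mult_nz)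
    then show ?thesis using Tmat_supp_bound[OF bd(1)] step.IH[OF bd(2)] supp_bound_trans by blast
  qed
qed

lemma Jtail_diag: "(x, y) \<in> pairs_ix \<Longrightarrow> entry (Jtail p) x y x y = 1"
proof (induction p rule: down_induct[where k = order_bound])
  case (big p)
  then show ?case by (auto simp: Jtail_big entry_one)
next
  case (step p)
  have "entry (Tmat p ** Jtail (p + 1)) x y x y = 0"
  proof (rule ccontr)
    assume "entry (Tmat p ** Jtail (p + 1)) x y x y \<noteq> 0"
    then obtain b d where bd: "entry (Tmat p) x y b d \<noteq> 0" "entry (Jtail (p + 1)) b d x y \<noteq> 0" by (rule entry_mult_nz)
    then show False using Tmat_supp_bound[OF bd(1)] Jtail_supp[OF bd(2)] unfolding supp_bound_def by auto
  qed
  then show ?case using step by (simp add: entry_Jtail[of p] swt_swti)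
qed

text \<open>
  In such an entry \<open>T\<^sup>p\<close> carries \<open>x\<close> either to \<open>w\<close>, which differs from \<open>y\<close>, or to \<open>y\<close> with a
  reflection, and similarly for \<open>z\<close>. Hence the weights \<open>D\<^sub>p\<close> act trivially on \<open>Tmat p\<close>.
\<close>

lemma Tmat_not_straight: 
  assumes "entry (Tmat p) x y z w \<noteq> 0"
  shows "\<not> straight p x y" "\<not> straight p z w"
proof -
  note c = Tmat_cases[OF assms]
  from c consider "iter p z x y w" | "iter p z x w y" by blast
  then have "\<not> straight p x y \<and> \<not> straight p z w"
  proof cases
    case 1
    then have "iter p x z w y" using iter_swap by blast
    then show ?thesis using 1 c straight_iter by (metis less_irrefl)
  next
    case 2
    then have "iter p x z y w" using iter_swap by blast
    then show ?thesis using 2 c straight_iter by (smt (verit))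
  qed
  then show "\<not> straight p x y" "\<not> straight p z w" by auto
qed

lemma Tmat_swt: "entry (Tmat p) x y z w * swti p z w = entry (Tmat p) x y z w"
  "swti p x y * entry (Tmat p) x y z w = entry (Tmat p) x y z w"
  using Tmat_not_straight[of p x y z w] by (cases "entry (Tmat p) x y z w = 0"; auto simp: swti_def)+

section \<open>Conjugation by a translation\<close>


text \<open>Both sides say that \<open>T\<^sup>p\<close> carries the segment from \<open>a\<close> to \<open>b\<close> to the segment from \<open>c\<close> to \<open>d\<close>.\<close>

lemma iter_conj:
  assumes "iter k a b a' b'" "iter k c d c' d'"
  shows "iter (p - k) a' b' c d \<longleftrightarrow> iter (p + k) a b c' d'"
proof -
  have "iter (p - k) a' b' c d \<longleftrightarrow> iter p a b c d" using iter_compose[OF assms(1), of "p - k" c d] by simp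
  also have "\<dots> \<longleftrightarrow> iter (- p) c d a b" by (rule iter_inv)
  also have "\<dots> \<longleftrightarrow> iter (- p - k) c' d' a b" using iter_compose[OF assms(2), of "- p - k" a b] by simp
  also have "\<dots> \<longleftrightarrow> iter (p + k) a b c' d'" using iter_inv[of "p + k" a b c' d'] by simp
  finally show ?thesis .
qed

text \<open>Straightness is already visible on one of the two edges at the vertex.\<close>

lemma straight_adj: "straight p x y \<longleftrightarrow> (\<exists>e\<in>{1, -1}. iter p x (x + e) y (y + e))"
proof
  assume "straight p x y"
  then obtain b d where b: "iter p x b y d" "d - y = b - x" unfolding straight_def by blast
  have "x \<noteq> b" using iter_range b(1) by blast
  define e :: int where "e = (if x < b then 1 else -1)"
  have "iter p x (x + e) y (y + (x + e - x))"
    using iter_shift_sub1[OF b, of "x + e"] \<open>x \<noteq> b\<close> unfolding e_def by (auto split: if_splits)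
  then show "\<exists>e\<in>{1, -1}. iter p x (x + e) y (y + e)" unfolding e_def by (intro bexI[of _ e]) (auto simp: e_def)
next
  assume "\<exists>e\<in>{1, -1}. iter p x (x + e) y (y + e)"
  then obtain e where "iter p x (x + e) y (y + e)" by blast
  then show "straight p x y" unfolding straight_def by (intro exI[of _ "x + e"] exI[of _ "y + e"]) simp
qed

lemma straight_left:
  assumes "straight p x y" "iter p u v (y - 1) y"
  shows "u = x - 1 \<and> v = x"
proof -
  have m: "iter p v u y (y - 1)" using assms(2) iter_swap by blast
  have v: "v = x" using straight_inj[of p v y x] assms(1) iter_inj m unfolding straight_def by blast
  show ?thesis using straight_iter[OF assms(1), of u y "y - 1"] m v by auto
qed

text \<open>
  At an inner vertex of a block \<open>l..t\<close> on which \<open>T\<^sup>k\<close> is the translation by \<open>\<delta>\<close>, both edges lie in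
  the block, so \<open>iter_conj\<close> applies to them.
\<close>

lemma straight_conj_inner:
  assumes "iter k l t (l + \<delta>) (t + \<delta>)" "l < a" "a < t" "l < c" "c < t"
  shows "straight (p - k) (a + \<delta>) c \<longleftrightarrow> straight (p + k) a (c + \<delta>)"
proof -
  have "iter (p - k) (a + \<delta>) (a + \<delta> + e) c (c + e) \<longleftrightarrow> iter (p + k) a (a + e) (c + \<delta>) (c + \<delta> + e)"
    if "e \<in> {1, -1}" for e
  proof -
    have "iter k a (a + e) (a + \<delta>) (a + e + \<delta>)" "iter k c (c + e) (c + \<delta>) (c + e + \<delta>)"
      using iter_shift_sub[OF assms(1)] assms(2-) that by auto
    from iter_conj[OF this, of p] show ?thesis by (simp add: algebra_simps)
  qed
  then show ?thesis unfolding straight_adj by blast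
qed

text \<open>
  At an end of the block, the edge that makes a vertex straight may lie outside the block, where
  \<open>T\<^sup>k\<close> is not known to be defined. The edges provided by the last clause of \<open>supp_bound\<close> show
  that it is the right edge and that it belongs to the domain of \<open>T\<^sup>k\<close>.
\<close>

lemma straight_conj_end:
  assumes blk: "iter k l t (l + \<delta>) (t + \<delta>)" and z: "l \<le> z" "z < t" and w: "l < w" "w \<le> t" and "1 \<le> p" "0 \<le> k"
    and L1: "supp_bound (p + 1 - k) (x + \<delta>) y (z + \<delta>) w" and L2: "supp_bound (p + 1 + k) x (y + \<delta>) z (w + \<delta>)"
    and "x \<le> t"
  shows "straight (p - k) (z + \<delta>) w \<longleftrightarrow> straight (p + k) z (w + \<delta>)"
proof -
  have kw: "iter k (w - 1) w (w - 1 + \<delta>) (w + \<delta>)" using iter_shift_sub[OF blk, of "w - 1" w] w by auto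
  have kz: "iter k z (z + 1) (z + \<delta>) (z + 1 + \<delta>)" using iter_shift_sub[OF blk, of z "z + 1"] z by auto
  have vz: "straight k z (z + \<delta>)" unfolding straight_def by (intro exI[of _ "z + 1"] exI[of _ "z + 1 + \<delta>"]) (use kz in auto)
  show ?thesis
  proof
    assume V: "straight (p - k) (z + \<delta>) w"
    obtain j a b where j: "j \<ge> p + 1 - k" "a \<in> {z + \<delta>..x + \<delta>}" "b \<in> {z + \<delta>..x + \<delta>}" "iter j a b (w - 1) w"
      using L1 unfolding supp_bound_def by blast
    \<comment> \<open>The last edge of \<open>y..w\<close> lies in the image of \<open>T\<^sup>p\<^sup>-\<^sup>k\<close>; straightness forces its preimage to be the edge that ends in \<open>z + \<delta>\<close>.\<close>
    obtain u v where uv: "iter (p - k) u v (w - 1) w"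
    proof (cases "p - k \<ge> 0")
      case True
      have "iter (int (nat (j - (p - k)) + nat (p - k))) a b (w - 1) w" using j True by simp
      from iter_im_mono[OF this] show ?thesis using that True by auto
    next
      case False
      have "defined_at (k - p) (w - 1) w" using kw defined_at_mono[of k "w - 1" w "k - p"] False \<open>1 \<le> p\<close> unfolding defined_at_def by auto
      then show ?thesis using that iter_inv[of "k - p" "w - 1" w] unfolding defined_at_def by auto
    qed
    have uv': "u = z + \<delta> - 1" "v = z + \<delta>" using straight_left[OF V uv] by auto
    have "iter (- (p - k) + j) a b u v" using iter_compose[OF j(4), of "- (p - k)" u v] uv iter_inv by blast
    moreover have "iter k (a - \<delta>) (b - \<delta>) a b"
      using iter_shift_sub[OF blk, of "a - \<delta>" "b - \<delta>"] j z \<open>x \<le> t\<close> iter_range[OF j(4)] by auto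
    ultimately have "iter (- (p - k) + j + k) (a - \<delta>) (b - \<delta>) u v" using iter_compose by blast
    then have "iter (int (nat (j - (p - k)) + nat k)) (a - \<delta>) (b - \<delta>) u v" using j \<open>0 \<le> k\<close> by (simp add: algebra_simps)
    from iter_im_mono[OF this] obtain u0 v0 where u0: "iter k u0 v0 u v" using \<open>0 \<le> k\<close> by auto
    then have "iter k u0 v0 (z + \<delta> - 1) (z + \<delta>)" using uv' by simp
    then have z1: "iter k (z - 1) z (z + \<delta> - 1) (z + \<delta>)" using straight_left[OF vz] by blast
    have "iter (p + k) (z - 1) z (w - 1 + \<delta>) (w + \<delta>)" using iter_conj[OF z1 kw, of p] uv uv' by simp
    then have "iter (p + k) z (z + (- 1)) (w + \<delta>) (w + \<delta> + (- 1))" using iter_swap by (simp add: algebra_simps)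
    then show "straight (p + k) z (w + \<delta>)" unfolding straight_adj by blast
  next
    assume V: "straight (p + k) z (w + \<delta>)"
    obtain j a b where j: "j \<ge> p + 1 + k" "iter j a b (w + \<delta> - 1) (w + \<delta>)"
      using L2 unfolding supp_bound_def by blast
    have "iter (int (nat (j - (p + k)) + nat (p + k))) a b (w + \<delta> - 1) (w + \<delta>)"
      using j \<open>1 \<le> p\<close> \<open>0 \<le> k\<close> by simp
    from iter_im_mono[OF this] obtain u v where uv: "iter (p + k) u v (w + \<delta> - 1) (w + \<delta>)" using \<open>1 \<le> p\<close> \<open>0 \<le> k\<close> by auto
    have uv': "u = z - 1" "v = z" using straight_left[OF V uv] by auto
    have "defined_at (p + k) (z - 1) z" using uv uv' unfolding defined_at_def by blast
    then have "defined_at k (z - 1) z" using defined_at_mono \<open>1 \<le> p\<close> \<open>0 \<le> k\<close> by auto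
    then obtain u1 v1 where "iter k (z - 1) z u1 v1" unfolding defined_at_def by blast
    then have s1: "iter k z (z - 1) v1 u1" using iter_swap by blast
    have "v1 = z + \<delta>" "u1 = z + \<delta> - 1" using straight_iter[OF vz s1] by auto
    then have z1: "iter k (z - 1) z (z + \<delta> - 1) (z + \<delta>)" using s1 iter_swap by blast
    have "iter (p + k) (z - 1) z (w - 1 + \<delta>) (w + \<delta>)" using uv uv' by (simp add: algebra_simps)
    then have "iter (p - k) (z + \<delta> - 1) (z + \<delta>) (w - 1) w" using iter_conj[OF z1 kw, of p] by simp
    then have "iter (p - k) (z + \<delta>) (z + \<delta> + (- 1)) w (w + (- 1))" using iter_swap by simp
    then show "straight (p - k) (z + \<delta>) w" unfolding straight_adj by blast
  qed
qed

lemma Tmat_conj: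
  assumes blk: "iter k l t (l + \<delta>) (t + \<delta>)" "l < t" and r: "x \<in> {l..t}" "y \<in> {l..t}" "z \<in> {l..t}" "w \<in> {l..t}"
  shows "entry (Tmat (p - k)) (x + \<delta>) y (z + \<delta>) w = entry (Tmat (p + k)) x (y + \<delta>) z (w + \<delta>)"
proof (cases "z < x \<and> y < w")
  case True
  have 1: "iter k z x (z + \<delta>) (x + \<delta>)" "iter k y w (y + \<delta>) (w + \<delta>)" "iter k w y (w + \<delta>) (y + \<delta>)"
    using iter_shift_sub[OF blk] r True by auto
  show ?thesis using iter_conj[OF 1(1,2), of p] iter_conj[OF 1(1,3), of p] by (simp add: entry_Tmat)
next
  case False
  then have "\<not> (z + \<delta> < x + \<delta> \<and> y < w)" "\<not> (z < x \<and> y + \<delta> < w + \<delta>)" by auto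
  then show ?thesis by (simp only: entry_Tmat if_False)
qed

text \<open>
  Conjugation by \<open>T\<^sup>k\<close> on a block where \<open>T\<^sup>k\<close> is the translation by \<open>\<delta>\<close>: shifting the second
  tensor factor instead of the first raises the level by \<open>2k\<close>. Levels correspond by \<open>Tmat_conj\<close>, the row weights by \<open>straight_conj_inner\<close>, and the column
  weights, which may sit at the ends of the block, by \<open>straight_conj_end\<close> whenever the entry they
  multiply is nonzero.
\<close>

lemma Jtail_conj:
  assumes "iter k l t (l + \<delta>) (t + \<delta>)" "l < t" "0 \<le> k"
  shows "1 \<le> p \<Longrightarrow> x \<in> {l..<t} \<Longrightarrow> y \<in> {l<..t} \<Longrightarrow> z \<in> {l..t} \<Longrightarrow> w \<in> {l..t} \<Longrightarrow>
    entry (Jtail (p - k)) (x + \<delta>) y (z + \<delta>) w = entry (Jtail (p + k)) x (y + \<delta>) z (w + \<delta>)"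
proof (induction p arbitrary: x y z w rule: down_induct[where k = "order_bound + k"])
  case (big p)
  have "x + \<delta> \<in> {1..N} \<and> y + \<delta> \<in> {1..N} \<and> x \<in> {1..N} \<and> y \<in> {1..N}"
    using iter_range[OF assms(1)] big by auto
  then show ?case using big assms(3) by (auto simp: Jtail_big entry_one pairs_ix_def)
next
  case (step p)
  have IH: "entry (Jtail (p + 1 - k)) (x + \<delta>) y (z + \<delta>) w = entry (Jtail (p + 1 + k)) x (y + \<delta>) z (w + \<delta>)"
    if "x \<in> {l..<t}" "y \<in> {l<..t}" "z \<in> {l..t}" "w \<in> {l..t}" for x y z w
    using step.IH[OF _ that] step.prems(1) by simp
  have rg: "x + \<delta> \<in> {1..N}" "y + \<delta> \<in> {1..N}" "x \<in> {1..N}" "y \<in> {1..N}"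
    using iter_range[OF assms(1)] step.prems by auto
  have pairs_ix: "(x + \<delta>, y) \<in> pairs_ix" "(x, y + \<delta>) \<in> pairs_ix" using rg by (auto simp: pairs_ix_def)
  have col: "straight (p - k) (z + \<delta>) w \<longleftrightarrow> straight (p + k) z (w + \<delta>)"
    if b: "b \<in> {l..<t}" "d \<in> {l<..t}" "entry (Jtail (p + 1 - k)) (b + \<delta>) d (z + \<delta>) w \<noteq> 0" "\<not> (b = z \<and> d = w)" for b d
  proof -
    have L1: "supp_bound (p + 1 - k) (b + \<delta>) d (z + \<delta>) w" using Jtail_supp[OF b(3)] b(4) by auto
    have "entry (Jtail (p + 1 + k)) b (d + \<delta>) z (w + \<delta>) \<noteq> 0" using IH[of b d z w] b step.prems by simp
    then have L2: "supp_bound (p + 1 + k) b (d + \<delta>) z (w + \<delta>)" using Jtail_supp b(4) by fastforce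
    show ?thesis
      by (rule straight_conj_end[OF assms(1) _ _ _ _ _ _ L1 L2]) (use step.prems b assms L1 in \<open>auto simp: supp_bound_def\<close>)
  qed
  show ?case
  proof (cases "x = z \<and> y = w")
    case True
    then show ?thesis using pairs_ix by (auto simp: Jtail_diag)
  next
    case ne: False
    have t1: "swt (p - k) (x + \<delta>) y * entry (Jtail (p + 1 - k)) (x + \<delta>) y (z + \<delta>) w * swti (p - k) (z + \<delta>) w
      = swt (p + k) x (y + \<delta>) * entry (Jtail (p + 1 + k)) x (y + \<delta>) z (w + \<delta>) * swti (p + k) z (w + \<delta>)"
    proof (cases "entry (Jtail (p + 1 - k)) (x + \<delta>) y (z + \<delta>) w = 0")
      case True
      then show ?thesis using IH step.prems by simp
    next
      case False
      have L: "supp_bound (p + 1 - k) (x + \<delta>) y (z + \<delta>) w" using Jtail_supp[OF False] ne by auto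
      have "straight (p - k) (x + \<delta>) y \<longleftrightarrow> straight (p + k) x (y + \<delta>)"
        by (rule straight_conj_inner[OF assms(1)]) (use L step.prems in \<open>auto simp: supp_bound_def\<close>)
      then show ?thesis using col[OF _ _ False ne] IH step.prems by (simp add: swt_def swti_def)
    qed
    have t2: "entry (Tmat (p - k) ** Jtail (p + 1 - k)) (x + \<delta>) y (z + \<delta>) w * swti (p - k) (z + \<delta>) w
      = entry (Tmat (p + k) ** Jtail (p + 1 + k)) x (y + \<delta>) z (w + \<delta>) * swti (p + k) z (w + \<delta>)"
    proof -
      let ?f = "\<lambda>(b, d). entry (Tmat (p - k)) (x + \<delta>) y b d * entry (Jtail (p + 1 - k)) b d (z + \<delta>) w * swti (p - k) (z + \<delta>) w"
      let ?g = "\<lambda>(b, d). entry (Tmat (p + k)) x (y + \<delta>) b d * entry (Jtail (p + 1 + k)) b d z (w + \<delta>) * swti (p + k) z (w + \<delta>)"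
      \<comment> \<open>Only summands in these rectangles, which correspond under the shift, are nonzero.\<close>
      let ?A = "{z + \<delta>..<x + \<delta>} \<times> {y<..w}" and ?B = "{z..<x} \<times> {y + \<delta><..w + \<delta>}"
      have A: "?A \<subseteq> pairs_ix" "?B \<subseteq> pairs_ix" using iter_range[OF assms(1)] step.prems by (auto simp: pairs_ix_def)
      have za: "?f u = 0" if "u \<in> pairs_ix - ?A" for u
      proof (rule ccontr)
        assume nz: "?f u \<noteq> 0"
        obtain b d where u: "u = (b, d)" by (cases u)
        have "entry (Tmat (p - k)) (x + \<delta>) y b d \<noteq> 0" "entry (Jtail (p + 1 - k)) b d (z + \<delta>) w \<noteq> 0" using nz u by auto
        from Tmat_cases[OF this(1)] Jtail_supp[OF this(2)] have "u \<in> ?A" using u by (auto simp: supp_bound_def)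
        then show False using that by blast
      qed
      have zb: "?g u = 0" if "u \<in> pairs_ix - ?B" for u
      proof (rule ccontr)
        assume nz: "?g u \<noteq> 0"
        obtain b d where u: "u = (b, d)" by (cases u)
        have "entry (Tmat (p + k)) x (y + \<delta>) b d \<noteq> 0" "entry (Jtail (p + 1 + k)) b d z (w + \<delta>) \<noteq> 0" using nz u by auto
        from Tmat_cases[OF this(1)] Jtail_supp[OF this(2)] have "u \<in> ?B" using u by (auto simp: supp_bound_def)
        then show False using that by blast
      qed
      have "sum ?f pairs_ix = sum ?f ?A" using A za finite_pairs_ix by (intro sum.mono_neutral_right) auto
      also have "\<dots> = sum ?g ?B"
      proof (rule sum.reindex_bij_witness[of _ "\<lambda>(b, d). (b + \<delta>, d - \<delta>)" "\<lambda>(b, d). (b - \<delta>, d + \<delta>)"])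
        fix u assume u: "u \<in> ?A"
        obtain b d where bd: "u = (b, d)" by (cases u)
        define b' where "b' = b - \<delta>"
        have b: "b = b' + \<delta>" by (simp add: b'_def)
        have br: "b' \<in> {l..<t}" "d \<in> {l<..t}" "z \<le> b'" "b' < x" "y < d" "d \<le> w" using u bd b step.prems by auto
        have e: "entry (Tmat (p - k)) (x + \<delta>) y (b' + \<delta>) d = entry (Tmat (p + k)) x (y + \<delta>) b' (d + \<delta>)"
          using Tmat_conj[OF assms(1,2), of x y b' d p] br step.prems by auto
        have g: "entry (Jtail (p + 1 - k)) (b' + \<delta>) d (z + \<delta>) w = entry (Jtail (p + 1 + k)) b' (d + \<delta>) z (w + \<delta>)"
          using IH br step.prems by blast
        have "?f (b' + \<delta>, d) = ?g (b', d + \<delta>)"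
        proof (cases "b' = z \<and> d = w")
          case True
          have d: "entry (Tmat (p - k)) (x + \<delta>) y (b' + \<delta>) d * swti (p - k) (z + \<delta>) w = entry (Tmat (p - k)) (x + \<delta>) y (b' + \<delta>) d"
            "entry (Tmat (p + k)) x (y + \<delta>) b' (d + \<delta>) * swti (p + k) z (w + \<delta>) = entry (Tmat (p + k)) x (y + \<delta>) b' (d + \<delta>)"
            using Tmat_swt(1)[of "p - k" "x + \<delta>" y "b' + \<delta>" d] Tmat_swt(1)[of "p + k" x "y + \<delta>" b' "d + \<delta>"] True by blast+
          have "?f (b' + \<delta>, d) = (entry (Tmat (p - k)) (x + \<delta>) y (b' + \<delta>) d * swti (p - k) (z + \<delta>) w) * entry (Jtail (p + 1 - k)) (b' + \<delta>) d (z + \<delta>) w"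
            by (simp only: case_prod_conv mult_ac)
          also have "\<dots> = (entry (Tmat (p + k)) x (y + \<delta>) b' (d + \<delta>) * swti (p + k) z (w + \<delta>)) * entry (Jtail (p + 1 + k)) b' (d + \<delta>) z (w + \<delta>)"
            by (subst d(1), subst d(2)) (simp only: e g)
          also have "\<dots> = ?g (b', d + \<delta>)" by (simp only: case_prod_conv mult_ac)
          finally show ?thesis .
        next
          case False
          show ?thesis
          proof (cases "entry (Jtail (p + 1 - k)) (b' + \<delta>) d (z + \<delta>) w = 0")
            case True then show ?thesis using g by simp
          next
            case nz: False
            then show ?thesis using col[OF br(1,2) nz False] e g by (simp add: swti_def)
          qed
        qed
        then show "?g (case u of (b, d) \<Rightarrow> (b - \<delta>, d + \<delta>)) = ?f u" using bd b by simp
      qed auto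
      also have "\<dots> = sum ?g pairs_ix" using A zb finite_pairs_ix by (intro sum.mono_neutral_left) auto
      finally show ?thesis unfolding entry_mult sum_distrib_right by (simp add: case_prod_beta)
    qed
    have pe: "p - k + 1 = p + 1 - k" "p + k + 1 = p + 1 + k" by auto
    show ?thesis unfolding entry_Jtail[of "p - k"] entry_Jtail[of "p + k"] distrib_right pe by (simp only: t1 t2)
  qed
qed

section \<open>The lower triangular identity\<close>


text \<open>
  The contribution of the levels above \<open>k\<close> to \<open>flip (Jtail (1 - k)) ** Stail k\<close>, without the
  column weight of level \<open>k\<close>.
\<close>

definition Zmat :: "int \<Rightarrow> (complex fps, 'n) tmat" where
  "Zmat k = flip (Jtail (1 - k)) ** dmat (swti k) ** Stail (k + 1)"

lemma flip_Jtail_supp: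
  assumes "entry (flip (Jtail (1 - k))) x y b d \<noteq> 0"
  shows "(x = b \<and> y = d) \<or> (d < y \<and> x < b \<and> b - x = y - d \<and> height_sum x b \<ge> height_sum d y + (1 - k) * (y - d))"
  using Jtail_supp[of "1 - k" y x d b] assms unfolding supp_bound_def entry_flip by blast

lemma Stail_supp: "entry (Stail p) x y z w \<noteq> 0 \<Longrightarrow> \<exists>j\<ge>p. entry (Tmat j) x y z w \<noteq> 0"
proof (induction p rule: down_induct[where k = order_bound])
  case (big p)
  then show ?case by (simp add: Stail_big entry_zero)
next
  case (step p)
  then have "entry (Tmat p) x y z w \<noteq> 0 \<or> entry (Stail (p + 1)) x y z w \<noteq> 0" unfolding entry_Stail[of p] by auto
  then show ?case using step.IH by (meson dual_order.refl order_trans zle_add1_eq_le order_less_imp_le less_add_one)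
qed

lemma Zmat_nz:
  assumes "entry (Zmat k) x y z w \<noteq> 0"
  obtains b d j where "entry (flip (Jtail (1 - k))) x y b d \<noteq> 0" "j \<ge> k + 1" "entry (Tmat j) b d z w \<noteq> 0"
proof -
  from assms obtain b d where "entry (flip (Jtail (1 - k)) ** dmat (swti k)) x y b d \<noteq> 0" "entry (Stail (k + 1)) b d z w \<noteq> 0"
    unfolding Zmat_def by (rule entry_mult_nz)
  then show ?thesis using that Stail_supp[of "k + 1" b d z w] by (auto simp: entry_dmat_right)
qed

lemma Tmat_im: "entry (Tmat j) b d z w \<noteq> 0 \<Longrightarrow> defined_at (- j) d w"
  using Tmat_cases[of j b d z w] iter_im_defined_at(1)[of j z b d w] iter_im_defined_at(1)[of j z b w d] defined_at_swap by blast

text \<open>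
  Every segment \<open>y..w\<close> that occurs in the product lies in the image of \<open>T\<^sup>k\<close>; elsewhere
  both sides of \<open>lower_identity\<close> vanish.
\<close>

lemma flip_Jtail_Tmat_nz:
  assumes "entry (flip (Jtail (1 - k))) x y b d \<noteq> 0" "entry (Tmat j) b d z w \<noteq> 0" "z < x" "0 \<le> k" "k \<le> j"
  shows "y < w \<and> w - y = x - z \<and> defined_at (- k) y w \<and> d \<le> y"
proof -
  have e: "z < b" "d < w" "w - d = b - z" "defined_at (- j) d w" using Tmat_cases[OF assms(2)] Tmat_im[OF assms(2)] by auto
  have h: "d \<le> y" "x \<le> b" "b - x = y - d" using flip_Jtail_supp[OF assms(1)] by auto
  have "defined_at (- k) d w" using defined_at_neg_mono e(4) assms by blast
  then have "defined_at (- k) y w" using defined_at_sub[of "- k" d w y w] e h assms(3) by auto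
  then show ?thesis using e h assms(3) by auto
qed

lemma flip_add: "flip (A + B) = flip A + flip (B :: ('a::monoid_add, 'n) tmat)"
  by (rule mat_eqI) (simp add: entry_flip entry_add)

lemma flip_Jtail_rec: "flip (Jtail (- k)) = (dmat (swt k) + flip (Tmat (- k))) ** flip (Jtail (1 - k)) ** dmat (swti k)"
proof -
  have "flip (dmat (swt (- k))) = dmat (swt k)" "flip (dmat (swti (- k))) = dmat (swti k)"
    by (rule mat_eqI; use straight_inv in \<open>auto simp: entry_flip entry_dmat swt_def swti_def pairs_ix_def\<close>)+
  then show ?thesis using Jtail_rec[of "- k"] by (simp add: flip_mult flip_add)
qed

lemma straight_of_translation:
  assumes "iter k y' w' (y' + \<delta>) (w' + \<delta>)"
  shows "straight k y' (y' + \<delta>)" "straight k w' (w' + \<delta>)"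
proof -
  show "straight k y' (y' + \<delta>)" unfolding straight_def by (intro exI[of _ w'] exI[of _ "w' + \<delta>"]) (use assms in auto)
  show "straight k w' (w' + \<delta>)" unfolding straight_def by (intro exI[of _ y'] exI[of _ "y' + \<delta>"]) (use assms iter_swap in auto)
qed

text \<open>
  The case \<open>p = 1\<close> of \<open>Jtail_conj\<close> with rows at the left end \<open>y'\<close> of a translated segment.
  If \<open>T\<^sup>k\<close> is not a translation on all of \<open>z..w'\<close>, the right-hand side vanishes because
  \<open>Jtail (1 + k)\<close> only has entries on the domain of \<open>T\<^sup>k\<close>.
\<close>

lemma Jtail_conj_block:
  assumes blk: "iter k y' w' (y' + \<delta>) (w' + \<delta>)" "y' < w'" "0 \<le> k" "z < x"
  shows "(if z < w' \<and> iter k z w' (z + \<delta>) (w' + \<delta>) then entry (Jtail (1 - k)) (y' + \<delta>) x (z + \<delta>) w' else 0)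
    = entry (Jtail (1 + k)) y' (x + \<delta>) z (w' + \<delta>)"
proof (cases "z < w' \<and> iter k z w' (z + \<delta>) (w' + \<delta>)")
  case Q: True
  show ?thesis
  proof (cases "z \<le> y' \<and> x \<le> w'")
    case True
    then show ?thesis using Jtail_conj[of k z w' \<delta> 1 y' x z w'] Q assms by auto
  next
    case False
    have "entry (Jtail (1 - k)) (y' + \<delta>) x (z + \<delta>) w' = 0"
      by (rule ccontr, drule Jtail_supp) (use False in \<open>auto simp: supp_bound_def\<close>)
    moreover have "entry (Jtail (1 + k)) y' (x + \<delta>) z (w' + \<delta>) = 0"
      by (rule ccontr, drule Jtail_supp) (use False in \<open>auto simp: supp_bound_def\<close>)
    ultimately show ?thesis by simp
  qed
next
  case nQ: False
  have "entry (Jtail (1 + k)) y' (x + \<delta>) z (w' + \<delta>) = 0"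
  proof (rule ccontr)
    assume "entry (Jtail (1 + k)) y' (x + \<delta>) z (w' + \<delta>) \<noteq> 0"
    from Jtail_supp[OF this] show False
    proof
      assume "y' = z \<and> x + \<delta> = w' + \<delta>" then show False using nQ assms by auto
    next
      assume L: "supp_bound (1 + k) y' (x + \<delta>) z (w' + \<delta>)"
      then have "defined_at k z y'" using defined_at_mono[of "1 + k" z y' k] assms(3) unfolding supp_bound_def by auto
      then obtain u v where m: "iter k z y' u v" unfolding defined_at_def by blast
      then have m': "iter k y' z v u" using iter_swap by blast
      have "v = y' + \<delta>" "u = z + \<delta>" using straight_iter[OF straight_of_translation(1)[OF blk(1)] m'] by auto
      moreover have "z < y'" using L unfolding supp_bound_def by auto
      ultimately have "iter k z w' (z + \<delta>) (w' + \<delta>)" using iter_concat[OF m] blk by auto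
      then show False using nQ \<open>z < y'\<close> blk by auto
    qed
  qed
  then show ?thesis unfolding if_not_P[OF nQ] by simp
qed

text \<open>
  This lemma and the next two treat the terms of the induction step of \<open>lower_identity\<close>
  where \<open>T\<^sup>k\<close> is the translation by \<open>\<delta>\<close> on \<open>y'..w'\<close> and \<open>y = y' + \<delta>\<close>, \<open>w = w' + \<delta>\<close>. Injectivity
  leaves one summand in each matrix product.
\<close>

lemma HE_plus:
  assumes blk: "iter k y' w' (y' + \<delta>) (w' + \<delta>)" "y' < w'" "0 \<le> k" "z < x"
  shows "entry (flip (Jtail (1 - k)) ** Tmat k) x (y' + \<delta>) z (w' + \<delta>) = hq * entry (Jtail (1 + k)) y' (x + \<delta>) z (w' + \<delta>)"
proof -
  note V = straight_of_translation[OF blk(1)]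
  have "entry (flip (Jtail (1 - k)) ** Tmat k) x (y' + \<delta>) z (w' + \<delta>)
    = entry (flip (Jtail (1 - k))) x (y' + \<delta>) w' (z + \<delta>) * entry (Tmat k) w' (z + \<delta>) z (w' + \<delta>)"
  proof (rule entry_mult_single, rule ccontr)
    fix b d assume ne: "(b, d) \<noteq> (w', z + \<delta>)"
      and "entry (flip (Jtail (1 - k))) x (y' + \<delta>) b d * entry (Tmat k) b d z (w' + \<delta>) \<noteq> 0"
    then have h: "entry (Tmat k) b d z (w' + \<delta>) \<noteq> 0" by auto
    note c = Tmat_cases[OF h]
    from c consider "iter k z b d (w' + \<delta>)" | "iter k z b (w' + \<delta>) d" by blast
    then show False
    proof cases
      case 1
      then have m: "iter k b z (w' + \<delta>) d" using iter_swap by blast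
      have "b = w'" using straight_inj[of k b "w' + \<delta>" w'] V(2) m iter_inj[of k b z "w' + \<delta>" d w'] unfolding straight_def by blast
      then have "d = z + \<delta>" using straight_iter[OF V(2), of z "w' + \<delta>" d] m by auto
      then show False using ne \<open>b = w'\<close> by simp
    next
      case 2
      have "z = w'" using iter_inj[of k z b "w' + \<delta>" d w'] 2 V(2) unfolding straight_def by blast
      then show False using straight_iter[OF V(2), of b "w' + \<delta>" d] 2 c by auto
    qed
  qed
  moreover have "entry (Tmat k) w' (z + \<delta>) z (w' + \<delta>) = (if z < w' \<and> iter k z w' (z + \<delta>) (w' + \<delta>) then hq else 0)"
  proof -
    have "\<not> iter k z w' (w' + \<delta>) (z + \<delta>)" if "z < w'"
      using that straight_iter[OF V(2), of z "z + \<delta>" "w' + \<delta>"] iter_swap[of k z w' "w' + \<delta>" "z + \<delta>"] by auto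
    then show ?thesis by (auto simp: entry_Tmat)
  qed
  moreover have "a * (if P then hq else 0) = hq * (if P then a else 0)" for a :: "complex fps" and P by simp
  ultimately show ?thesis unfolding Jtail_conj_block[OF assms, symmetric] entry_flip by simp
qed

lemma EQ_plus:
  assumes blk: "iter k y' w' (y' + \<delta>) (w' + \<delta>)" "y' < w'" "0 \<le> k" "z < x"
  shows "entry (Tmat k ** Jtail (1 + k)) x (y' + \<delta>) z (w' + \<delta>) =
    (if y' < x then hq * entry (Jtail (1 + k)) y' (x + \<delta>) z (w' + \<delta>) else 0)"
proof -
  note V = straight_of_translation[OF blk(1)]
  have s: "entry (Tmat k ** Jtail (1 + k)) x (y' + \<delta>) z (w' + \<delta>)
    = entry (Tmat k) x (y' + \<delta>) y' (x + \<delta>) * entry (Jtail (1 + k)) y' (x + \<delta>) z (w' + \<delta>)"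
  proof (rule entry_mult_single, rule ccontr)
    fix b d assume ne: "(b, d) \<noteq> (y', x + \<delta>)"
      and "entry (Tmat k) x (y' + \<delta>) b d * entry (Jtail (1 + k)) b d z (w' + \<delta>) \<noteq> 0"
    then have h: "entry (Tmat k) x (y' + \<delta>) b d \<noteq> 0" by auto
    note c = Tmat_cases[OF h]
    from c consider "iter k b x (y' + \<delta>) d" | "iter k b x d (y' + \<delta>)" by blast
    then show False
    proof cases
      case 1
      have "b = y'" using iter_inj[of k b x "y' + \<delta>" d y'] 1 V(1) unfolding straight_def by blast
      then have "d = x + \<delta>" using straight_iter[OF V(1), of x "y' + \<delta>" d] 1 by auto
      then show False using ne \<open>b = y'\<close> by simp
    next
      case 2
      then have m: "iter k x b (y' + \<delta>) d" using iter_swap by blast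
      have "x = y'" using iter_inj[of k x b "y' + \<delta>" d y'] m V(1) unfolding straight_def by blast
      then show False using straight_iter[OF V(1), of b "y' + \<delta>" d] m c by auto
    qed
  qed
  show ?thesis
  proof (cases "y' < x")
    case False
    then have "entry (Tmat k) x (y' + \<delta>) y' (x + \<delta>) = 0" by (simp add: entry_Tmat)
    then show ?thesis using s False by simp
  next
    case lt: True
    show ?thesis
    proof (cases "entry (Jtail (1 + k)) y' (x + \<delta>) z (w' + \<delta>) = 0")
      case True then show ?thesis using s by simp
    next
      case False
      have "x \<le> w'" using Jtail_supp[OF False] unfolding supp_bound_def by auto
      then have "iter k y' x (y' + \<delta>) (x + \<delta>)" using iter_shift_sub[OF blk(1,2), of y' x] lt by auto
      then show ?thesis using s lt by (simp add: entry_Tmat)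
    qed
  qed
qed

lemma EZ_plus:
  assumes blk: "iter k y' w' (y' + \<delta>) (w' + \<delta>)" "y' < w'"
  shows "entry (flip (Tmat (- k)) ** Zmat k) x (y' + \<delta>) z w =
    (if x < y' \<and> iter k x y' (x + \<delta>) (y' + \<delta>) then hq * entry (Zmat k) y' (x + \<delta>) z w else 0)"
proof -
  note V = straight_of_translation[OF blk(1)]
  have s: "entry (flip (Tmat (- k)) ** Zmat k) x (y' + \<delta>) z w
    = entry (flip (Tmat (- k))) x (y' + \<delta>) y' (x + \<delta>) * entry (Zmat k) y' (x + \<delta>) z w"
  proof (rule entry_mult_single, rule ccontr)
    fix e f assume ne: "(e, f) \<noteq> (y', x + \<delta>)"
      and "entry (flip (Tmat (- k))) x (y' + \<delta>) e f * entry (Zmat k) e f z w \<noteq> 0"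
    then have h: "entry (Tmat (- k)) (y' + \<delta>) x f e \<noteq> 0" by (auto simp: entry_flip)
    note c = Tmat_cases[OF h]
    from c consider "iter k x e f (y' + \<delta>)" | "iter k e x f (y' + \<delta>)" using iter_inv[of "- k"] by auto
    then show False
    proof cases
      case 1
      then have m: "iter k e x (y' + \<delta>) f" using iter_swap by blast
      have "e = y'" using iter_inj[of k e x "y' + \<delta>" f y'] m V(1) unfolding straight_def by blast
      then have "f = x + \<delta>" using straight_iter[OF V(1), of x "y' + \<delta>" f] m by auto
      then show False using ne \<open>e = y'\<close> by simp
    next
      case 2
      then have m: "iter k x e (y' + \<delta>) f" using iter_swap by blast
      have "x = y'" using iter_inj[of k x e "y' + \<delta>" f y'] m V(1) unfolding straight_def by blast
      then show False using straight_iter[OF V(1), of e "y' + \<delta>" f] m c by auto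
    qed
  qed
  have "\<not> iter k y' x (x + \<delta>) (y' + \<delta>)" if "x < y'"
    using that straight_iter[OF V(1), of x "x + \<delta>" "y' + \<delta>"] by auto
  then have "entry (flip (Tmat (- k))) x (y' + \<delta>) y' (x + \<delta>) =
    (if x < y' \<and> iter k x y' (x + \<delta>) (y' + \<delta>) then hq else 0)"
    by (auto simp: entry_flip entry_Tmat iter_inv[of "- k"])
  then show ?thesis using s by simp
qed


text \<open>A vertex of a segment reflected by \<open>T\<^sup>k\<close> is not straight.\<close>

lemma no_straight_minus:
  assumes "iter k w' y' (\<kappa> - w') (\<kappa> - y')" "w' < y'"
  shows "\<not> straight k y' u" "\<not> straight k w' u"
  using straight_iter[of k y' u w' "\<kappa> - y'" "\<kappa> - w'"] straight_iter[of k w' u y' "\<kappa> - w'" "\<kappa> - y'"] assms iter_swap by auto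

lemma Tmat_minus_row:
  assumes blk: "iter k w' y' (\<kappa> - w') (\<kappa> - y')" "w' < y'"
    and nz: "entry (Tmat k) x (\<kappa> - y') b d \<noteq> 0"
  shows "x = y' \<and> d = \<kappa> - b"
proof -
  have blk': "iter k y' w' (\<kappa> - y') (\<kappa> - w')" using blk iter_swap by blast
  note c = Tmat_cases[OF nz]
  have "\<not> iter k b x (\<kappa> - y') d"
  proof
    assume m: "iter k b x (\<kappa> - y') d"
    have "b = y'" using iter_inj[OF m blk'] .
    moreover have "straight k b (\<kappa> - y')" unfolding straight_def by (intro exI[of _ x] exI[of _ d]) (use m c in auto)
    ultimately show False using no_straight_minus[OF blk] by blast
  qed
  then have "iter k b x d (\<kappa> - y')" using c by blast
  then have m: "iter k x b (\<kappa> - y') d" using iter_swap by blast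
  have "x = y'" using iter_inj[OF m blk'] .
  then show ?thesis using c by auto
qed

lemma Tmat_minus_col:
  assumes blk: "iter k w' y' (\<kappa> - w') (\<kappa> - y')" "w' < y'"
    and nz: "entry (Tmat k) b d z (\<kappa> - w') \<noteq> 0"
  shows "z = w' \<and> d = \<kappa> - b"
proof -
  note c = Tmat_cases[OF nz]
  have "\<not> iter k z b d (\<kappa> - w')"
  proof
    assume m: "iter k z b d (\<kappa> - w')"
    then have m': "iter k b z (\<kappa> - w') d" using iter_swap by blast
    have "b = w'" using iter_inj[OF m' blk(1)] .
    moreover have "straight k b (\<kappa> - w')" unfolding straight_def by (intro exI[of _ z] exI[of _ d]) (use m' c in auto)
    ultimately show False using no_straight_minus[OF blk] by blast
  qed
  then have m: "iter k z b (\<kappa> - w') d" using c by blast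
  have "z = w'" using iter_inj[OF m blk(1)] .
  then show ?thesis using c by auto
qed

text \<open>
  The same terms where \<open>T\<^sup>k\<close> is a reflection \<open>v \<mapsto> \<kappa> - v\<close> on \<open>w'..y'\<close>. Only the diagonal entries
  of \<open>Jtail\<close> contribute: for any other summand, the height sums given by the reflection
  contradict the inequality in \<open>supp_bound\<close>. The term with \<open>Zmat\<close> has no summand left.
\<close>

lemma HE_minus:
  assumes blk: "iter k w' y' (\<kappa> - w') (\<kappa> - y')" "w' < y'" and "z < x"
  shows "entry (flip (Jtail (1 - k)) ** Tmat k) x (\<kappa> - y') z (\<kappa> - w') = entry (Tmat k) x (\<kappa> - y') z (\<kappa> - w')"
proof -
  have "entry (flip (Jtail (1 - k)) ** Tmat k) x (\<kappa> - y') z (\<kappa> - w')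
    = entry (flip (Jtail (1 - k))) x (\<kappa> - y') x (\<kappa> - y') * entry (Tmat k) x (\<kappa> - y') z (\<kappa> - w')"
  proof (rule entry_mult_single, rule ccontr)
    fix b d assume ne: "(b, d) \<noteq> (x, \<kappa> - y')"
      and "entry (flip (Jtail (1 - k))) x (\<kappa> - y') b d * entry (Tmat k) b d z (\<kappa> - w') \<noteq> 0"
    then have h: "entry (flip (Jtail (1 - k))) x (\<kappa> - y') b d \<noteq> 0" "entry (Tmat k) b d z (\<kappa> - w') \<noteq> 0" by auto
    have zd: "z = w'" "d = \<kappa> - b" using Tmat_minus_col[OF blk h(2)] by auto
    note c = Tmat_cases[OF h(2)]
    have g: "d < \<kappa> - y'" "x < b" "b - x = \<kappa> - y' - d" "height_sum x b \<ge> height_sum d (\<kappa> - y') + (1 - k) * (\<kappa> - y' - d)"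
      using flip_Jtail_supp[OF h(1)] ne by auto
    have "x = y'" using g zd by auto
    have "iter k w' b (\<kappa> - w') (\<kappa> - b)" using c zd iter_vertex[OF blk(1)] iter_swap
      by (smt (verit, best) iter_range)
    then have "iter k y' b (\<kappa> - y') (\<kappa> - b)" using iter_refl_sub[of k w' b \<kappa> y' b] blk(2) g \<open>x = y'\<close> by auto
    from iter_height[OF this] have "height_sum d (\<kappa> - y') = height_sum x b + k * (b - x)" using zd \<open>x = y'\<close> g height_sum_swap[of d "\<kappa> - y'"] by simp
    then have "height_sum x b \<ge> height_sum x b + k * (b - x) + (1 - k) * (b - x)" using g by simp
    then show False using g(2) by (simp add: algebra_simps)
  qed
  moreover have "(x, \<kappa> - y') \<in> pairs_ix" if "entry (Tmat k) x (\<kappa> - y') z (\<kappa> - w') \<noteq> 0" using that by (rule contrapos_np) (simp add: entry_out)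
  ultimately show ?thesis by (cases "entry (Tmat k) x (\<kappa> - y') z (\<kappa> - w') = 0") (auto simp: entry_flip Jtail_diag pairs_ix_def)
qed

lemma EQ_minus:
  assumes blk: "iter k w' y' (\<kappa> - w') (\<kappa> - y')" "w' < y'" and "z < x"
  shows "entry (Tmat k ** Jtail (1 + k)) x (\<kappa> - y') z (\<kappa> - w') = entry (Tmat k) x (\<kappa> - y') z (\<kappa> - w')"
proof -
  have "entry (Tmat k ** Jtail (1 + k)) x (\<kappa> - y') z (\<kappa> - w')
    = entry (Tmat k) x (\<kappa> - y') z (\<kappa> - w') * entry (Jtail (1 + k)) z (\<kappa> - w') z (\<kappa> - w')"
  proof (rule entry_mult_single, rule ccontr)
    fix b d assume ne: "(b, d) \<noteq> (z, \<kappa> - w')"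
      and "entry (Tmat k) x (\<kappa> - y') b d * entry (Jtail (1 + k)) b d z (\<kappa> - w') \<noteq> 0"
    then have h: "entry (Tmat k) x (\<kappa> - y') b d \<noteq> 0" "entry (Jtail (1 + k)) b d z (\<kappa> - w') \<noteq> 0" by auto
    have xd: "x = y'" "d = \<kappa> - b" using Tmat_minus_row[OF blk h(1)] by auto
    note c = Tmat_cases[OF h(1)]
    have g: "z < b" "d < \<kappa> - w'" "\<kappa> - w' - d = b - z" "height_sum d (\<kappa> - w') \<ge> height_sum z b + (1 + k) * (b - z)"
      using Jtail_supp[OF h(2)] ne unfolding supp_bound_def by auto
    have "z = w'" using g xd by auto
    have "iter k w' b (\<kappa> - w') (\<kappa> - b)" using iter_refl_sub[OF blk, of w' b] g c xd \<open>z = w'\<close> by auto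
    from iter_height[OF this] have "height_sum d (\<kappa> - w') = height_sum z b + k * (b - z)"
      using \<open>z = w'\<close> g(1) height_sum_swap[of "\<kappa> - b" "\<kappa> - w'"] unfolding xd(2) by simp
    then have "height_sum z b + k * (b - z) \<ge> height_sum z b + (1 + k) * (b - z)" using g by simp
    then show False using g(1) by (simp add: algebra_simps)
  qed
  moreover have "(z, \<kappa> - w') \<in> pairs_ix" if "entry (Tmat k) x (\<kappa> - y') z (\<kappa> - w') \<noteq> 0" using that by (rule contrapos_np) (simp add: entry_out)
  ultimately show ?thesis by (cases "entry (Tmat k) x (\<kappa> - y') z (\<kappa> - w') = 0") (auto simp: Jtail_diag)
qed

lemma EZ_minus:
  assumes blk: "iter k w' y' (\<kappa> - w') (\<kappa> - y')" "w' < y'" and "z < x" "0 \<le> k"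
  shows "entry (flip (Tmat (- k)) ** Zmat k) x (\<kappa> - y') z (\<kappa> - w') = 0"
proof (rule ccontr)
  assume "entry (flip (Tmat (- k)) ** Zmat k) x (\<kappa> - y') z (\<kappa> - w') \<noteq> 0"
  then obtain e f where ef: "entry (flip (Tmat (- k))) x (\<kappa> - y') e f \<noteq> 0" "entry (Zmat k) e f z (\<kappa> - w') \<noteq> 0"
    by (rule entry_mult_nz)
  have blk': "iter k y' w' (\<kappa> - y') (\<kappa> - w')" using blk iter_swap by blast
  have "entry (Tmat (- k)) (\<kappa> - y') x f e \<noteq> 0" using ef(1) by (simp add: entry_flip)
  note c = Tmat_cases[OF this]
  have "\<not> iter k x e f (\<kappa> - y')"
  proof
    assume "iter k x e f (\<kappa> - y')"
    then have m: "iter k e x (\<kappa> - y') f" using iter_swap by blast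
    have "e = y'" using iter_inj[OF m blk'] .
    moreover have "straight k e (\<kappa> - y')" unfolding straight_def by (intro exI[of _ x] exI[of _ f]) (use m c in auto)
    ultimately show False using no_straight_minus[OF blk] by blast
  qed
  then have "iter k e x f (\<kappa> - y')" using c iter_inv[of "- k"] by auto
  then have m: "iter k x e (\<kappa> - y') f" using iter_swap by blast
  have x: "x = y'" using iter_inj[OF m blk'] .
  have f: "f = \<kappa> - e" "x < e" using c x by auto
  obtain b d j where bd: "entry (flip (Jtail (1 - k))) e f b d \<noteq> 0" "j \<ge> k + 1" "entry (Tmat j) b d z (\<kappa> - w') \<noteq> 0"
    using ef(2) by (rule Zmat_nz)
  have ez: "z < e" using f assms(3) by simp
  have p: "f < \<kappa> - w'" "\<kappa> - w' - f = e - z" "d \<le> f" using flip_Jtail_Tmat_nz[OF bd(1,3) ez assms(4)] bd(2) by auto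
  have z: "z = w'" using p f by auto
  have de: "d < \<kappa> - w'" "\<kappa> - w' - d = b - z" using Tmat_cases[OF bd(3)] by auto
  have b: "b = \<kappa> - d" using de z by auto
  have "defined_at (- k) d (\<kappa> - w')" using Tmat_im[OF bd(3)] defined_at_neg_mono[of j d "\<kappa> - w'" k] bd(2) assms(4) by auto
  then obtain d' w'' where "iter (- k) d (\<kappa> - w') d' w''" unfolding defined_at_def by blast
  then have "iter k d' w'' d (\<kappa> - w')" using iter_inv[of "- k"] by auto
  then have m2: "iter k w'' d' (\<kappa> - w') d" using iter_swap by blast
  have "w'' = w'" using iter_inj[OF m2 blk(1)] .
  have m3: "iter k w' b (\<kappa> - w') (\<kappa> - b)"
  proof (rule iter_dich[OF m2])
    assume "d - (\<kappa> - w') = d' - w''"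
    then have "straight k w'' (\<kappa> - w')" unfolding straight_def using m2 by blast
    then show ?thesis using no_straight_minus[OF blk] \<open>w'' = w'\<close> by blast
  next
    assume "d - (\<kappa> - w') = w'' - d'"
    then have "d' = b" using b \<open>w'' = w'\<close> by simp
    then show ?thesis using m2 \<open>w'' = w'\<close> b by simp
  qed
  have be: "e = b \<and> f = d"
  proof (rule ccontr)
    assume "\<not> (e = b \<and> f = d)"
    then have g: "e < b" "b - e = f - d" "height_sum e b \<ge> height_sum d f + (1 - k) * (f - d)" using flip_Jtail_supp[OF bd(1)] by auto
    have "iter k e b (\<kappa> - e) (\<kappa> - b)" using iter_refl_sub[OF m3, of e b] g f x blk(2) by auto
    from iter_height[OF this] have "height_sum d f = height_sum e b + k * (b - e)" using b f g height_sum_swap[of d f] by simp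
    then show False using g by (simp add: algebra_simps)
  qed
  have "iter k w' e (\<kappa> - w') (\<kappa> - e)" using m3 be by simp
  from iter_height[OF this] have h1: "height_sum f (\<kappa> - w') = height_sum w' e + k * (e - w')" using f x blk(2) height_sum_swap[of f "\<kappa> - w'"] by simp
  have "height_sum f (\<kappa> - w') = height_sum w' e + j * (e - w')"
    using Tmat_cases[OF bd(3)] be z iter_height[of j w' e f "\<kappa> - w'"] iter_height[of j w' e "\<kappa> - w'" f] height_sum_swap[of f] by auto
  then have "(j - k) * (e - w') = 0" using h1 by (simp add: algebra_simps)
  then show False using bd(2) ez z by auto
qed

text \<open>
  Downward induction on \<open>k\<close>; beyond \<open>order_bound\<close> both sides vanish below the diagonal. In the
  step, all terms vanish unless \<open>y..w\<close> is the image under \<open>T\<^sup>k\<close> of a segment with ends \<open>y'\<close> and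
  \<open>w'\<close>. If \<open>T\<^sup>k\<close> translates it, the induction hypothesis is needed for the row \<open>(x, y)\<close> and, if
  \<open>x < y'\<close>, also for the row \<open>(y', x + \<delta>)\<close>; if it reflects it, only the entry of \<open>Tmat k\<close> is left
  besides the induction hypothesis.
\<close>

theorem lower_identity:
  "0 \<le> k \<Longrightarrow> z < x \<Longrightarrow> entry (flip (Jtail (1 - k)) ** Stail k) x y z w = entry (Jtail k) x y z w"
proof (induction k arbitrary: x y z w rule: down_induct[where k = order_bound])
  case (big k)
  then show ?case by (auto simp: Stail_big Jtail_big entry_one entry_mult entry_zero)
next
  case (step k)
  let ?H = "flip (Jtail (1 - k))"
  have k0: "0 \<le> k" by fact
  have IH: "entry (Jtail (1 + k)) x y z w = swt k x y * entry (Zmat k) x y z w + entry (flip (Tmat (- k)) ** Zmat k) x y z w"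
    if "z < x" for x y z w
  proof -
    have "flip (Jtail (1 - (k + 1))) ** Stail (k + 1) = (dmat (swt k) + flip (Tmat (- k))) ** Zmat k"
      using flip_Jtail_rec[of k] by (simp add: Zmat_def matrix_mul_assoc)
    then show ?thesis using step.IH[OF _ that, of y w] k0
      by (simp add: matrix_add_rdistrib entry_add entry_dmat_left add.commute)
  qed
  have L: "entry (?H ** Stail k) x y z w = (entry (?H ** Tmat k) x y z w + entry (Zmat k) x y z w) * swti k z w"
  proof -
    have DE: "dmat (swti k) ** Tmat k = Tmat k" by (rule mat_eqI) (simp add: entry_dmat_left Tmat_swt)
    have "?H ** Stail k = (?H ** (dmat (swti k) ** Tmat k) + Zmat k) ** dmat (swti k)"
      by (subst Stail_rec) (simp add: Zmat_def matrix_mul_assoc matrix_add_ldistrib)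
    then show ?thesis unfolding DE by (simp add: entry_dmat_right entry_add)
  qed
  have R: "entry (Jtail k) x y z w = (swt k x y * entry (Jtail (1 + k)) x y z w + entry (Tmat k ** Jtail (1 + k)) x y z w) * swti k z w"
    using entry_Jtail[of k x y z w] by (simp add: add.commute)
  have "entry (?H ** Tmat k) x y z w + entry (Zmat k) x y z w
    = swt k x y * entry (Jtail (1 + k)) x y z w + entry (Tmat k ** Jtail (1 + k)) x y z w"
  proof (cases "y < w \<and> w - y = x - z \<and> defined_at (- k) y w")
    case False
    \<comment> \<open>Here \<open>y..w\<close> is not in the image of \<open>T\<^sup>k\<close>, and each of the four terms vanishes.\<close>
    have 1: "entry (?H ** Tmat k) x y z w = 0"
    proof (rule ccontr)
      assume "entry (?H ** Tmat k) x y z w \<noteq> 0"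
      then obtain b d where "entry ?H x y b d \<noteq> 0" "entry (Tmat k) b d z w \<noteq> 0" by (rule entry_mult_nz)
      then show False using flip_Jtail_Tmat_nz step.prems False by blast
    qed
    have Z: "y < w \<and> w - y = x - z \<and> defined_at (- k) y w" if "entry (Zmat k) x y z w \<noteq> 0" "z < x" for x y
    proof -
      note t = that
      obtain b d j where "entry ?H x y b d \<noteq> 0" "j \<ge> k + 1" "entry (Tmat j) b d z w \<noteq> 0" using t(1) by (rule Zmat_nz)
      then show ?thesis using flip_Jtail_Tmat_nz[of k x y b d j z w] t(2) k0 by auto
    qed
    have 3: "entry (flip (Tmat (- k)) ** Zmat k) x y z w = 0"
    proof (rule ccontr)
      assume "entry (flip (Tmat (- k)) ** Zmat k) x y z w \<noteq> 0"
      then obtain e f where ef: "entry (flip (Tmat (- k))) x y e f \<noteq> 0" "entry (Zmat k) e f z w \<noteq> 0" by (rule entry_mult_nz)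
      then have c: "x < e" "f < y" "e - x = y - f" using Tmat_cases[of "- k" y x f e] by (auto simp: entry_flip)
      have z: "f < w" "w - f = e - z" "defined_at (- k) f w" using Z[OF ef(2)] c step.prems by auto
      have "y < w" using c z step.prems by auto
      moreover have "defined_at (- k) y w" using defined_at_sub[OF z(3,1), of y w] \<open>y < w\<close> c by auto
      ultimately show False using False c z by auto
    qed
    have 4: "entry (Tmat k ** Jtail (1 + k)) x y z w = 0"
    proof (rule ccontr)
      assume "entry (Tmat k ** Jtail (1 + k)) x y z w \<noteq> 0"
      then obtain b d where bd: "entry (Tmat k) x y b d \<noteq> 0" "entry (Jtail (1 + k)) b d z w \<noteq> 0" by (rule entry_mult_nz)
      have c: "b < x" "y < d" "d - y = x - b" "defined_at (- k) y d" using Tmat_cases[OF bd(1)] Tmat_im[OF bd(1)] by auto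
      from Jtail_supp[OF bd(2)] show False
      proof
        assume "b = z \<and> d = w" then show False using c False by auto
      next
        assume l: "supp_bound (1 + k) b d z w"
        have "defined_at (- k) d w" using l k0 defined_at_neg_mono[of "1 + k" d w k] unfolding supp_bound_def by auto
        then have "defined_at (- k) y w" using defined_at_concat[OF c(4)] l c unfolding supp_bound_def by auto
        then show False using False l c unfolding supp_bound_def by auto
      qed
    qed
    have 2: "entry (Zmat k) x y z w = 0" using Z False step.prems by blast
    show ?thesis using IH[OF step.prems(2), of y w] 1 2 3 4 by simp
  next
    case cnd: True
    then obtain y' w' where m: "iter k y' w' y w" unfolding defined_at_def using iter_inv[of "- k"] by auto
    have m': "iter k w' y' w y" using m iter_swap by blast
    from m show ?thesis
    proof (cases rule: iter_dich)
      case 1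
      \<comment> \<open>\<open>T\<^sup>k\<close> is the translation by \<open>\<delta>\<close> on \<open>y'..w'\<close>.\<close>
      define \<delta> where "\<delta> = y - y'"
      have y: "y = y' + \<delta>" and w: "w = w' + \<delta>" and lt: "y' < w'" using 1 cnd by (auto simp: \<delta>_def)
      have blk: "iter k y' w' (y' + \<delta>) (w' + \<delta>)" using m y w by simp
      note V = straight_of_translation[OF blk]
      have HE: "entry (?H ** Tmat k) x y z w = hq * entry (Jtail (1 + k)) y' (x + \<delta>) z w"
        unfolding y w using HE_plus[OF blk lt k0 step.prems(2)] .
      have EQ: "entry (Tmat k ** Jtail (1 + k)) x y z w = (if y' < x then hq * entry (Jtail (1 + k)) y' (x + \<delta>) z w else 0)"
        unfolding y w using EQ_plus[OF blk lt k0 step.prems(2)] .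
      have EZ: "entry (flip (Tmat (- k)) ** Zmat k) x y z w =
        (if x < y' \<and> iter k x y' (x + \<delta>) y then hq * entry (Zmat k) y' (x + \<delta>) z w else 0)"
        unfolding y using EZ_plus[OF blk lt] .
      have dwx: "swt k x y = (if x = y' then q else 1)"
        using V(1) straight_inj[of k x y y'] y by (auto simp: swt_def)
      consider "y' < x" | "x < y'" | "x = y'" by linarith
      then show ?thesis
      proof cases
        case 1
        then show ?thesis using HE EQ EZ dwx IH[OF step.prems(2), of y w] by simp
      next
        case 2
        have "entry (Jtail (1 + k)) y' (x + \<delta>) z w = (if iter k x y' (x + \<delta>) y then entry (Zmat k) y' (x + \<delta>) z w else 0)"
        proof (cases "iter k x y' (x + \<delta>) y")
          case True
          have Vx: "straight k x (x + \<delta>)" unfolding straight_def by (intro exI[of _ y'] exI[of _ y]) (use True y in auto)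
          have "swt k y' (x + \<delta>) = 1" using straight_inj[OF Vx, of y'] 2 by (auto simp: swt_def)
          moreover have "entry (flip (Tmat (- k)) ** Zmat k) y' (x + \<delta>) z w = 0"
            using EZ_plus[of k x y' \<delta> y' z w] True y 2 by simp
          moreover have "z < y'" using 2 step.prems by simp
          ultimately show ?thesis using IH[of z y' "x + \<delta>" w] True by simp
        next
          case False
          have "entry (Jtail (1 + k)) y' (x + \<delta>) z w = 0"
          proof (rule ccontr)
            assume "entry (Jtail (1 + k)) y' (x + \<delta>) z w \<noteq> 0"
            then have "supp_bound (1 + k) y' (x + \<delta>) z w" using Jtail_supp[of "1 + k" y' "x + \<delta>" z w] 2 step.prems by auto
            then have zy: "z < y'" "defined_at k z y'" using defined_at_mono[of "1 + k" z y' k] k0 unfolding supp_bound_def by auto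
            then have "defined_at k x y'" using defined_at_sub[OF zy(2,1), of x y'] 2 step.prems by auto
            then obtain u v where "iter k x y' u v" unfolding defined_at_def by blast
            moreover then have "iter k y' x v u" using iter_swap by blast
            moreover then have "v = y" "u = x + \<delta>" using straight_iter[OF V(1), of x v u] y by auto
            ultimately show False using False by simp
          qed
          then show ?thesis using False by simp
        qed
        then show ?thesis using 2 HE EQ EZ dwx IH[OF step.prems(2), of y w] by simp
      next
        case 3
        have "entry (Jtail (1 + k)) x y z w = q * entry (Zmat k) x y z w"
          using IH[OF step.prems(2), of y w] EZ dwx 3 by simp
        then have zq: "inverse q * entry (Jtail (1 + k)) x y z w = entry (Zmat k) x y z w"
          by (simp add: mult.assoc[symmetric] q_inverse)
        \<comment> \<open>The weight \<open>q\<close> of the straight vertex \<open>x\<close> makes up for the term of level \<open>k\<close>.\<close>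
        have "hq * entry (Jtail (1 + k)) x y z w + inverse q * entry (Jtail (1 + k)) x y z w = q * entry (Jtail (1 + k)) x y z w"
          by (simp add: algebra_simps)
        then show ?thesis using HE EQ dwx 3 y zq by simp
      qed
    next
      case 2
      \<comment> \<open>\<open>T\<^sup>k\<close> is the reflection \<open>v \<mapsto> \<kappa> - v\<close>.\<close>
      define \<kappa> where "\<kappa> = y + y'"
      have y: "y = \<kappa> - y'" and w: "w = \<kappa> - w'" and lt: "w' < y'" using 2 cnd by (auto simp: \<kappa>_def)
      have blk: "iter k w' y' (\<kappa> - w') (\<kappa> - y')" using m' y w by simp
      have "swt k x y = 1"
      proof -
        have "x = y'" if "straight k x y" using that m iter_inj[of k x _ y _ y' w' w] unfolding straight_def by blast
        then show ?thesis using no_straight_minus[OF blk lt] by (auto simp: swt_def)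
      qed
      then show ?thesis
        using HE_minus[OF blk lt step.prems(2)] EQ_minus[OF blk lt step.prems(2)] EZ_minus[OF blk lt step.prems(2) k0]
          IH[OF step.prems(2), of y w] y w by simp
    qed
  qed
  then show ?case using L R by simp
qed

end

section \<open>Powers of \<open>q\<close> and the substitution of \<open>-\<hbar>\<close> for \<open>\<hbar>\<close>\<close>

lemma qpow_add: "qpow a * qpow b = qpow (a + b)" by (simp add: qpow_def fps_exp_add_mult)
lemma qpow_0: "qpow 0 = 1" by (simp add: qpow_def)
lemma q_qpow: "q = qpow 1" by (simp add: q_def)
lemma qi_qpow: "inverse q = qpow (- 1)" by (simp add: q_def qpow_def fps_exp_neg)

text \<open>The substitution of \<open>-\<hbar>\<close> for \<open>\<hbar>\<close>; it exchanges \<open>q\<close> and \<open>q\<^sup>-\<^sup>1\<close>.\<close>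

definition fbar :: "complex fps \<Rightarrow> complex fps" where
  "fbar f = Abs_fps (\<lambda>n. (- 1) ^ n * fps_nth f n)"

lemma fbar_add: "fbar (f + g) = fbar f + fbar g" by (simp add: fbar_def fps_eq_iff algebra_simps)
lemma fbar_minus: "fbar (- f) = - fbar f" by (simp add: fbar_def fps_eq_iff)
lemma fbar_diff: "fbar (f - g) = fbar f - fbar g" by (simp add: fbar_def fps_eq_iff algebra_simps)
lemma fbar_0: "fbar 0 = 0" by (simp add: fbar_def fps_eq_iff)
lemma fbar_const: "fbar (fps_const c) = fps_const c" by (auto simp: fbar_def fps_eq_iff)
lemma fbar_1: "fbar 1 = 1" using fbar_const[of 1] by simp
lemma fbar_fbar: "fbar (fbar f) = f" by (simp add: fbar_def fps_eq_iff mult.assoc[symmetric] power_add[symmetric])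
lemma fbar_mult: "fbar (f * g) = fbar f * fbar g"
proof -
  have "(- 1 :: complex) ^ n = (- 1) ^ i * (- 1) ^ (n - i)" if "i \<le> n" for i n
    using that by (simp add: power_add[symmetric])
  then show ?thesis
    unfolding fbar_def fps_eq_iff fps_mult_nth by (auto simp: sum_distrib_left intro!: sum.cong)
qed
lemma fbar_sum: "fbar (sum f A) = (\<Sum>a\<in>A. fbar (f a))"
  by (induction A rule: infinite_finite_induct) (auto simp: fbar_0 fbar_add)
lemma fbar_power: "fbar (f ^ n) = fbar f ^ n" by (induction n) (auto simp: fbar_1 fbar_mult)
lemma fbar_qpow: "fbar (qpow y) = qpow (- y)"
  by (simp add: fbar_def fps_eq_iff qpow_def fps_exp_def power_minus[of y])
lemma fbar_q: "fbar q = inverse q" "fbar (inverse q) = q"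
  using fbar_qpow[of 1] fbar_qpow[of "- 1"] by (simp_all add: q_qpow qi_qpow[unfolded q_qpow])
lemma fbar_hq: "fbar hq = - hq" by (simp add: fbar_diff fbar_q)

lemma qpow_power: "qpow y ^ n = qpow (of_nat n * y)"
  by (simp add: qpow_def fps_exp_power_mult)

lemma GGS_0: "GGS_form 0" unfolding GGS_form_def by (intro exI[of _ 0] exI[of _ 0] bexI[of _ 0]) auto

lemma GGS_qpow: "GGS_form (qpow y)"
  unfolding GGS_form_def by (intro exI[of _ 1] exI[of _ y] bexI[of _ 0]) auto

lemma GGS_mult_qpow: "GGS_form f \<Longrightarrow> GGS_form (qpow a * f)"
proof -
  assume "GGS_form f"
  then obtain x y z where f: "f = fps_const x * qpow y * hq ^ z" "z \<in> {0, 1}" unfolding GGS_form_def by blast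
  have "qpow a * f = fps_const x * (qpow a * qpow y) * hq ^ z" unfolding f(1) by (simp only: mult_ac)
  then show ?thesis using f(2) unfolding GGS_form_def qpow_add by blast
qed

lemma GGS_mult_qpow': "GGS_form f \<Longrightarrow> GGS_form (f * qpow a)"
  using GGS_mult_qpow by (simp add: mult.commute)

lemma GGS_fbar: "GGS_form f \<Longrightarrow> GGS_form (fbar f)"
proof -
  assume "GGS_form f"
  then obtain x y z where f: "f = fps_const x * qpow y * hq ^ z" "z \<in> {0, 1}" unfolding GGS_form_def by blast
  have "fbar f = fps_const x * qpow (- y) * (- hq) ^ z"
    unfolding f(1) by (simp only: fbar_mult fbar_const fbar_qpow fbar_power fbar_hq)
  also have "(- hq) ^ z = fps_const ((- 1) ^ z) * hq ^ z"
  proof -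
    have "- hq = fps_const (- 1) * hq" unfolding fps_const_neg[symmetric] fps_const_1_eq_1 by simp
    moreover have "z = 0 \<or> z = 1" using f(2) by auto
    ultimately show ?thesis by (elim disjE) simp_all
  qed
  also have "fps_const x * qpow (- y) * (fps_const ((- 1) ^ z) * hq ^ z) = fps_const (x * (- 1) ^ z) * qpow (- y) * hq ^ z"
    unfolding fps_const_mult[symmetric] by (simp only: mult_ac)
  finally show ?thesis using f(2) unfolding GGS_form_def by blast
qed

context bd_mat
begin

section \<open>Entries below the diagonal\<close>

text \<open>Half passed pairs are those whose segments have an end in common.\<close>

definition half_wt :: "int \<Rightarrow> int \<Rightarrow> complex fps" where "half_wt x y = (if x = y then qpow (1 / 2) else 1)"
definition half_wti :: "int \<Rightarrow> int \<Rightarrow> complex fps" where "half_wti x y = (if x = y then qpow (- 1 / 2) else 1)"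

definition lev_wt :: "int \<Rightarrow> int \<Rightarrow> int \<Rightarrow> complex fps" where
  "lev_wt k x y = half_wt x y * (\<Prod>t\<in>{1..<k}. swt t x y)"
definition lev_wti :: "int \<Rightarrow> int \<Rightarrow> int \<Rightarrow> complex fps" where
  "lev_wti k x y = half_wti x y * (\<Prod>t\<in>{1..<k}. swti t x y)"

lemma half_wt_half_wti: "half_wt x y * half_wti x y = 1" "half_wti x y * half_wt x y = 1"
  by (simp_all add: half_wt_def half_wti_def qpow_add qpow_0)

lemma lev_wt_lev_wti: "lev_wt k x y * lev_wti k x y = 1" "lev_wti k x y * lev_wt k x y = 1"
proof -
  have "lev_wt k x y * lev_wti k x y = (half_wt x y * half_wti x y) * (\<Prod>t\<in>{1..<k}. swt t x y * swti t x y)"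
    unfolding lev_wt_def lev_wti_def prod.distrib by (simp only: mult_ac)
  then show "lev_wt k x y * lev_wti k x y = 1" by (simp add: half_wt_half_wti swt_swti)
  then show "lev_wti k x y * lev_wt k x y = 1" by (simp add: mult.commute)
qed

lemma lev_wt_Suc: "1 \<le> k \<Longrightarrow> lev_wt (k + 1) x y = lev_wt k x y * swt k x y"
  "1 \<le> k \<Longrightarrow> lev_wti (k + 1) x y = swti k x y * lev_wti k x y"
proof -
  assume "1 \<le> k"
  then have "{1..<k + 1} = insert k {1..<k}" by auto
  then show "lev_wt (k + 1) x y = lev_wt k x y * swt k x y" "lev_wti (k + 1) x y = swti k x y * lev_wti k x y"
    by (simp_all add: lev_wt_def lev_wti_def mult_ac)
qed

lemma dmat_mult: "dmat f ** dmat g = dmat (\<lambda>x y. f x y * (g x y :: 'a::semiring_1))"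
  by (rule mat_eqI) (auto simp: entry_dmat_left entry_dmat)

lemma dmat_one: "(\<And>x y. f x y = (1 :: 'a::semiring_1)) \<Longrightarrow> dmat f = mat 1"
  by (rule mat_eqI) (auto simp: entry_dmat entry_one)

text \<open>
  This is \<open>J\<^sub>k\<close> with the tensor factors exchanged (\<open>J_factor_flip\<close>). The left weights are
  \<open>q\<close> to the power \<open>P\<^sup>r\<close> and the right weights \<open>q\<close> to the power \<open>-P\<^sup>l\<close> (\<open>weights_tpair\<close>).
\<close>

definition Jlev :: "int \<Rightarrow> (complex fps, 'n) tmat" where
  "Jlev k = dmat (lev_wt k) ** (mat 1 + Tmat k) ** dmat (lev_wti k)"

lemma Jtail_one:
  assumes "\<And>p. p > m \<Longrightarrow> Tmat p = 0" 
  shows "p > m \<Longrightarrow> Jtail p = mat 1"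
proof (induction p rule: down_induct[where k = order_bound])
  case (big p) then show ?case by (simp add: Jtail_big)
next
  case (step p)
  then show ?case using assms[of p] by (subst Jtail_rec) (simp add: dmat_mult dmat_one swt_swti)
qed

text \<open>
  The weights of consecutive factors telescope: between the factors \<open>a\<close> and \<open>a + 1\<close> they
  leave \<open>D\<^sub>a\<close>, which is absorbed by \<open>1 + Tmat a\<close> to give \<open>D\<^sub>a + Tmat a\<close>.
\<close>

lemma Jlev_foldr:
  assumes "\<And>p. p > int m \<Longrightarrow> Tmat p = 0" "1 \<le> a" "a \<le> Suc m"
  shows "foldr (\<lambda>k X. Jlev (int k) ** X) [a..<Suc m] (mat 1) = dmat (lev_wt (int a)) ** Jtail (int a) ** dmat (lev_wti (int a))"
  using assms(3,2)
proof (induction a rule: inc_induct)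
  case base
  have "Jtail (int (Suc m)) = mat 1" using Jtail_one[of "int m" "int (Suc m)"] assms(1) by simp
  then show ?case by (simp add: dmat_mult dmat_one lev_wt_lev_wti)
next
  case (step a)
  have E: "(mat 1 + Tmat (int a)) ** dmat (swt (int a)) = dmat (swt (int a)) + Tmat (int a)"
  proof (rule mat_eqI)
    fix x y z w
    have "entry (Tmat (int a)) x y z w * swt (int a) z w = entry (Tmat (int a)) x y z w"
      using Tmat_not_straight(2)[of "int a" x y z w] by (cases "entry (Tmat (int a)) x y z w = 0") (auto simp: swt_def)
    then show "entry ((mat 1 + Tmat (int a)) ** dmat (swt (int a))) x y z w = entry (dmat (swt (int a)) + Tmat (int a)) x y z w"
      by (auto simp: matrix_add_rdistrib entry_add entry_dmat_right entry_one entry_dmat)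
  qed
  have w: "dmat (lev_wti (int a)) ** dmat (lev_wt (int (Suc a))) = dmat (swt (int a))"
  proof (rule mat_eqI)
    fix x y z w
    have "lev_wti (int a) x y * lev_wt (int (Suc a)) x y = swt (int a) x y"
      using lev_wt_Suc(1)[of "int a" x y] step.prems by (simp add: add.commute mult.assoc[symmetric] lev_wt_lev_wti)
    then show "entry (dmat (lev_wti (int a)) ** dmat (lev_wt (int (Suc a)))) x y z w = entry (dmat (swt (int a))) x y z w"
      by (auto simp: dmat_mult entry_dmat)
  qed
  have wi: "dmat (lev_wti (int (Suc a))) = dmat (swti (int a)) ** dmat (lev_wti (int a))"
    using lev_wt_Suc(2)[of "int a"] step.prems unfolding dmat_mult by (intro arg_cong[of _ _ dmat] ext) (simp add: add.commute)
  have "foldr (\<lambda>k X. Jlev (int k) ** X) [a..<Suc m] (mat 1)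
    = Jlev (int a) ** (dmat (lev_wt (int (Suc a))) ** Jtail (int (Suc a)) ** dmat (lev_wti (int (Suc a))))"
    unfolding upt_conv_Cons[OF step.hyps(2)] by (simp only: foldr.simps o_apply step.IH[OF le_SucI[OF step.prems]])
  also have "\<dots> = dmat (lev_wt (int a)) ** ((mat 1 + Tmat (int a)) ** (dmat (lev_wti (int a)) ** dmat (lev_wt (int (Suc a))))) ** Jtail (int (Suc a)) ** (dmat (lev_wti (int (Suc a))))"
    by (simp add: Jlev_def matrix_mul_assoc)
  also have "\<dots> = dmat (lev_wt (int a)) ** ((dmat (swt (int a)) + Tmat (int a)) ** Jtail (int a + 1) ** dmat (swti (int a))) ** dmat (lev_wti (int a))"
    unfolding w E wi by (simp add: matrix_mul_assoc add.commute)
  also have "\<dots> = dmat (lev_wt (int a)) ** Jtail (int a) ** dmat (lev_wti (int a))"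
    by (simp only: Jtail_rec[of "int a", symmetric])
  finally show ?case .
qed

text \<open>The standard \<open>R\<close>-matrix as level \<open>0\<close>: \<open>T\<^sup>0\<close> carries each vertex straight to itself.\<close>

definition Rmat :: "(complex fps, 'n) tmat" where "Rmat = dmat (swt 0) + Tmat 0"

lemma straight_0: "N \<ge> 2 \<Longrightarrow> straight 0 x y \<longleftrightarrow> x = y \<and> x \<in> {1..N}"
proof
  assume "straight 0 x y" then show "x = y \<and> x \<in> {1..N}" unfolding straight_def iter_0 by auto
next
  assume n: "N \<ge> 2" and x: "x = y \<and> x \<in> {1..N}"
  define b where "b = (if x = 1 then 2 else x - 1)"
  have "iter 0 x b x b" unfolding iter_0 using n x by (auto simp: b_def)
  then show "straight 0 x y" unfolding straight_def using x by blast
qed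

lemma entry_Em0: "entry (Tmat 0) x y z w = (if z < x \<and> y = z \<and> w = x \<and> (x, y) \<in> pairs_ix then hq else 0)"
  by (auto simp: entry_Tmat iter_0 pairs_ix_def)

lemma entry_Rmat: "N \<ge> 2 \<Longrightarrow> entry Rmat x y z w = (if (x, y) \<in> pairs_ix then if x = z \<and> y = w then if x = y then q else 1
    else if z < x \<and> y = z \<and> w = x then hq else 0 else 0)"
  by (auto simp: Rmat_def entry_add entry_dmat entry_Em0 swt_def straight_0 pairs_ix_def)

text \<open>
  Let \<open>F\<close> be the left factor of \<open>X\<close> in the hypothesis and
  \<open>Y = dmat half_wt ** Stail 0 ** dmat half_wt\<close>. By \<open>lower_identity\<close> with \<open>k = 0\<close>, the products \<open>F ** X\<close> and
  \<open>F ** Y\<close> have the same strictly lower part. The factor \<open>F\<close> is unitriangular, and its row \<open>(x, y)\<close>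
  involves only columns \<open>(b, d)\<close> with \<open>b > x\<close> besides the diagonal, so it can be cancelled, starting from the
  largest \<open>x\<close>. On the diagonal blocks \<open>z = x\<close> the same triangularity reduces the claim to the
  vanishing of certain products, which follows from the height sums.
\<close>

lemma twisted_matrix_lower_part:
  assumes N: "N \<ge> 2" and X: "flip (dmat half_wt ** Jtail 1 ** dmat half_wti) ** X = Rmat ** (dmat half_wt ** Jtail 1 ** dmat half_wti)"
  shows "z < x \<Longrightarrow> entry X x y z w = half_wt x y * entry (Stail 0) x y z w * half_wt z w"
    and "entry X x y x w = (if y = w then entry Rmat x y x w else 0)"
proof -
  let ?J = "flip (dmat half_wt ** Jtail 1 ** dmat half_wti)"
  define Y where "Y = dmat half_wt ** Stail 0 ** dmat half_wt"
  have fsh: "flip (dmat half_wt) = dmat half_wt" "flip (dmat half_wti) = dmat half_wti"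
    by (rule mat_eqI; auto simp: entry_flip entry_dmat half_wt_def half_wti_def pairs_ix_def)+
  have J: "?J = dmat half_wt ** flip (Jtail 1) ** dmat half_wti" by (simp add: flip_mult fsh)
  have ss: "dmat half_wti ** dmat half_wt = mat 1" by (simp add: dmat_mult dmat_one half_wt_half_wti)
  have JY: "?J ** Y = dmat half_wt ** (flip (Jtail 1) ** Stail 0) ** dmat half_wt"
  proof -
    have "?J ** Y = dmat half_wt ** flip (Jtail 1) ** (dmat half_wti ** dmat half_wt) ** Stail 0 ** dmat half_wt"
      unfolding J Y_def by (simp add: matrix_mul_assoc)
    then show ?thesis by (simp add: ss matrix_mul_assoc)
  qed
  have com: "Rmat ** dmat half_wt = dmat half_wt ** Rmat"
  proof (rule mat_eqI)
    fix x y z w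
    have "half_wt z w = half_wt x y" if "entry Rmat x y z w \<noteq> 0"
      using that unfolding entry_Rmat[OF N] half_wt_def by (simp split: if_splits) 
    then show "entry (Rmat ** dmat half_wt) x y z w = entry (dmat half_wt ** Rmat) x y z w"
      unfolding entry_dmat_left entry_dmat_right by (cases "entry Rmat x y z w = 0") simp_all
  qed
  have R: "entry (Rmat ** (dmat half_wt ** Jtail 1 ** dmat half_wti)) x y z w = half_wt x y * entry (Jtail 0) x y z w * half_wt z w" for x y z w
  proof -
    have "dmat (swti 0) ** dmat (swt 0) = mat 1" by (simp add: dmat_mult dmat_one swt_swti)
    then have "Rmat ** Jtail 1 = Jtail 0 ** dmat (swt 0)" using Jtail_rec[of 0] by (simp add: Rmat_def matrix_mul_assoc[symmetric])
    then have "Rmat ** (dmat half_wt ** Jtail 1 ** dmat half_wti) = dmat half_wt ** Jtail 0 ** dmat (swt 0) ** dmat half_wti"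
      using com by (metis matrix_mul_assoc)
    moreover have "entry (Jtail 0) x y z w * (swt 0 z w * half_wti z w) = entry (Jtail 0) x y z w * half_wt z w"
    proof (cases "(z, w) \<in> pairs_ix")
      case True
      then have "swt 0 z w * half_wti z w = half_wt z w"
        by (auto simp: swt_def straight_0[OF N] half_wti_def half_wt_def pairs_ix_def q_qpow qpow_add)
      then show ?thesis by simp
    qed (simp add: entry_out)
    ultimately show ?thesis by (simp add: entry_dmat_left entry_dmat_right mult.assoc)
  qed
  have eq: "entry (?J ** X) x y z w = entry (?J ** Y) x y z w" if "z < x" for x y z w
    unfolding X R JY using lower_identity[of 0 z x y w] that by (simp add: entry_dmat_left entry_dmat_right mult.assoc)
  have Jd: "entry ?J x y x y = (if (x, y) \<in> pairs_ix then 1 else 0)" for x y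
  proof (cases "(x, y) \<in> pairs_ix")
    case True
    then have "(y, x) \<in> pairs_ix" by (auto simp: pairs_ix_def)
    then show ?thesis unfolding J using True half_wt_half_wti[of x y]
      by (simp add: entry_dmat_left entry_dmat_right entry_flip Jtail_diag)
  qed (simp add: entry_out)
  have Js: "(x = b \<and> y = d) \<or> (d < y \<and> x < b \<and> b - x = y - d \<and> height_sum x b \<ge> height_sum d y + (y - d))"
    if "entry ?J x y b d \<noteq> 0" for x y b d
    using flip_Jtail_supp[of 0 x y b d] that unfolding J by (auto simp: entry_dmat_left entry_dmat_right)
  have split: "entry (?J ** A) x y z w = entry A x y z w + (\<Sum>(b, d)\<in>pairs_ix - {(x, y)}. entry ?J x y b d * entry A b d z w)" 
    if "(x, y) \<in> pairs_ix" for A x y z w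
    unfolding entry_mult using that Jd[of x y] by (simp add: sum.remove[OF finite_pairs_ix that])
  have supp_bound: "z < x \<Longrightarrow> entry X x y z w = entry Y x y z w" for x y z w
  proof (induction "nat (N + 1 - x)" arbitrary: x y z w rule: less_induct)
    case less
    show ?case
    proof (cases "(x, y) \<in> pairs_ix")
      case True
      have F: "entry ?J x y b d * entry X b d z w = entry ?J x y b d * entry Y b d z w" if "(b, d) \<noteq> (x, y)" for b d
      proof (cases "entry ?J x y b d = 0")
        case False
        then have "b > x" using Js[OF False] that by auto
        moreover have "x \<le> N" using True by (simp add: pairs_ix_def)
        ultimately have "nat (N + 1 - b) < nat (N + 1 - x)" "z < b" using less.prems by auto
        then have "entry X b d z w = entry Y b d z w" by (rule less.hyps)
        then show ?thesis by simp
      qed simp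
      have "(\<Sum>(b, d)\<in>pairs_ix - {(x, y)}. entry ?J x y b d * entry X b d z w)
        = (\<Sum>(b, d)\<in>pairs_ix - {(x, y)}. entry ?J x y b d * entry Y b d z w)"
      proof (intro sum.cong refl)
        fix u assume "u \<in> pairs_ix - {(x, y)}"
        then have "(fst u, snd u) \<noteq> (x, y)" by auto
        from F[OF this] show "(case u of (b, d) \<Rightarrow> entry ?J x y b d * entry X b d z w) = (case u of (b, d) \<Rightarrow> entry ?J x y b d * entry Y b d z w)"
          unfolding case_prod_beta .
      qed
      then show ?thesis using eq[OF less.prems, of y w] split[OF True, of X z w] split[OF True, of Y z w] by simp
    qed (simp add: entry_out)
  qed
  show "entry X x y z w = half_wt x y * entry (Stail 0) x y z w * half_wt z w" if "z < x"
    using supp_bound[OF that, of y w] by (simp add: Y_def entry_dmat_left entry_dmat_right mult.assoc)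
  show "entry X x y x w = (if y = w then entry Rmat x y x w else 0)"
  proof (cases "(x, y) \<in> pairs_ix \<and> (x, w) \<in> pairs_ix")
    case True
    have F: "entry ?J x y b d * entry X b d x w = 0" if "(b, d) \<noteq> (x, y)" for b d
    proof (rule ccontr)
      assume nz: "entry ?J x y b d * entry X b d x w \<noteq> 0"
      then have j: "d < y" "x < b" "b - x = y - d" "height_sum x b \<ge> height_sum d y + (y - d)" using Js[of x y b d] that by auto
      have "entry X b d x w \<noteq> 0" using nz by auto
      then have "entry (Stail 0) b d x w \<noteq> 0" using supp_bound[OF j(2), of d w] by (auto simp: Y_def entry_dmat_left entry_dmat_right)
      then obtain i where i: "i \<ge> 0" "entry (Tmat i) b d x w \<noteq> 0" using Stail_supp by blast
      note c = Tmat_cases[OF i(2)]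
      have "w = y" using c j by auto
      have "height_sum d w = height_sum x b + i * (b - x)"
        using c iter_height[of i x b d w] iter_height[of i x b w d] height_sum_swap[of w d] by auto
      moreover have "i * (b - x) \<ge> 0" using i c by simp
      ultimately show False using j \<open>w = y\<close> by simp
    qed
    have "(\<Sum>(b, d)\<in>pairs_ix - {(x, y)}. entry ?J x y b d * entry X b d x w) = 0"
    proof (intro sum.neutral ballI)
      fix u assume "u \<in> pairs_ix - {(x, y)}"
      then have "(fst u, snd u) \<noteq> (x, y)" by auto
      from F[OF this] show "(case u of (b, d) \<Rightarrow> entry ?J x y b d * entry X b d x w) = 0" unfolding case_prod_beta .
    qed
    then have "entry X x y x w = half_wt x y * entry (Jtail 0) x y x w * half_wt x w"
      using split[of x y X x w] True unfolding X R by simp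
    moreover have "entry (Jtail 0) x y x w = (if y = w then 1 else 0)"
      using Jtail_supp[of 0 x y x w] Jtail_diag[of x y 0] True by (auto simp: supp_bound_def)
    ultimately show ?thesis using True by (auto simp: entry_Rmat[OF N] half_wt_def qpow_add q_qpow)
  qed (auto simp: entry_out)
qed

end

section \<open>Reversal of the path\<close>

lemma fbar_prod: "fbar (prod f A) = (\<Prod>a\<in>A. fbar (f a))"
  by (induction A rule: infinite_finite_induct) (auto simp: fbar_1 fbar_mult)

context bd_mat
begin

definition rG :: "int set" where "rG = {e. N - e \<in> G}"
definition rs :: "int \<Rightarrow> int" where "rs x = N + 1 - s (N + 1 - x)"
definition rht :: "int \<Rightarrow> int" where "rht e = ht (N - e)"

text \<open>
  Reading the path from the other end preserves the axioms. What is proved for entries below the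
  diagonal, applied to the reversed data, is a statement about entries above the diagonal.
\<close>

lemma rev_bd_mat: "bd_mat N rG rs rht vx"
proof (unfold_locales)
  show "rG \<subseteq> {1..<N}" using G_sub by (fastforce simp: rG_def)
next
  fix e assume e: "e \<in> rG"
  then have g: "N - e \<in> G" by (simp add: rG_def)
  have r: "rs e = N + 1 - s (N - e + 1)" "rs (e + 1) = N + 1 - s (N - e)"
    by (simp_all add: rs_def algebra_simps)
  show "rs e \<in> {1..N} \<and> rs (e + 1) \<in> {1..N}" using s_range[OF g] unfolding r by auto
  show "\<bar>rs (e + 1) - rs e\<bar> = 1" using s_step[OF g] unfolding r by auto
  have "min (rs e) (rs (e + 1)) = N - min (s (N - e)) (s (N - e + 1))" using s_step[OF g] unfolding r by auto
  then show "rht (min (rs e) (rs (e + 1))) = rht e + 1" using ht_step[OF g] by (simp add: rht_def)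
next
  fix e assume e: "e \<in> rG" "e + 1 \<in> rG"
  define f where "f = N - e - 1"
  have g: "f \<in> G" "f + 1 \<in> G" using e by (simp_all add: rG_def f_def algebra_simps)
  have "rs (e + 2) = N + 1 - s f" "rs (e + 1) = N + 1 - s (f + 1)" "rs e = N + 1 - s (f + 2)"
    by (simp_all add: rs_def f_def algebra_simps)
  then show "rs (e + 2) - rs (e + 1) = rs (e + 1) - rs e" using s_straight[OF g] by simp
next
  show "inj_on rs (rG \<union> (\<lambda>e. e + 1) ` rG)"
  proof (rule inj_onI)
    have v: "N + 1 - x \<in> G \<union> (\<lambda>e. e + 1) ` G" if "x \<in> rG \<union> (\<lambda>e. e + 1) ` rG" for x
      using that
    proof
      assume "x \<in> rG"
      then have "N - x + 1 \<in> (\<lambda>e. e + 1) ` G" by (intro imageI) (simp add: rG_def)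
      then show ?thesis by (simp add: algebra_simps)
    next
      assume "x \<in> (\<lambda>e. e + 1) ` rG"
      then show ?thesis by (auto simp: rG_def algebra_simps)
    qed
    fix x y assume "x \<in> rG \<union> (\<lambda>e. e + 1) ` rG" "y \<in> rG \<union> (\<lambda>e. e + 1) ` rG" "rs x = rs y"
    then have "N + 1 - x = N + 1 - y" using inj_onD[OF s_inj _ v v] by (simp add: rs_def)
    then show "x = y" by simp
  qed
next
  show "bij_betw vx {1..N} UNIV" by (rule vx_bij)
qed

interpretation rv: bd_mat N rG rs rht vx by (rule rev_bd_mat)

lemma rv_seg: "rv.seg x y \<longleftrightarrow> seg (N + 1 - x) (N + 1 - y)"
proof -
  have "{min x y..<max x y} \<subseteq> rG \<longleftrightarrow> {min (N + 1 - x) (N + 1 - y)..<max (N + 1 - x) (N + 1 - y)} \<subseteq> G"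
  proof
    assume a: "{min x y..<max x y} \<subseteq> rG"
    show "{min (N + 1 - x) (N + 1 - y)..<max (N + 1 - x) (N + 1 - y)} \<subseteq> G"
    proof
      fix e assume "e \<in> {min (N + 1 - x) (N + 1 - y)..<max (N + 1 - x) (N + 1 - y)}"
      then have "N - e \<in> {min x y..<max x y}" by auto
      then have "N - e \<in> rG" using a by blast
      then show "e \<in> G" by (simp add: rG_def)
    qed
  next
    assume a: "{min (N + 1 - x) (N + 1 - y)..<max (N + 1 - x) (N + 1 - y)} \<subseteq> G"
    show "{min x y..<max x y} \<subseteq> rG"
    proof
      fix e assume "e \<in> {min x y..<max x y}"
      then have "N - e \<in> {min (N + 1 - x) (N + 1 - y)..<max (N + 1 - x) (N + 1 - y)}" by auto
      then have "N - e \<in> G" using a by blast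
      then show "e \<in> rG" by (simp add: rG_def)
    qed
  qed
  then show ?thesis by (auto simp: rv.seg_def seg_def)
qed

lemma rv_seg_step: "((x, y), (u, v)) \<in> rv.seg_step \<longleftrightarrow> ((N + 1 - x, N + 1 - y), (N + 1 - u, N + 1 - v)) \<in> seg_step"
  unfolding rv.seg_step_iff seg_step_iff rv_seg by (auto simp: rs_def)

lemma rv_seg_steps: "((x, y), (u, v)) \<in> rv.seg_step ^^ k \<longleftrightarrow> ((N + 1 - x, N + 1 - y), (N + 1 - u, N + 1 - v)) \<in> seg_step ^^ k"
proof (induction k arbitrary: u v)
  case (Suc k)
  show ?case
  proof
    assume "((x, y), (u, v)) \<in> rv.seg_step ^^ Suc k"
    then obtain p r where "((x, y), (p, r)) \<in> rv.seg_step ^^ k" "((p, r), (u, v)) \<in> rv.seg_step" by auto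
    then show "((N + 1 - x, N + 1 - y), (N + 1 - u, N + 1 - v)) \<in> seg_step ^^ Suc k"
      unfolding Suc.IH rv_seg_step by auto
  next
    assume "((N + 1 - x, N + 1 - y), (N + 1 - u, N + 1 - v)) \<in> seg_step ^^ Suc k"
    then obtain p r where a: "((N + 1 - x, N + 1 - y), (p, r)) \<in> seg_step ^^ k" "((p, r), (N + 1 - u, N + 1 - v)) \<in> seg_step" by auto
    have "((x, y), (N + 1 - p, N + 1 - r)) \<in> rv.seg_step ^^ k" "((N + 1 - p, N + 1 - r), (u, v)) \<in> rv.seg_step"
      unfolding Suc.IH rv_seg_step using a by simp_all
    then show "((x, y), (u, v)) \<in> rv.seg_step ^^ Suc k" by auto
  qed
qed auto

lemma rv_iter: "rv.iter p x y u v \<longleftrightarrow> iter p (N + 1 - x) (N + 1 - y) (N + 1 - u) (N + 1 - v)"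
  unfolding rv.iter_def iter_def by (auto simp: rv_seg_steps rv.conv_pow conv_pow)

lemma rv_straight: "rv.straight p x y \<longleftrightarrow> straight p (N + 1 - x) (N + 1 - y)"
proof
  assume "rv.straight p x y"
  then obtain b d where "iter p (N + 1 - x) (N + 1 - b) (N + 1 - y) (N + 1 - d)" "d - y = b - x"
    unfolding rv.straight_def rv_iter by blast
  then show "straight p (N + 1 - x) (N + 1 - y)" unfolding straight_def
    by (intro exI[of _ "N + 1 - b"] exI[of _ "N + 1 - d"]) simp
next
  assume "straight p (N + 1 - x) (N + 1 - y)"
  then obtain b d where "iter p (N + 1 - x) b (N + 1 - y) d" "d - (N + 1 - y) = b - (N + 1 - x)"
    unfolding straight_def by blast
  then show "rv.straight p x y" unfolding rv.straight_def rv_iter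
    by (intro exI[of _ "N + 1 - b"] exI[of _ "N + 1 - d"]) simp
qed

lemma rv_Tmat: "entry (rv.Tmat p) (N + 1 - z) (N + 1 - w) (N + 1 - x) (N + 1 - y) = entry (Tmat p) x y z w"
proof -
  have "rv.iter p (N + 1 - x) (N + 1 - z) (N + 1 - w) (N + 1 - y) \<longleftrightarrow> iter p z x y w"
    "rv.iter p (N + 1 - x) (N + 1 - z) (N + 1 - y) (N + 1 - w) \<longleftrightarrow> iter p z x w y"
    using rv_iter iter_swap by auto
  then show ?thesis unfolding rv.entry_Tmat entry_Tmat by auto
qed

lemma rv_swt: "rv.swt p (N + 1 - x) (N + 1 - y) = swt p x y" "rv.swti p (N + 1 - x) (N + 1 - y) = swti p x y"
  by (simp_all add: rv.swt_def swt_def rv.swti_def swti_def rv_straight)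

lemma rv_Stail: "entry (rv.Stail p) (N + 1 - z) (N + 1 - w) (N + 1 - x) (N + 1 - y) = entry (Stail p) x y z w"
proof (induction p rule: down_induct[where k = "max order_bound rv.order_bound"])
  case (big p)
  then show ?case by (simp add: Stail_big rv.Stail_big entry_zero)
next
  case (step p)
  then show ?case unfolding entry_Stail[of p] rv.entry_Stail[of p] rv_swt rv_Tmat by (simp add: mult_ac)
qed

text \<open>
  The antiautomorphism that transposes, reverses the path in both tensor factors and
  substitutes \<open>-\<hbar>\<close> for \<open>\<hbar>\<close>. It takes \<open>Tmat k\<close> of the reversed data to \<open>bar_mat (Tmat k)\<close>.
\<close>

definition bar_rot :: "(complex fps, 'n) tmat \<Rightarrow> (complex fps, 'n) tmat" where
  "bar_rot A = of_entries (\<lambda>x y z w. fbar (entry A (N + 1 - z) (N + 1 - w) (N + 1 - x) (N + 1 - y)))"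

definition bar_mat :: "(complex fps, 'n) tmat \<Rightarrow> (complex fps, 'n) tmat" where
  "bar_mat A = of_entries (\<lambda>x y z w. fbar (entry A x y z w))"

lemma pairs_ix_rev: "(N + 1 - x, N + 1 - y) \<in> pairs_ix \<longleftrightarrow> (x, y) \<in> pairs_ix" by (auto simp: pairs_ix_def)

lemma entry_bar_rot: "entry (bar_rot A) x y z w = fbar (entry A (N + 1 - z) (N + 1 - w) (N + 1 - x) (N + 1 - y))"
proof (cases "(x, y) \<in> pairs_ix \<and> (z, w) \<in> pairs_ix")
  case False
  then have "entry A (N + 1 - z) (N + 1 - w) (N + 1 - x) (N + 1 - y) = 0"
    using entry_out pairs_ix_rev by blast
  then show ?thesis using False unfolding bar_rot_def entry_of_entries by (simp add: fbar_0)
qed (simp add: bar_rot_def entry_of_entries)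

lemma entry_bar_mat: "entry (bar_mat A) x y z w = fbar (entry A x y z w)"
proof (cases "(x, y) \<in> pairs_ix \<and> (z, w) \<in> pairs_ix")
  case False
  then have "entry A x y z w = 0" using entry_out by blast
  then show ?thesis using False unfolding bar_mat_def entry_of_entries by (simp add: fbar_0)
qed (simp add: bar_mat_def entry_of_entries)

lemma bar_rot_mult: "bar_rot (A ** B) = bar_rot B ** bar_rot A"
proof (rule mat_eqI)
  fix x y z w
  have "fbar (\<Sum>(b, d)\<in>pairs_ix. entry A (N + 1 - z) (N + 1 - w) b d * entry B b d (N + 1 - x) (N + 1 - y))
    = (\<Sum>(b, d)\<in>pairs_ix. fbar (entry B b d (N + 1 - x) (N + 1 - y)) * fbar (entry A (N + 1 - z) (N + 1 - w) b d))"
    unfolding fbar_sum by (simp add: case_prod_beta fbar_mult mult.commute)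
  also have "\<dots> = (\<Sum>(b, d)\<in>pairs_ix. fbar (entry B (N + 1 - b) (N + 1 - d) (N + 1 - x) (N + 1 - y)) * fbar (entry A (N + 1 - z) (N + 1 - w) (N + 1 - b) (N + 1 - d)))"
    by (rule sum.reindex_bij_witness[of _ "\<lambda>(b, d). (N + 1 - b, N + 1 - d)" "\<lambda>(b, d). (N + 1 - b, N + 1 - d)"])
      (auto simp: pairs_ix_def)
  finally show "entry (bar_rot (A ** B)) x y z w = entry (bar_rot B ** bar_rot A) x y z w"
    unfolding entry_bar_rot entry_mult .
qed

lemma bar_mat_mult: "bar_mat (A ** B) = bar_mat A ** bar_mat B"
  by (rule mat_eqI) (simp add: entry_bar_mat entry_mult fbar_sum case_prod_beta fbar_mult)

lemma bar_rot_add: "bar_rot (A + B) = bar_rot A + bar_rot B" by (rule mat_eqI) (simp add: entry_bar_rot entry_add fbar_add)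
lemma bar_mat_add: "bar_mat (A + B) = bar_mat A + bar_mat B" by (rule mat_eqI) (simp add: entry_bar_mat entry_add fbar_add)
lemma bar_rot_bar_rot: "bar_rot (bar_rot A) = A" by (rule mat_eqI) (simp add: entry_bar_rot fbar_fbar)
lemma bar_mat_bar_mat: "bar_mat (bar_mat A) = A" by (rule mat_eqI) (simp add: entry_bar_mat fbar_fbar)
lemma bar_rot_one: "bar_rot (mat 1) = mat 1" by (rule mat_eqI) (auto simp: entry_bar_rot entry_one fbar_0 fbar_1 pairs_ix_def)
lemma bar_rot_flip: "bar_rot (flip A) = flip (bar_rot A)" by (rule mat_eqI) (simp add: entry_bar_rot entry_flip)
lemma bar_rot_dmat: "bar_rot (dmat f) = dmat (\<lambda>x y. fbar (f (N + 1 - x) (N + 1 - y)))"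
  by (rule mat_eqI) (auto simp: entry_bar_rot entry_dmat fbar_0 pairs_ix_def)
lemma bar_mat_zero: "bar_mat 0 = 0" by (rule mat_eqI) (simp add: entry_bar_mat entry_zero fbar_0)

lemma bar_rot_rv_Tmat: "bar_rot (rv.Tmat k) = bar_mat (Tmat k)"
  by (rule mat_eqI) (simp add: entry_bar_rot entry_bar_mat rv_Tmat)

lemma geometric_hq:
  "(\<Sum>i<n. (- q) ^ (n - Suc i) * (- inverse q) ^ i) * hq = (- inverse q) ^ n - (- q) ^ n"
proof -
  have "(- inverse q) ^ n - (- q) ^ n = (- inverse q - - q) * (\<Sum>i<n. (- q) ^ (n - Suc i) * (- inverse q) ^ i)"
    by (rule power_diff_sumr2)
  then show ?thesis by (simp add: mult.commute)
qed

text \<open>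
  In the product only reversed segments can be composed, with a cut point \<open>b\<close> inside the
  reversed segment \<open>z..x\<close>; the sum over \<open>b\<close> is the geometric sum of \<open>geometric_hq\<close>. Hence
  substituting \<open>-\<hbar>\<close> for \<open>\<hbar>\<close> inverts \<open>1 + Tmat k\<close>.
\<close>

lemma Tmat_inv: "Tmat k + bar_mat (Tmat k) + Tmat k ** bar_mat (Tmat k) = 0"
proof (rule mat_eqI)
  fix x y z w
  have minus: "iter k b x d y \<and> iter k z b w d \<and> z < b \<and> b < x \<and> y < d \<and> d < w"
    if nz: "entry (Tmat k) x y b d * entry (bar_mat (Tmat k)) b d z w \<noteq> 0" for b d
  proof -
    have 1: "entry (Tmat k) x y b d \<noteq> 0" using nz by auto
    have 2: "entry (Tmat k) b d z w \<noteq> 0" using nz by (auto simp: entry_bar_mat fbar_0)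
    note c = Tmat_cases[OF 1] Tmat_cases[OF 2]
    have "\<not> iter k b x y d"
    proof
      assume m: "iter k b x y d"
      from c(2) consider "iter k z b d w" | "iter k z b w d" by blast
      then show False
      proof cases
        case 1 
        then have "iter k b z w d" using iter_swap by blast
        then have "y = w" using iter_vertex[OF m] by blast
        then show False using c by auto
      next
        case 2
        then have "iter k b z d w" using iter_swap by blast
        then have "y = d" using iter_vertex[OF m] by blast
        then show False using c by auto
      qed
    qed
    then have m: "iter k b x d y" using c by blast
    have "\<not> iter k z b d w"
    proof
      assume "iter k z b d w"
      then have "iter k b z w d" using iter_swap by blast
      then have "d = w" using iter_vertex[OF m] by blast
      then show False using c by auto
    qed
    then show ?thesis using m c by blast
  qed
  have "entry (Tmat k) x y z w + fbar (entry (Tmat k) x y z w) + entry (Tmat k ** bar_mat (Tmat k)) x y z w = 0"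
  proof (cases "z < x \<and> y < w \<and> iter k z x w y")
    case True
    then have m: "iter k z x w y" and lt: "z < x" "y < w" by auto
    have d: "y - w = z - x" using iter_dich[OF m] lt by auto
    define \<kappa> where "\<kappa> = z + w"
    have kz: "\<kappa> - z = w" "\<kappa> - x = y" using d by (auto simp: \<kappa>_def)
    have m': "iter k z x (\<kappa> - z) (\<kappa> - x)" unfolding kz by (rule m)
    have nM: "\<not> iter k z x y w" using iter_vertex[OF m, of x y w] lt by auto
    \<comment> \<open>The number of cut points strictly inside the segment.\<close>
    define n where "n = nat (x - z) - 1"
    have e: "entry (Tmat k) x y z w = hq * (- inverse q) ^ n" using m lt nM by (simp add: entry_Tmat n_def)
    have sub: "iter k b x (\<kappa> - b) y \<and> iter k z b w (\<kappa> - b) \<and> \<not> iter k b x y (\<kappa> - b) \<and> \<not> iter k z b (\<kappa> - b) w"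
      if "b \<in> {z<..<x}" for b
    proof -
      have 1: "iter k b x (\<kappa> - b) (\<kappa> - x)" "iter k z b (\<kappa> - z) (\<kappa> - b)"
        using iter_refl_sub[OF m' lt(1), of b x] iter_refl_sub[OF m' lt(1), of z b] that by auto
      have "\<kappa> - x = y" "\<kappa> - z = w" using d by (auto simp: \<kappa>_def)
      then have 2: "iter k b x (\<kappa> - b) y" "iter k z b w (\<kappa> - b)" using 1 by auto
      then show ?thesis using iter_vertex[OF 2(1), of x y "\<kappa> - b"] iter_vertex[OF 2(2), of b "\<kappa> - b" w]
          that lt d by (auto simp: \<kappa>_def)
    qed
    have "entry (Tmat k ** bar_mat (Tmat k)) x y z w
      = (\<Sum>(b, d)\<in>(\<lambda>b. (b, \<kappa> - b)) ` {z<..<x}. entry (Tmat k) x y b d * entry (bar_mat (Tmat k)) b d z w)"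
      unfolding entry_mult
    proof (rule sum.mono_neutral_right[OF finite_pairs_ix])
      show "(\<lambda>b. (b, \<kappa> - b)) ` {z<..<x} \<subseteq> pairs_ix"
        using sub iter_range by (fastforce simp: pairs_ix_def)
      show "\<forall>u\<in>pairs_ix - (\<lambda>b. (b, \<kappa> - b)) ` {z<..<x}. (case u of (b, d) \<Rightarrow> entry (Tmat k) x y b d * entry (bar_mat (Tmat k)) b d z w) = 0"
      proof
        fix u assume u: "u \<in> pairs_ix - (\<lambda>b. (b, \<kappa> - b)) ` {z<..<x}"
        obtain b d where bd: "u = (b, d)" by (cases u)
        show "(case u of (b, d) \<Rightarrow> entry (Tmat k) x y b d * entry (bar_mat (Tmat k)) b d z w) = 0"
        proof (rule ccontr)
          assume "(case u of (b, d) \<Rightarrow> entry (Tmat k) x y b d * entry (bar_mat (Tmat k)) b d z w) \<noteq> 0"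
          then have "iter k b x d y \<and> iter k z b w d \<and> z < b \<and> b < x \<and> y < d \<and> d < w" using minus bd by simp
          then have g: "b \<in> {z<..<x}" "iter k b x d y" by auto
          then have "d = \<kappa> - b" using sub[of b] iter_vertex[of k b x d y x "\<kappa> - b" y] by blast
          then show False using u bd g by blast
        qed
      qed
    qed
    also have "\<dots> = (\<Sum>b\<in>{z<..<x}. entry (Tmat k) x y b (\<kappa> - b) * entry (bar_mat (Tmat k)) b (\<kappa> - b) z w)"
      by (subst sum.reindex) (auto simp: inj_on_def)
    also have "\<dots> = (\<Sum>b\<in>{z<..<x}. (hq * (- inverse q) ^ (nat (x - b) - 1)) * (- hq * (- q) ^ (nat (b - z) - 1)))"
    proof (rule sum.cong[OF refl])
      fix b assume b: "b \<in> {z<..<x}"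
      have dd: "y < \<kappa> - b" "\<kappa> - b < w" using b d by (auto simp: \<kappa>_def)
      have "entry (Tmat k) x y b (\<kappa> - b) = hq * (- inverse q) ^ (nat (x - b) - 1)"
        using sub[OF b] b dd by (simp add: entry_Tmat)
      moreover have "entry (bar_mat (Tmat k)) b (\<kappa> - b) z w = - hq * (- q) ^ (nat (b - z) - 1)"
      proof -
        have "entry (Tmat k) b (\<kappa> - b) z w = hq * (- inverse q) ^ (nat (b - z) - 1)"
          using sub[OF b] b dd by (simp add: entry_Tmat)
        then show ?thesis by (simp only: entry_bar_mat fbar_mult fbar_power fbar_minus fbar_hq fbar_q)
      qed
      ultimately show "entry (Tmat k) x y b (\<kappa> - b) * entry (bar_mat (Tmat k)) b (\<kappa> - b) z w =
        (hq * (- inverse q) ^ (nat (x - b) - 1)) * (- hq * (- q) ^ (nat (b - z) - 1))" by (simp only:)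
    qed
    also have "\<dots> = (\<Sum>i<n. (hq * (- inverse q) ^ i) * (- hq * (- q) ^ (n - Suc i)))"
    proof (rule sum.reindex_bij_witness[of _ "\<lambda>i. x - 1 - int i" "\<lambda>b. nat (x - 1 - b)"])
      fix b assume b: "b \<in> {z<..<x}"
      have "nat (x - 1 - b) = nat (x - b) - 1" "n - Suc (nat (x - 1 - b)) = nat (b - z) - 1"
        using b by (auto simp: n_def)
      then show "hq * (- inverse q) ^ nat (x - 1 - b) * (- hq * (- q) ^ (n - Suc (nat (x - 1 - b))))
        = hq * (- inverse q) ^ (nat (x - b) - 1) * (- hq * (- q) ^ (nat (b - z) - 1))" by (simp only:)
    qed (auto simp: n_def)
    also have "\<dots> = - hq * ((\<Sum>i<n. (- q) ^ (n - Suc i) * (- inverse q) ^ i) * hq)"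
      by (simp add: sum_distrib_left sum_distrib_right mult_ac sum_negf)
    also have "\<dots> = - hq * ((- inverse q) ^ n - (- q) ^ n)" unfolding geometric_hq ..
    finally have p: "entry (Tmat k ** bar_mat (Tmat k)) x y z w = - hq * ((- inverse q) ^ n - (- q) ^ n)" .
    have "fbar (entry (Tmat k) x y z w) = - hq * (- q) ^ n"
      unfolding e by (simp only: fbar_mult fbar_power fbar_minus fbar_hq fbar_q)
    then show ?thesis unfolding p e by (simp add: algebra_simps)
  next
    case False
    have p: "entry (Tmat k ** bar_mat (Tmat k)) x y z w = 0"
    proof (rule ccontr)
      assume "entry (Tmat k ** bar_mat (Tmat k)) x y z w \<noteq> 0"
      then obtain b d where "entry (Tmat k) x y b d \<noteq> 0" "entry (bar_mat (Tmat k)) b d z w \<noteq> 0" by (rule entry_mult_nz)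
      then have m: "iter k b x d y" "iter k z b w d" "z < b" "b < x" "y < d" "d < w" using minus[of b d] by auto
      then have "iter k z x w y" using iter_concat[OF m(2,1)] by auto
      then show False using m False by auto
    qed
    have "entry (Tmat k) x y z w = hq \<or> entry (Tmat k) x y z w = 0" using False by (auto simp: entry_Tmat)
    then show ?thesis using p by (auto simp: fbar_hq fbar_0)
  qed
  then show "entry (Tmat k + bar_mat (Tmat k) + Tmat k ** bar_mat (Tmat k)) x y z w = entry 0 x y z w"
    by (simp add: entry_add entry_bar_mat entry_zero)
qed

lemma Em_inv': "Tmat k + bar_mat (Tmat k) + bar_mat (Tmat k) ** Tmat k = 0"
proof -
  have "bar_mat (Tmat k + bar_mat (Tmat k) + Tmat k ** bar_mat (Tmat k)) = 0" unfolding Tmat_inv by (rule bar_mat_zero)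
  then show ?thesis by (simp add: bar_mat_add bar_mat_mult bar_mat_bar_mat add.commute)
qed

lemma unip_inv: "(mat 1 + Tmat k) ** (mat 1 + bar_mat (Tmat k)) = mat 1" "(mat 1 + bar_mat (Tmat k)) ** (mat 1 + Tmat k) = mat 1"
  using Tmat_inv[of k] Em_inv'[of k] by (simp_all add: matrix_add_ldistrib matrix_add_rdistrib add.commute add.left_commute add.assoc)

section \<open>Entries above the diagonal\<close>


text \<open>The product \<open>J\<close> with the tensor factors exchanged.\<close>

definition Jlevs :: "nat list \<Rightarrow> (complex fps, 'n) tmat" where
  "Jlevs ks = foldr (\<lambda>k X. Jlev (int k) ** X) ks (mat 1)"

text \<open>Preservation of the weight \<open>e\<^sub>x + e\<^sub>y\<close>, of which only the sum of the positions is used.\<close>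

definition homog :: "(complex fps, 'n) tmat \<Rightarrow> bool" where
  "homog A \<longleftrightarrow> (\<forall>x y z w. entry A x y z w \<noteq> 0 \<longrightarrow> x + y = z + w)"

lemma homog_Jtail: "homog (Jtail p)"
  unfolding homog_def
proof (intro allI impI)
  fix x y z w assume "entry (Jtail p) x y z w \<noteq> 0"
  then show "x + y = z + w" using Jtail_supp[of p x y z w] by (auto simp: supp_bound_def)
qed

end

context bd_mat
begin

interpretation rv: bd_mat N rG rs rht vx by (rule rev_bd_mat)

lemma dmat_cancel: "dmat (lev_wti k) ** dmat (lev_wt k) = mat 1" "dmat (lev_wt k) ** dmat (lev_wti k) = mat 1"
  by (simp_all add: dmat_mult dmat_one lev_wt_lev_wti)

lemma fbar_swt: "fbar (swt t x y) = swti t x y" "fbar (swti t x y) = swt t x y"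
  by (simp_all add: swt_def swti_def fbar_q fbar_1)

lemma bar_rot_rv_Jlev: "bar_rot (rv.Jlev k) = dmat (lev_wt k) ** (mat 1 + bar_mat (Tmat k)) ** dmat (lev_wti k)"
proof -
  have "fbar (rv.lev_wti k (N + 1 - x) (N + 1 - y)) = lev_wt k x y" for x y
    by (simp add: rv.lev_wti_def lev_wt_def fbar_mult fbar_prod rv_swt fbar_swt half_wti_def half_wt_def fbar_qpow fbar_1)
  moreover have "fbar (rv.lev_wt k (N + 1 - x) (N + 1 - y)) = lev_wti k x y" for x y
    by (simp add: rv.lev_wt_def lev_wti_def fbar_mult fbar_prod rv_swt fbar_swt half_wti_def half_wt_def fbar_qpow fbar_1)
  ultimately have "bar_rot (dmat (rv.lev_wti k)) = dmat (lev_wt k)" "bar_rot (dmat (rv.lev_wt k)) = dmat (lev_wti k)"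
    unfolding bar_rot_dmat by simp_all
  then show ?thesis unfolding rv.Jlev_def by (simp add: bar_rot_mult bar_rot_add bar_rot_one bar_rot_rv_Tmat matrix_mul_assoc)
qed

lemma Jlev_inv: "Jlev k ** bar_rot (rv.Jlev k) = mat 1" "bar_rot (rv.Jlev k) ** Jlev k = mat 1"
proof -
  have "Jlev k ** bar_rot (rv.Jlev k) = dmat (lev_wt k) ** ((mat 1 + Tmat k) ** (dmat (lev_wti k) ** dmat (lev_wt k)) ** (mat 1 + bar_mat (Tmat k))) ** dmat (lev_wti k)"
    unfolding bar_rot_rv_Jlev Jlev_def by (simp add: matrix_mul_assoc)
  then show "Jlev k ** bar_rot (rv.Jlev k) = mat 1" by (simp add: dmat_cancel unip_inv)
  have "bar_rot (rv.Jlev k) ** Jlev k = dmat (lev_wt k) ** ((mat 1 + bar_mat (Tmat k)) ** (dmat (lev_wti k) ** dmat (lev_wt k)) ** (mat 1 + Tmat k)) ** dmat (lev_wti k)"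
    unfolding bar_rot_rv_Jlev Jlev_def by (simp add: matrix_mul_assoc)
  then show "bar_rot (rv.Jlev k) ** Jlev k = mat 1" by (simp add: dmat_cancel unip_inv)
qed

text \<open>The inverse of the twist is the twist of the reversed triple, up to \<open>bar_rot\<close>.\<close>

lemma Jlevs_inv: "Jlevs ks ** bar_rot (rv.Jlevs ks) = mat 1" "bar_rot (rv.Jlevs ks) ** Jlevs ks = mat 1"
proof (induction ks)
  case Nil
  show "Jlevs [] ** bar_rot (rv.Jlevs []) = mat 1" "bar_rot (rv.Jlevs []) ** Jlevs [] = mat 1"
    by (simp_all add: Jlevs_def rv.Jlevs_def bar_rot_one)
next
  case (Cons k ks)
  have u: "Jlevs (k # ks) = Jlev (int k) ** Jlevs ks" "bar_rot (rv.Jlevs (k # ks)) = bar_rot (rv.Jlevs ks) ** bar_rot (rv.Jlev (int k))"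
    by (simp_all add: Jlevs_def rv.Jlevs_def bar_rot_mult)
  have "Jlevs (k # ks) ** bar_rot (rv.Jlevs (k # ks)) = Jlev (int k) ** (Jlevs ks ** bar_rot (rv.Jlevs ks)) ** bar_rot (rv.Jlev (int k))"
    unfolding u by (simp add: matrix_mul_assoc)
  then show "Jlevs (k # ks) ** bar_rot (rv.Jlevs (k # ks)) = mat 1" by (simp add: Cons Jlev_inv)
  have "bar_rot (rv.Jlevs (k # ks)) ** Jlevs (k # ks) = bar_rot (rv.Jlevs ks) ** (bar_rot (rv.Jlev (int k)) ** Jlev (int k)) ** Jlevs ks"
    unfolding u by (simp add: matrix_mul_assoc)
  then show "bar_rot (rv.Jlevs (k # ks)) ** Jlevs (k # ks) = mat 1" by (simp add: Cons Jlev_inv)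
qed

lemma Jlevs_invertible: "\<exists>I. flip (Jlevs ks) ** I = mat 1 \<and> I ** flip (Jlevs ks) = mat 1"
proof -
  have "flip (mat 1) = (mat 1 :: (complex fps, 'n) tmat)" by (rule mat_eqI) (auto simp: entry_flip entry_one pairs_ix_def)
  then show ?thesis using Jlevs_inv[of ks] by (metis flip_mult)
qed

lemma Tmat_zero_rv: "Tmat p = 0 \<Longrightarrow> rv.Tmat p = 0"
proof (rule mat_eqI)
  fix x y z w assume "Tmat p = 0"
  then show "entry (rv.Tmat p) x y z w = entry 0 x y z w"
    using rv_Tmat[of p "N + 1 - x" "N + 1 - y" "N + 1 - z" "N + 1 - w"] by (simp add: entry_zero)
qed

text \<open>The multiple \<open>(q - q\<^sup>-\<^sup>1) P\<close> of the permutation of the tensor factors.\<close>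

definition hflip :: "(complex fps, 'n) tmat" where
  "hflip = of_entries (\<lambda>x y z w. if x = w \<and> y = z then hq else 0)"

lemma entry_hflip: "entry hflip x y z w = (if x = w \<and> y = z \<and> (x, y) \<in> pairs_ix then hq else 0)"
  by (auto simp: hflip_def entry_of_entries pairs_ix_def)

lemma hflip_flip: "hflip ** flip A = A ** hflip"
proof (rule mat_eqI)
  fix x y z w assume i: "(x, y) \<in> pairs_ix" "(z, w) \<in> pairs_ix"
  have "entry (hflip ** flip A) x y z w = entry hflip x y y x * entry (flip A) y x z w"
    by (rule entry_mult_single) (auto simp: entry_hflip)
  moreover have "entry (A ** hflip) x y z w = entry A x y w z * entry hflip w z z w"
    by (rule entry_mult_single) (auto simp: entry_hflip)
  ultimately show "entry (hflip ** flip A) x y z w = entry (A ** hflip) x y z w"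
    using i by (auto simp: entry_hflip entry_flip pairs_ix_def mult.commute)
qed

lemma Rmat_inv: "bar_mat Rmat ** Rmat = mat 1"
proof -
  have bdg: "bar_mat (dmat (swt 0)) = dmat (swti 0)" by (rule mat_eqI) (auto simp: entry_bar_mat entry_dmat fbar_swt fbar_0)
  have 1: "dmat (swti 0) ** Tmat 0 = Tmat 0" by (rule mat_eqI) (simp add: entry_dmat_left Tmat_swt)
  have 2: "bar_mat (Tmat 0) ** dmat (swt 0) = bar_mat (Tmat 0)"
  proof -
    have "Tmat 0 ** dmat (swti 0) = Tmat 0" by (rule mat_eqI) (simp add: entry_dmat_right Tmat_swt)
    then have "bar_mat (Tmat 0 ** dmat (swti 0)) = bar_mat (Tmat 0)" by simp
    moreover have "bar_mat (dmat (swti 0)) = dmat (swt 0)" by (rule mat_eqI) (auto simp: entry_bar_mat entry_dmat fbar_swt fbar_0)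
    ultimately show ?thesis by (simp add: bar_mat_mult)
  qed
  have "bar_mat Rmat ** Rmat = dmat (swti 0) ** dmat (swt 0) + dmat (swti 0) ** Tmat 0 + (bar_mat (Tmat 0) ** dmat (swt 0) + bar_mat (Tmat 0) ** Tmat 0)"
    unfolding Rmat_def bar_mat_add bdg by (simp add: matrix_add_ldistrib matrix_add_rdistrib add.assoc add.left_commute)
  also have "\<dots> = mat 1 + (Tmat 0 + bar_mat (Tmat 0) + bar_mat (Tmat 0) ** Tmat 0)"
    unfolding 1 2 by (simp add: dmat_mult dmat_one swt_swti add.assoc)
  finally show ?thesis by (simp add: Em_inv')
qed

lemma flip_Rmat: "N \<ge> 2 \<Longrightarrow> flip Rmat = bar_mat Rmat + hflip"
proof (rule mat_eqI)
  fix x y z w assume "N \<ge> 2" "(x, y) \<in> pairs_ix" "(z, w) \<in> pairs_ix"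
  moreover have "(y, x) \<in> pairs_ix" using calculation by (auto simp: pairs_ix_def)
  ultimately show "entry (flip Rmat) x y z w = entry (bar_mat Rmat + hflip) x y z w"
    unfolding entry_flip entry_add entry_bar_mat entry_hflip entry_Rmat[OF \<open>N \<ge> 2\<close>]
    by (auto simp: fbar_q fbar_1 fbar_0 fbar_hq pairs_ix_def)
qed

lemma bar_rot_rv_Rmat: "N \<ge> 2 \<Longrightarrow> bar_rot rv.Rmat = bar_mat Rmat"
proof (rule mat_eqI)
  fix x y z w assume "N \<ge> 2"
  then have "entry rv.Rmat (N + 1 - z) (N + 1 - w) (N + 1 - x) (N + 1 - y) = entry Rmat x y z w"
    unfolding rv.entry_Rmat[OF \<open>N \<ge> 2\<close>] entry_Rmat[OF \<open>N \<ge> 2\<close>] pairs_ix_rev by (auto simp: pairs_ix_def)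
  then show "entry (bar_rot rv.Rmat) x y z w = entry (bar_mat Rmat) x y z w" by (simp add: entry_bar_rot entry_bar_mat)
qed

lemma homog_mult: "homog A \<Longrightarrow> homog B \<Longrightarrow> homog (A ** B)"
  unfolding homog_def by (metis entry_mult_nz)

lemma homog_flip: "homog A \<Longrightarrow> homog (flip A)" unfolding homog_def entry_flip by (metis add.commute)

lemma homog_dmat: "homog (dmat f)" by (auto simp: homog_def entry_dmat)

lemma homog_bar_rot: "homog A \<Longrightarrow> homog (bar_rot A)"
  unfolding homog_def
proof (intro allI impI)
  fix x y z w
  assume a: "\<forall>x y z w. entry A x y z w \<noteq> 0 \<longrightarrow> x + y = z + w" and nz: "entry (bar_rot A) x y z w \<noteq> 0"
  have "entry A (N + 1 - z) (N + 1 - w) (N + 1 - x) (N + 1 - y) \<noteq> 0"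
    using nz unfolding entry_bar_rot by (auto simp: fbar_0)
  from a[rule_format, OF this] show "x + y = z + w" by simp
qed

lemma homog_Rmat: "N \<ge> 2 \<Longrightarrow> homog Rmat" by (auto simp: homog_def entry_Rmat split: if_splits)

text \<open>
  By \<open>iter_height\<close>, the level of a segment and its image is unique. Thus each entry of \<open>Stail\<close>
  comes from a single level and is a constant times a power of \<open>q\<close> times \<open>q - q\<^sup>-\<^sup>1\<close>.
\<close>

lemma Stail_zero_if_iter:
  assumes "iter p z x y w \<or> iter p z x w y" "z < x" "y < w"
  shows "entry (Stail (p + 1)) x y z w = 0"
proof (rule ccontr)
  assume "entry (Stail (p + 1)) x y z w \<noteq> 0"
  then obtain j where j: "j \<ge> p + 1" "entry (Tmat j) x y z w \<noteq> 0" using Stail_supp by blast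
  have h: "height_sum y w = height_sum z x + i * (x - z)" if "iter i z x y w \<or> iter i z x w y" for i
    using that iter_height[of i z x y w] iter_height[of i z x w y] height_sum_swap[of w y] assms(2) by auto
  have "height_sum y w = height_sum z x + j * (x - z)" "height_sum y w = height_sum z x + p * (x - z)"
    using h assms(1) Tmat_cases[OF j(2)] by blast+
  then have "(j - p) * (x - z) = 0" by (simp add: algebra_simps)
  then show False using j assms(2) by auto
qed

lemma Stail_zero_if_Tmat: "entry (Tmat p) x y z w \<noteq> 0 \<Longrightarrow> entry (Stail (p + 1)) x y z w = 0"
  using Tmat_cases[of p x y z w] Stail_zero_if_iter by blast

lemma GGS_Tmat: "GGS_form (entry (Tmat p) x y z w)"
proof -
  have 1: "GGS_form (hq * (- inverse q) ^ n)" for n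
  proof -
    have "- inverse q = fps_const (- 1) * qpow (- 1)"
      unfolding qi_qpow fps_const_neg[symmetric] fps_const_1_eq_1 by simp
    then have "(- inverse q) ^ n = fps_const ((- 1) ^ n) * qpow (- of_nat n)"
      by (simp only: power_mult_distrib fps_const_power qpow_power mult_minus1_right)
    then have "hq * (- inverse q) ^ n = fps_const ((- 1) ^ n) * qpow (- of_nat n) * hq ^ 1"
      by (simp only: mult_ac power_one_right)
    then show ?thesis unfolding GGS_form_def by blast
  qed
  show ?thesis using 1 1[of 0] GGS_0 unfolding entry_Tmat by simp
qed

lemma GGS_Stail: "GGS_form (entry (Stail p) x y z w)"
proof (induction p rule: down_induct[where k = order_bound])
  case (big p)
  then show ?case by (simp add: Stail_big entry_zero GGS_0)
next
  case (step p)
  have "GGS_form (entry (Tmat p) x y z w + entry (Stail (p + 1)) x y z w)"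
    using Stail_zero_if_Tmat[of p x y z w] GGS_Tmat[of p x y z w] step.IH by (cases "entry (Tmat p) x y z w = 0") simp_all
  moreover have "swti p a b = qpow (if straight p a b then - 1 else 0)" for a b
    by (simp add: swti_def qi_qpow qpow_0)
  ultimately show ?case unfolding entry_Stail[of p] by (simp only: GGS_mult_qpow GGS_mult_qpow')
qed

text \<open>
  Let \<open>A = flip J\<close> with inverse \<open>B\<close>, so that \<open>X = flip B ** Rmat ** A\<close>, and let \<open>X'\<close> be the matrix
  \<open>X\<close> of the reversed data. Then \<open>bar_rot X' = B ** bar_mat Rmat ** flip A\<close> is the inverse of \<open>X\<close>, and
  \<open>flip Rmat = bar_mat Rmat + hflip\<close> turns into \<open>flip X = bar_rot X' + hflip\<close>. This is the quadratic
  relation for \<open>X\<close>. Entrywise it compares entries above and below the diagonal, since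
  \<open>twisted_matrix_lower_part\<close> describes both \<open>X\<close> and \<open>X'\<close> by the same matrix \<open>Stail 0\<close>.
\<close>

theorem twisted_matrix_properties:
  assumes N: "N \<ge> 2" and m: "\<And>p. p > int m \<Longrightarrow> Tmat p = 0"
    and J: "J = flip (Jlevs [1..<Suc m])" and X: "J ** X = Rmat ** flip J"
  shows "GGS_form (entry X x y z w)"
    and "fps_nth (entry X y x w z) 2 = fps_nth (entry X x y z w) 2"
    and "flip X ** X = mat 1 + hflip ** X"
proof -
  define A where "A = Jlevs [1..<Suc m]"
  define B where "B = bar_rot (rv.Jlevs [1..<Suc m])"
  have AB: "A ** B = mat 1" "B ** A = mat 1" unfolding A_def B_def by (rule Jlevs_inv)+
  have ff: "flip (flip C) = C" for C :: "(complex fps, 'n) tmat" by (rule mat_eqI) (simp add: entry_flip)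
  have f1: "flip (mat 1) = (mat 1 :: (complex fps, 'n) tmat)" by (rule mat_eqI) (auto simp: entry_flip entry_one pairs_ix_def)
  have fA: "J = flip A" "flip J = A" using J by (simp_all add: A_def ff)
  have JB: "J ** flip B = mat 1" "flip B ** J = mat 1"
    using AB unfolding fA(1) by (simp_all add: flip_mult[symmetric] f1)
  have A1: "A = dmat half_wt ** Jtail 1 ** dmat half_wti"
  proof -
    have "lev_wt 1 = half_wt" "lev_wti 1 = half_wti" by (auto simp: lev_wt_def lev_wti_def fun_eq_iff)
    then show ?thesis using Jlev_foldr[of m 1, OF m] unfolding A_def Jlevs_def by (simp del: upt_Suc)
  qed
  have rA1: "rv.Jlevs [1..<Suc m] = dmat rv.half_wt ** rv.Jtail 1 ** dmat rv.half_wti"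
  proof -
    have "rv.lev_wt 1 = rv.half_wt" "rv.lev_wti 1 = rv.half_wti" by (auto simp: rv.lev_wt_def rv.lev_wti_def fun_eq_iff)
    then show ?thesis using rv.Jlev_foldr[of m 1, OF Tmat_zero_rv[OF m]] unfolding rv.Jlevs_def by (simp del: upt_Suc)
  qed
  have Xe: "X = flip B ** Rmat ** A"
  proof -
    have "flip B ** (J ** X) = flip B ** (Rmat ** A)" using X fA by simp
    then show ?thesis by (simp add: matrix_mul_assoc JB)
  qed
  \<comment> \<open>The matrix \<open>X\<close> of the reversed data.\<close>
  define X' where "X' = flip (bar_rot A) ** rv.Rmat ** rv.Jlevs [1..<Suc m]"
  have rB: "rv.Jlevs [1..<Suc m] = bar_rot B" by (simp add: B_def bar_rot_bar_rot)
  have X': "flip (rv.Jlevs [1..<Suc m]) ** X' = rv.Rmat ** rv.Jlevs [1..<Suc m]"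
  proof -
    have "bar_rot B ** bar_rot A = mat 1" using AB by (metis bar_rot_mult bar_rot_one)
    then have "flip (bar_rot B) ** flip (bar_rot A) = mat 1" by (simp add: flip_mult[symmetric] f1)
    then show ?thesis unfolding X'_def rB by (simp add: matrix_mul_assoc)
  qed
  have sbX': "bar_rot X' = B ** bar_mat Rmat ** flip A"
    unfolding X'_def by (simp add: bar_rot_mult bar_rot_flip bar_rot_bar_rot bar_rot_rv_Rmat[OF N] B_def matrix_mul_assoc)
  have fX: "flip X = bar_rot X' + hflip"
  proof -
    have "flip X = B ** (bar_mat Rmat + hflip) ** flip A"
      unfolding Xe by (simp add: flip_mult ff flip_Rmat[OF N] matrix_mul_assoc)
    also have "\<dots> = bar_rot X' + B ** (hflip ** flip A)"
      unfolding sbX' by (simp add: matrix_add_ldistrib matrix_add_rdistrib matrix_mul_assoc)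
    also have "B ** (hflip ** flip A) = hflip" unfolding hflip_flip by (simp add: matrix_mul_assoc AB)
    finally show ?thesis .
  qed
  have "bar_rot X' ** X = B ** (bar_mat Rmat ** (flip A ** flip B) ** Rmat) ** A"
    unfolding sbX' Xe by (simp add: matrix_mul_assoc)
  also have "\<dots> = mat 1" using JB AB fA by (simp add: Rmat_inv)
  finally show "flip X ** X = mat 1 + hflip ** X" unfolding fX by (simp add: matrix_add_rdistrib)
  have loX: "entry X x y z w = half_wt x y * entry (Stail 0) x y z w * half_wt z w" if "z < x" for x y z w
    using twisted_matrix_lower_part(1)[OF N _ that, of X] X fA A1 by simp
  have diX: "entry X x y x w = (if y = w then entry Rmat x y x w else 0)" for x y w
    using twisted_matrix_lower_part(2)[OF N, of X] X fA A1 by simp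
  have loX': "entry X' x y z w = rv.half_wt x y * entry (rv.Stail 0) x y z w * rv.half_wt z w" if "z < x" for x y z w
    using rv.twisted_matrix_lower_part(1)[OF N _ that, of X'] X' rA1 by simp
  \<comment> \<open>Both \<open>X\<close> and \<open>X'\<close> are given by \<open>Stail 0\<close> below the diagonal, and \<open>bar_rot\<close> moves entries of \<open>X'\<close> above it.\<close>
  have up: "entry X y x w z = fbar (entry X x y z w) + entry hflip x y z w" if "z < x" for x y z w
  proof -
    have "entry X y x w z = entry (flip X) x y z w" by (simp add: entry_flip)
    also have "\<dots> = fbar (entry X' (N + 1 - z) (N + 1 - w) (N + 1 - x) (N + 1 - y)) + entry hflip x y z w"
      unfolding fX entry_add entry_bar_rot ..
    also have "entry X' (N + 1 - z) (N + 1 - w) (N + 1 - x) (N + 1 - y) = half_wt z w * entry (Stail 0) x y z w * half_wt x y"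
      using loX'[of "N + 1 - x" "N + 1 - z" "N + 1 - w" "N + 1 - y"] that rv_Stail[of 0 z w x y]
      by (simp add: half_wt_def)
    also have "\<dots> = entry X x y z w" unfolding loX[OF that] by (simp only: mult_ac)
    finally show ?thesis .
  qed
  note up = this
  have hq2: "fps_nth hq 2 = 0" unfolding qi_qpow by (simp add: q_qpow qpow_def)
  have low2: "fps_nth (entry X y x w z) 2 = fps_nth (entry X x y z w) 2" if "z < x" for x y z w
    unfolding up[OF that] using hq2 by (simp add: entry_hflip fbar_def)
  have shq: "half_wt a b = qpow (if a = b then 1 / 2 else 0)" for a b by (simp add: half_wt_def qpow_0)
  have GGl: "GGS_form (entry X x y z w)" if "z < x" for x y z w
    unfolding loX[OF that] shq by (intro GGS_mult_qpow' GGS_mult_qpow GGS_Stail)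
  have "homog X" 
  proof -
    have "homog A" unfolding A1 by (intro homog_mult homog_dmat homog_Jtail)
    moreover have "homog B"
      unfolding B_def rA1 by (intro homog_bar_rot homog_mult homog_dmat) (use rv.homog_Jtail in \<open>simp add: homog_def rv.homog_def\<close>)
    ultimately show ?thesis unfolding Xe by (intro homog_mult homog_flip homog_Rmat[OF N])
  qed
  have hX: "x + y = z + w" if "entry X x y z w \<noteq> 0" for x y z w using that \<open>homog X\<close> unfolding homog_def by blast
  show "fps_nth (entry X y x w z) 2 = fps_nth (entry X x y z w) 2"
  proof -
    consider "z < x" | "w < y" | "x \<le> z" "y \<le> w" by linarith
    then show ?thesis
    proof cases
      case 1 then show ?thesis by (rule low2)
    next
      case 2 then show ?thesis by (rule low2[symmetric])
    next
      case 3
      have "entry X x y z w = 0 \<and> entry X y x w z = 0 \<or> x = z \<and> y = w" using hX[of x y z w] hX[of y x w z] 3 by fastforce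
      then show ?thesis using diX[of x y y] diX[of y x x] by (auto simp: entry_Rmat[OF N] pairs_ix_def)
    qed
  qed
  consider "z < x" | "z = x" | "x < z" by linarith
  then show "GGS_form (entry X x y z w)"
  proof cases
    case 1 then show ?thesis by (rule GGl)
  next
    case 2
    have "GGS_form q" "GGS_form 1" using GGS_qpow[of 1] GGS_qpow[of 0] by (simp_all add: q_qpow qpow_0)
    then show ?thesis unfolding 2 diX entry_Rmat[OF N] using GGS_0 by simp
  next
    case 3
    show ?thesis
    proof (cases "entry X x y z w = 0")
      case False
      then have "w < y" using \<open>homog X\<close> 3 unfolding homog_def by force
      note u = up[OF this, of x z]
      show ?thesis
      proof (cases "entry hflip y x w z = 0")
        case True
        then show ?thesis using u GGS_fbar[OF GGl[OF \<open>w < y\<close>, of x z]] by simp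
      next
        case nP: False
        \<comment> \<open>An entry of \<open>P\<close>: the mirror entry is \<open>q - q\<^sup>-\<^sup>1\<close>, whose image under \<open>fbar\<close> cancels \<open>hflip\<close>.\<close>
        then have p: "y = z" "x = w" "(y, x) \<in> pairs_ix" by (auto simp: entry_hflip split: if_splits)
        have e: "entry (Tmat 0) y x x y = hq" using p \<open>w < y\<close> by (simp add: entry_Em0)
        have "entry (Stail 0) y x x y = hq"
        proof -
          have "entry (Stail (0 + 1)) y x x y = 0"
            by (rule Stail_zero_if_iter) (use p \<open>w < y\<close> in \<open>auto simp: iter_0 pairs_ix_def\<close>)
          moreover have "\<not> straight 0 y x" "\<not> straight 0 x y" using straight_0[OF N] p \<open>w < y\<close> by auto
          ultimately show ?thesis unfolding entry_Stail[of 0] using e by (simp add: swti_def)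
        qed
        then have "entry X y x x y = hq" using loX[of x y x y] p \<open>w < y\<close> by (simp add: half_wt_def)
        then have "entry X x y z w = 0" using u p by (simp add: entry_hflip fbar_hq)
        then show ?thesis by (simp add: GGS_0)
      qed
    qed (simp add: GGS_0)
  qed
qed

end

section \<open>From a map of edges to a map of vertices\<close>

text \<open>The action of a Belavin-Drinfeld triple on the indices of the simple roots.\<close>

locale edge_map =
  fixes N :: int and G :: "int set" and t :: "int \<Rightarrow> int"
  assumes G_ivl: "G \<subseteq> {1..<N}"
    and t_ivl: "e \<in> G \<Longrightarrow> t e \<in> {1..<N}"
    and t_inj: "inj_on t G"
    and t_adj: "e \<in> G \<Longrightarrow> f \<in> G \<Longrightarrow> \<bar>t e - t f\<bar> = 1 \<longleftrightarrow> \<bar>e - f\<bar> = 1"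
    and t_nil: "e \<in> G \<Longrightarrow> \<exists>k. (t ^^ k) e \<notin> G"
begin

text \<open>
  Whether \<open>t\<close> reverses the component of \<open>e\<close>, read off from a neighbouring edge in \<open>G\<close>; an
  isolated edge keeps its orientation.
\<close>

definition edge_rev :: "int \<Rightarrow> bool" where
  "edge_rev e \<longleftrightarrow> (e + 1 \<in> G \<and> t (e + 1) < t e) \<or> (e + 1 \<notin> G \<and> e - 1 \<in> G \<and> t e < t (e - 1))"

text \<open>
  The ends of \<open>e\<close> go to the ends of \<open>t e\<close>. A vertex at which no edge of \<open>G\<close> begins is treated as the
  right end of the edge \<open>x - 1\<close>.
\<close>

definition vmap :: "int \<Rightarrow> int" where
  "vmap x = (if x \<in> G then (if edge_rev x then t x + 1 else t x)
     else if edge_rev (x - 1) then t (x - 1) else t (x - 1) + 1)"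

text \<open>Minus the number of steps after which the orbit leaves \<open>G\<close>.\<close>

definition height :: "int \<Rightarrow> int" where
  "height e = - int (LEAST k. (t ^^ k) e \<notin> G)"

lemma t_next:
  assumes "e \<in> G" "e + 1 \<in> G"
  shows "t (e + 1) = t e + 1 \<or> t (e + 1) = t e - 1"
  using t_adj[OF assms] by auto

lemma edge_rev_next:
  assumes "e \<in> G" "e + 1 \<in> G"
  shows "edge_rev (e + 1) \<longleftrightarrow> edge_rev e"
proof (cases "e + 2 \<in> G")
  case True
  then have "e + 1 + 1 \<in> G" by (simp add: add.commute)
  have "t (e + 2) \<noteq> t e" using t_inj assms True unfolding inj_on_def by force
  moreover have "t (e + 2) = t (e + 1) + 1 \<or> t (e + 2) = t (e + 1) - 1"
    using t_next[OF assms(2)] True by (simp add: add.assoc)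
  ultimately show ?thesis using t_next[OF assms] assms True by (auto simp: edge_rev_def add.assoc)
next
  case False
  then show ?thesis using t_next[OF assms] assms by (auto simp: edge_rev_def add.assoc)
qed

lemma vmap_edge:
  assumes "e \<in> G"
  shows "vmap e = (if edge_rev e then t e + 1 else t e)" "vmap (e + 1) = (if edge_rev e then t e else t e + 1)"
proof -
  show "vmap e = (if edge_rev e then t e + 1 else t e)" using assms by (simp add: vmap_def)
  show "vmap (e + 1) = (if edge_rev e then t e else t e + 1)"
  proof (cases "e + 1 \<in> G")
    case True
    then show ?thesis using t_next[OF assms True] edge_rev_next[OF assms True] assms
      by (auto simp: vmap_def edge_rev_def)
  next
    case False
    then show ?thesis by (simp add: vmap_def)
  qed
qed

lemma edge_map_bd_map: "bd_map N G vmap height"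
proof
  show "G \<subseteq> {1..<N}" by (rule G_ivl)
next
  fix e assume e: "e \<in> G"
  show "vmap e \<in> {1..N} \<and> vmap (e + 1) \<in> {1..N}" using t_ivl[OF e] by (auto simp: vmap_edge[OF e])
  show "\<bar>vmap (e + 1) - vmap e\<bar> = 1" by (auto simp: vmap_edge[OF e])
  have "min (vmap e) (vmap (e + 1)) = t e" by (auto simp: vmap_edge[OF e])
  moreover have "(LEAST k. (t ^^ k) e \<notin> G) = Suc (LEAST k. (t ^^ k) (t e) \<notin> G)"
  proof -
    obtain k where "(t ^^ k) e \<notin> G" using t_nil[OF e] by blast
    then have "(LEAST k. (t ^^ k) e \<notin> G) = Suc (LEAST k. (t ^^ Suc k) e \<notin> G)"
      by (rule Least_Suc) (use e in simp)
    then show ?thesis by (simp add: funpow_swap1)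
  qed
  ultimately show "height (min (vmap e) (vmap (e + 1))) = height e + 1" by (simp add: height_def)
next
  fix e assume e: "e \<in> G" "e + 1 \<in> G"
  show "vmap (e + 2) - vmap (e + 1) = vmap (e + 1) - vmap e"
    using vmap_edge[OF e(1)] vmap_edge[OF e(2)] edge_rev_next[OF e] t_next[OF e] e
    by (auto simp: add.assoc)
next
  show "inj_on vmap (G \<union> (\<lambda>e. e + 1) ` G)"
  proof (rule inj_onI)
    fix x y assume x: "x \<in> G \<union> (\<lambda>e. e + 1) ` G" and y: "y \<in> G \<union> (\<lambda>e. e + 1) ` G" and eq: "vmap x = vmap y"
    obtain e where e: "e \<in> G" "x = e \<or> x = e + 1" using x by auto
    obtain f where f: "f \<in> G" "y = f \<or> y = f + 1" using y by auto
    note v = vmap_edge[OF e(1)] vmap_edge[OF f(1)]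
    have "\<bar>t e - t f\<bar> \<le> 1" using v e(2) f(2) eq by (auto split: if_splits)
    then consider "t e = t f" | "\<bar>t e - t f\<bar> = 1" by linarith
    then show "x = y"
    proof cases
      case 1
      then have "e = f" using t_inj e f by (auto simp: inj_on_def)
      then show ?thesis using v e(2) f(2) eq by (auto split: if_splits)
    next
      case 2
      then have "\<bar>e - f\<bar> = 1" using t_adj[OF e(1) f(1)] by simp
      then consider "f = e + 1" | "e = f + 1" by linarith
      then show ?thesis
      proof cases
        case 1
        then show ?thesis using v e f eq edge_rev_next[of e] t_next[of e] by (auto split: if_splits)
      next
        case 2
        then show ?thesis using v e f eq edge_rev_next[of f] t_next[of f] by (auto split: if_splits)
      qed
    qed
  qed
qed

text \<open>
  An edge whose orientation is reversed has a neighbour in \<open>G\<close> with the same property. This is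
  how the orientation of \<open>T\<close> on simple roots is defined.
\<close>

lemma vmap_reversed_iff:
  assumes "e \<in> G"
  shows "vmap (e + 1) < vmap e \<longleftrightarrow> (\<exists>i. (e = i \<or> e = i + 1) \<and> i \<in> G \<and> i + 1 \<in> G \<and> vmap (i + 2) < vmap i)"
proof -
  have two: "vmap (i + 2) < vmap i \<longleftrightarrow> edge_rev i" if "i \<in> G" "i + 1 \<in> G" for i
    using vmap_edge[OF that(1)] vmap_edge[OF that(2)] edge_rev_next[OF that] t_next[OF that] that
    by (auto simp: add.assoc)
  have one: "vmap (e + 1) < vmap e \<longleftrightarrow> edge_rev e" by (auto simp: vmap_edge[OF assms])
  show ?thesis
  proof
    assume "vmap (e + 1) < vmap e"
    then have r: "edge_rev e" using one by simp
    show "\<exists>i. (e = i \<or> e = i + 1) \<and> i \<in> G \<and> i + 1 \<in> G \<and> vmap (i + 2) < vmap i"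
    proof (cases "e + 1 \<in> G")
      case True
      then show ?thesis using two[OF assms True] r assms by blast
    next
      case False
      then have i: "e - 1 \<in> G" using r by (auto simp: edge_rev_def)
      then have "edge_rev (e - 1)" using edge_rev_next[of "e - 1"] assms r by simp
      then have "vmap (e - 1 + 2) < vmap (e - 1)" using two[of "e - 1"] i assms by simp
      then show ?thesis using i assms by (intro exI[of _ "e - 1"]) auto
    qed
  next
    assume "\<exists>i. (e = i \<or> e = i + 1) \<and> i \<in> G \<and> i + 1 \<in> G \<and> vmap (i + 2) < vmap i"
    then obtain i where i: "e = i \<or> e = i + 1" "i \<in> G" "i + 1 \<in> G" "edge_rev i" using two by blast
    then show "vmap (e + 1) < vmap e" using one edge_rev_next[OF i(2,3)] by auto
  qed
qed

end

section \<open>Roots as segments\<close>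

lemma idx_bij: "bij_betw (idx :: nat \<Rightarrow> 'n::finite) {1..CARD('n)} UNIV"
proof -
  obtain f where "bij_betw f {1..CARD('n)} (UNIV :: 'n set)"
    using ex_bij_betw_nat_finite_1[of "UNIV :: 'n set"] by auto
  then show ?thesis unfolding idx_def by (rule someI[where P = "\<lambda>f. bij_betw f {1..CARD('n)} UNIV"])
qed

definition vx :: "int \<Rightarrow> 'n::finite" where "vx i = idx (nat i)"

lemma vx_bij_betw: "bij_betw (vx :: int \<Rightarrow> 'n::finite) {1..int CARD('n)} UNIV"
proof -
  have "bij_betw nat {1..int CARD('n)} {1..CARD('n)}"
    by (rule bij_betwI[where g = int]) auto
  from bij_betw_trans[OF this idx_bij] show ?thesis by (simp add: vx_def[abs_def] comp_def)
qed

lemma vx_eq: "i \<in> {1..int CARD('n)} \<Longrightarrow> j \<in> {1..int CARD('n)} \<Longrightarrow> (vx i :: 'n::finite) = vx j \<longleftrightarrow> i = j"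
  using vx_bij_betw[where 'n = 'n] by (auto simp: bij_betw_def inj_on_def)

text \<open>
  The indices are integers because reflections and differences of positions would be truncated on
  natural numbers.
\<close>

definition rt :: "int \<Rightarrow> int \<Rightarrow> 'n::finite cvec" where
  "rt i j = basis_vec (nat i) - basis_vec (nat j)"

abbreviation sr :: "int \<Rightarrow> 'n::finite cvec" where "sr e \<equiv> rt e (e + 1)"

lemma basis_vec_vx: "basis_vec (nat i) = axis (vx i) 1" by (simp add: basis_vec_def vx_def)

lemma rt_nth:
  assumes "i \<in> {1..int CARD('n)}" "j \<in> {1..int CARD('n)}" "k \<in> {1..int CARD('n)}"
  shows "(rt i j :: 'n::finite cvec) $ vx k = (if k = i then 1 else 0) - (if k = j then 1 else 0)"
  using assms vx_eq[of k i] vx_eq[of k j] by (auto simp: rt_def basis_vec_vx axis_def)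

lemma rt_inj:
  assumes "i \<in> {1..int CARD('n)}" "j \<in> {1..int CARD('n)}" "i \<noteq> j"
    "i' \<in> {1..int CARD('n)}" "j' \<in> {1..int CARD('n)}" "i' \<noteq> j'" "(rt i j :: 'n::finite cvec) = rt i' j'"
  shows "i = i' \<and> j = j'"
  using rt_nth[where 'n = 'n, OF assms(1,2,1)] rt_nth[where 'n = 'n, OF assms(4,5,1)]
    rt_nth[where 'n = 'n, OF assms(1,2,2)] rt_nth[where 'n = 'n, OF assms(4,5,2)] assms
  by (auto split: if_splits)

lemma rt_uminus: "- rt i j = rt j i" by (simp add: rt_def)

lemma simple_root_sr: "simple_root (nat e) = (sr e :: 'n::finite cvec)" if "e \<ge> 0"
  using that by (simp add: simple_root_def rt_def nat_add_distrib)

lemma simple_roots_sr: "(simple_roots :: 'n::finite cvec set) = sr ` {1..<int CARD('n)}"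
proof -
  have "(simple_roots :: 'n cvec set) = (\<lambda>i. simple_root i) ` {1..<CARD('n)}" by (auto simp: simple_roots_def)
  also have "\<dots> = sr ` {1..<int CARD('n)}"
  proof (intro equalityI subsetI)
    fix v :: "'n cvec" assume "v \<in> simple_root ` {1..<CARD('n)}"
    then obtain i where "i \<in> {1..<CARD('n)}" "v = simple_root i" by blast
    then show "v \<in> sr ` {1..<int CARD('n)}" using simple_root_sr[of "int i", where 'n = 'n] by (intro image_eqI[of _ _ "int i"]) auto
  next
    fix v :: "'n cvec" assume "v \<in> sr ` {1..<int CARD('n)}"
    then obtain e where "e \<in> {1..<int CARD('n)}" "v = sr e" by blast
    then show "v \<in> simple_root ` {1..<CARD('n)}" using simple_root_sr[of e, where 'n = 'n] by (intro image_eqI[of _ _ "nat e"]) auto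
  qed
  finally show ?thesis .
qed

lemma root_ix_rt:
  assumes "i \<in> {1..int CARD('n)}" "j \<in> {1..int CARD('n)}" "i \<noteq> j"
  shows "root_ix (rt i j :: 'n::finite cvec) = (nat i, nat j)"
  unfolding root_ix_def
proof (rule the_equality)
  show "case (nat i, nat j) of (a, b) \<Rightarrow> a \<in> {1..CARD('n)} \<and> b \<in> {1..CARD('n)} \<and> a \<noteq> b \<and>
    (rt i j :: 'n cvec) = basis_vec a - basis_vec b"
    using assms by (auto simp: rt_def)
next
  fix u :: "nat \<times> nat"
  obtain a b where u: "u = (a, b)" by (cases u)
  assume "case u of (a, b) \<Rightarrow> a \<in> {1..CARD('n)} \<and> b \<in> {1..CARD('n)} \<and> a \<noteq> b \<and>
    (rt i j :: 'n cvec) = basis_vec a - basis_vec b"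
  then have h: "a \<in> {1..CARD('n)}" "b \<in> {1..CARD('n)}" "a \<noteq> b" "(rt i j :: 'n cvec) = rt (int a) (int b)"
    by (auto simp: u rt_def)
  have "i = int a \<and> j = int b" using rt_inj[OF assms _ _ _ h(4)] h by auto
  then show "u = (nat i, nat j)" using u by simp
qed

text \<open>The functional dual to the simple root \<open>sr e\<close>.\<close>

definition phi :: "int \<Rightarrow> 'n::finite cvec \<Rightarrow> complex" where
  "phi e v = (\<Sum>k\<in>{1..e}. v $ vx k)"

lemma phi_sum: "phi e (sum f A) = (\<Sum>a\<in>A. phi e (f a))"
  unfolding phi_def by (subst sum.swap) simp

lemma phi_add: "phi e (v + w) = phi e v + phi e w" by (simp add: phi_def sum.distrib)

lemma phi_scale: "phi e (c *s v) = c * phi e v" by (simp add: phi_def sum_distrib_left)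

lemma phi_rt:
  assumes "i \<in> {1..int CARD('n)}" "j \<in> {1..int CARD('n)}" "e \<in> {1..int CARD('n)}"
  shows "phi e (rt i j :: 'n::finite cvec) = (if i \<le> e then 1 else 0) - (if j \<le> e then 1 else 0)"
proof -
  have "phi e (rt i j :: 'n cvec) = (\<Sum>k\<in>{1..e}. (if k = i then 1 else 0) - (if k = j then 1 else 0))"
    unfolding phi_def using assms by (intro sum.cong rt_nth) auto
  also have "\<dots> = (if i \<le> e then 1 else 0) - (if j \<le> e then 1 else 0)"
    unfolding sum_subtractf using assms by (simp add: sum.delta')
  finally show ?thesis .
qed

lemma phi_sr:
  assumes "e \<in> {1..<int CARD('n)}" "f \<in> {1..<int CARD('n)}"
  shows "phi e (sr f :: 'n::finite cvec) = (if e = f then 1 else 0)"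
  using phi_rt[of f "f + 1" e, where 'n = 'n] assms by auto

lemma sr_inj: "inj_on (sr :: int \<Rightarrow> 'n::finite cvec) {1..<int CARD('n)}"
proof (rule inj_onI)
  fix e f assume a: "e \<in> {1..<int CARD('n)}" "f \<in> {1..<int CARD('n)}" "(sr e :: 'n cvec) = sr f"
  then have "phi e (sr f :: 'n cvec) = 1" using phi_sr[of e e, where 'n = 'n] by simp
  then show "e = f" using phi_sr[OF a(1,2)] by (simp split: if_splits)
qed

lemma rt_telescope: "i \<le> j \<Longrightarrow> (rt i j :: 'n::finite cvec) = (\<Sum>e\<in>{i..<j}. sr e)"
proof (induction j rule: int_ge_induct)
  case base then show ?case by (simp add: rt_def)
next
  case (step j)
  have "{i..<j + 1} = insert j {i..<j}" using step by auto
  then have "(\<Sum>e\<in>{i..<j + 1}. sr e :: 'n cvec) = sr j + (\<Sum>e\<in>{i..<j}. sr e)" by simp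
  also have "\<dots> = sr j + rt i j" using step by simp
  also have "\<dots> = rt i (j + 1)" by (simp add: rt_def)
  finally show ?case by simp
qed

text \<open>
  The functional \<open>phi e\<close> vanishes on the span of the simple roots other than \<open>sr e\<close>, but not on a
  root through the edge \<open>e\<close>.
\<close>

lemma rt_in_span:
  assumes Y: "Y \<subseteq> (simple_roots :: 'n::finite cvec set)" and ij: "1 \<le> i" "i < j" "j \<le> int CARD('n)"
  shows "rt i j \<in> vec.span Y \<longleftrightarrow> (\<forall>e\<in>{i..<j}. sr e \<in> Y)"
proof
  assume a: "\<forall>e\<in>{i..<j}. sr e \<in> Y"
  have "(\<Sum>e\<in>{i..<j}. sr e) \<in> vec.span Y"
    by (rule vec.span_sum, rule vec.span_base) (use a in blast)
  then show "rt i j \<in> vec.span Y" using rt_telescope[of i j, where 'n = 'n] ij by simp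
next
  assume r: "rt i j \<in> vec.span Y"
  show "\<forall>e\<in>{i..<j}. sr e \<in> Y"
  proof (rule ballI, rule ccontr)
    fix e assume e: "e \<in> {i..<j}" "(sr e :: 'n cvec) \<notin> Y"
    have "Y \<subseteq> {v. phi e v = 0}"
    proof
      fix v assume v: "v \<in> Y"
      then obtain f where f: "f \<in> {1..<int CARD('n)}" "v = sr f" using Y simple_roots_sr by blast
      then have "e \<noteq> f" using e v by auto
      then show "v \<in> {v. phi e v = 0}" using phi_sr[of e f, where 'n = 'n] f e ij by simp
    qed
    moreover have "vec.subspace {v :: 'n cvec. phi e v = 0}"
      by (auto simp: vec.subspace_def phi_scale phi_add) (simp add: phi_def)
    ultimately have "phi e (rt i j :: 'n cvec) = 0" using vec.span_minimal r by blast
    then show False using phi_rt[of i j e, where 'n = 'n] e ij by simp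
  qed
qed

text \<open>
  The functionals \<open>phi\<close> show that the coefficients with respect to simple roots are unique, so the
  description in the definition of \<open>ext\<close> singles out the sum over the edges.
\<close>

lemma ext_rt:
  assumes Y: "Y \<subseteq> (simple_roots :: 'n::finite cvec set)" and ij: "1 \<le> i" "i < j" "j \<le> int CARD('n)"
    and e: "\<forall>e\<in>{i..<j}. sr e \<in> Y"
  shows "ext T Y (rt i j) = (\<Sum>e\<in>{i..<j}. T (sr e))"
proof -
  have "finite (simple_roots :: 'n cvec set)" unfolding simple_roots_sr by simp
  then have fin: "finite Y" using Y finite_subset by metis
  have sr_ex: "\<exists>f\<in>{1..<int CARD('n)}. \<gamma> = sr f" if "\<gamma> \<in> Y" for \<gamma>
    using that Y unfolding simple_roots_sr by blast
  have inj: "inj_on (sr :: int \<Rightarrow> 'n cvec) {i..<j}" by (rule inj_on_subset[OF sr_inj]) (use ij in auto)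
  define c0 :: "'n cvec \<Rightarrow> complex" where "c0 \<gamma> = (if \<gamma> \<in> sr ` {i..<j} then 1 else 0)" for \<gamma>
  have c0: "(\<Sum>\<gamma>\<in>Y. c0 \<gamma> *s g \<gamma>) = (\<Sum>e\<in>{i..<j}. g (sr e))" for g :: "'n cvec \<Rightarrow> 'n cvec"
  proof -
    have "(\<Sum>\<gamma>\<in>Y. c0 \<gamma> *s g \<gamma>) = (\<Sum>\<gamma>\<in>sr ` {i..<j}. c0 \<gamma> *s g \<gamma>)"
      by (rule sum.mono_neutral_right) (use fin e in \<open>auto simp: c0_def\<close>)
    also have "\<dots> = (\<Sum>\<gamma>\<in>sr ` {i..<j}. g \<gamma>)" by (rule sum.cong) (auto simp: c0_def)
    also have "\<dots> = (\<Sum>e\<in>{i..<j}. g (sr e))" using inj by (simp add: sum.reindex)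
    finally show ?thesis .
  qed
  show ?thesis
    unfolding ext_def
  proof (rule the_equality)
    show "\<exists>c. rt i j = (\<Sum>\<gamma>\<in>Y. c \<gamma> *s \<gamma>) \<and> (\<Sum>e\<in>{i..<j}. T (sr e)) = (\<Sum>\<gamma>\<in>Y. c \<gamma> *s T \<gamma>)"
      using c0[of "\<lambda>v. v"] c0[of T] rt_telescope[of i j, where 'n = 'n] ij by (intro exI[of _ c0]) simp
  next
    fix \<beta> assume "\<exists>c. rt i j = (\<Sum>\<gamma>\<in>Y. c \<gamma> *s \<gamma>) \<and> \<beta> = (\<Sum>\<gamma>\<in>Y. c \<gamma> *s T \<gamma>)"
    then obtain c where c: "rt i j = (\<Sum>\<gamma>\<in>Y. c \<gamma> *s \<gamma>)" "\<beta> = (\<Sum>\<gamma>\<in>Y. c \<gamma> *s T \<gamma>)" by blast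
    have "c \<gamma> = c0 \<gamma>" if g: "\<gamma> \<in> Y" for \<gamma>
    proof -
      obtain f where f: "f \<in> {1..<int CARD('n)}" "\<gamma> = sr f" using sr_ex[OF g] by blast
      have ph: "phi f \<gamma>' = (if \<gamma>' = \<gamma> then 1 else 0)" if g': "\<gamma>' \<in> Y" for \<gamma>'
      proof -
        obtain f' where f': "f' \<in> {1..<int CARD('n)}" "\<gamma>' = sr f'" using sr_ex[OF g'] by blast
        have ff: "\<gamma>' = \<gamma> \<longleftrightarrow> f = f'" unfolding f(2) f'(2) using inj_onD[OF sr_inj _ f(1) f'(1)] by auto
        show ?thesis unfolding ff unfolding f'(2) by (rule phi_sr[OF f(1) f'(1)])
      qed
      have "phi f (rt i j :: 'n cvec) = (\<Sum>\<gamma>'\<in>Y. c \<gamma>' * phi f \<gamma>')" unfolding c(1) phi_sum phi_scale ..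
      also have "\<dots> = (\<Sum>\<gamma>'\<in>Y. if \<gamma>' = \<gamma> then c \<gamma>' else 0)" by (rule sum.cong) (simp_all add: ph)
      also have "\<dots> = c \<gamma>" using fin g by simp
      finally have "c \<gamma> = (if i \<le> f then 1 else 0) - (if j \<le> f then 1 else 0)"
        using phi_rt[of i j f, where 'n = 'n] f ij by simp
      moreover have "\<gamma> \<in> sr ` {i..<j} \<longleftrightarrow> f \<in> {i..<j}"
      proof
        assume "\<gamma> \<in> sr ` {i..<j}"
        then obtain f' where f': "f' \<in> {i..<j}" "(sr f' :: 'n cvec) = sr f" using f by auto
        have "f' = f" by (rule inj_onD[OF sr_inj[where 'n = 'n] f'(2)]) (use f' f ij in auto)
        then show "f \<in> {i..<j}" using f' by simp
      qed (use f in auto)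
      ultimately show ?thesis using ij by (auto simp: c0_def)
    qed
    then show "\<beta> = (\<Sum>e\<in>{i..<j}. T (sr e))" unfolding c(2) c0[symmetric] by (intro sum.cong) simp_all
  qed
qed

lemma pos_roots_rt:
  assumes "Y \<subseteq> (simple_roots :: 'n::finite cvec set)"
  shows "\<alpha> \<in> pos_roots_in Y \<longleftrightarrow>
    (\<exists>i j. 1 \<le> i \<and> i < j \<and> j \<le> int CARD('n) \<and> \<alpha> = rt i j \<and> (\<forall>e\<in>{i..<j}. sr e \<in> Y))"
proof
  assume "\<alpha> \<in> pos_roots_in Y"
  then obtain a b where "1 \<le> a" "a < b" "b \<le> CARD('n)" "\<alpha> = rt (int a) (int b)" "\<alpha> \<in> vec.span Y"
    by (auto simp: pos_roots_in_def rt_def)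
  then show "\<exists>i j. 1 \<le> i \<and> i < j \<and> j \<le> int CARD('n) \<and> \<alpha> = rt i j \<and> (\<forall>e\<in>{i..<j}. sr e \<in> Y)"
    using rt_in_span[OF assms, of "int a" "int b"] by (intro exI[of _ "int a"] exI[of _ "int b"]) auto
next
  assume "\<exists>i j. 1 \<le> i \<and> i < j \<and> j \<le> int CARD('n) \<and> \<alpha> = rt i j \<and> (\<forall>e\<in>{i..<j}. sr e \<in> Y)"
  then obtain i j where h: "1 \<le> i" "i < j" "j \<le> int CARD('n)" "\<alpha> = rt i j" "\<forall>e\<in>{i..<j}. sr e \<in> Y" by blast
  then have "\<alpha> \<in> vec.span Y" using rt_in_span[OF assms] by blast
  moreover have "1 \<le> nat i \<and> nat i < nat j \<and> nat j \<le> CARD('n) \<and> \<alpha> = basis_vec (nat i) - basis_vec (nat j)"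
    using h by (auto simp: rt_def)
  ultimately show "\<alpha> \<in> pos_roots_in Y" unfolding pos_roots_in_def by blast
qed

lemma inner_sr:
  assumes "e \<in> {1..<int CARD('n)}" "f \<in> {1..<int CARD('n)}"
  shows "(sr e :: 'n::finite cvec) \<bullet> sr f = (if e = f then 2 else if \<bar>e - f\<bar> = 1 then -1 else 0)"
proof -
  have "basis_vec (nat i) \<bullet> (basis_vec (nat j) :: 'n cvec) = (if i = j then 1 else 0)"
    if "i \<in> {1..int CARD('n)}" "j \<in> {1..int CARD('n)}" for i j
    using vx_eq[where 'n = 'n, OF that] by (simp add: basis_vec_vx inner_axis_axis)
  then show ?thesis using assms by (auto simp: rt_def inner_diff_left inner_diff_right)
qed

section \<open>Belavin-Drinfeld triples as segment maps\<close>

locale bd_setup =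
  fixes T :: "'n::finite cvec \<Rightarrow> 'n cvec" and \<Gamma>1 \<Gamma>2 :: "'n cvec set"
  assumes n2: "CARD('n) \<ge> 2" and bd: "BD_triple T \<Gamma>1 \<Gamma>2"
begin

definition Gs :: "int set" where "Gs = {e \<in> {1..<int CARD('n)}. (sr e :: 'n cvec) \<in> \<Gamma>1}"

definition tt :: "int \<Rightarrow> int" where
  "tt e = (SOME f. f \<in> {1..<int CARD('n)} \<and> T (sr e) = sr f)"

lemma G1_sub: "\<Gamma>1 \<subseteq> simple_roots" using bd by (simp add: BD_triple_def)

lemma tt: "e \<in> Gs \<Longrightarrow> tt e \<in> {1..<int CARD('n)} \<and> T (sr e) = sr (tt e)"
proof -
  assume "e \<in> Gs"
  then have "T (sr e) \<in> \<Gamma>2" using bd by (auto simp: BD_triple_def Gs_def bij_betw_def)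
  then have "T (sr e) \<in> sr ` {1..<int CARD('n)}" using bd unfolding simple_roots_sr[symmetric] by (auto simp: BD_triple_def)
  then have "\<exists>f. f \<in> {1..<int CARD('n)} \<and> T (sr e) = sr f" by blast
  then show ?thesis unfolding tt_def by (rule someI_ex)
qed

lemma sr_eq: "e \<in> {1..<int CARD('n)} \<Longrightarrow> f \<in> {1..<int CARD('n)} \<Longrightarrow> (sr e :: 'n cvec) = sr f \<longleftrightarrow> e = f"
  using inj_onD[OF sr_inj[where 'n = 'n]] by blast

sublocale em: edge_map "int CARD('n)" Gs tt
proof
  show "Gs \<subseteq> {1..<int CARD('n)}" by (auto simp: Gs_def)
  show "e \<in> Gs \<Longrightarrow> tt e \<in> {1..<int CARD('n)}" for e using tt by blast
  show "inj_on tt Gs"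
  proof (rule inj_onI)
    fix e f assume a: "e \<in> Gs" "f \<in> Gs" "tt e = tt f"
    then have "T (sr e) = T (sr f)" using tt by metis
    moreover have "inj_on T \<Gamma>1" using bd by (simp add: BD_triple_def bij_betw_def)
    ultimately have "(sr e :: 'n cvec) = sr f" using a by (auto simp: Gs_def inj_on_def)
    then show "e = f" using sr_eq a by (auto simp: Gs_def)
  qed
  show "\<bar>tt e - tt f\<bar> = 1 \<longleftrightarrow> \<bar>e - f\<bar> = 1" if ef: "e \<in> Gs" "f \<in> Gs" for e f
  proof -
    have g: "(sr e :: 'n cvec) \<in> \<Gamma>1" "(sr f :: 'n cvec) \<in> \<Gamma>1" "e \<in> {1..<int CARD('n)}" "f \<in> {1..<int CARD('n)}" using ef by (auto simp: Gs_def)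
    then have "T (sr e) \<bullet> T (sr f) = (sr e :: 'n cvec) \<bullet> sr f" using bd unfolding BD_triple_def by blast
    then have "(sr (tt e) :: 'n cvec) \<bullet> sr (tt f) = (sr e :: 'n cvec) \<bullet> sr f" using tt[OF ef(1)] tt[OF ef(2)] by simp
    then show ?thesis
      using inner_sr[where 'n = 'n, OF g(3,4)] inner_sr[where 'n = 'n, of "tt e" "tt f"] tt[OF ef(1)] tt[OF ef(2)]
      by (auto split: if_splits)
  qed
  show "\<exists>k. (tt ^^ k) e \<notin> Gs" if e: "e \<in> Gs" for e
  proof (rule ccontr)
    assume a: "\<not> ?thesis"
    have "(T ^^ k) (sr e) = sr ((tt ^^ k) e)" for k
    proof (induction k)
      case (Suc k)
      have "(tt ^^ k) e \<in> Gs" using a by blast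
      then show ?case using Suc tt by simp
    qed simp
    moreover have "(sr ((tt ^^ k) e) :: 'n cvec) \<in> \<Gamma>1" for k using a by (auto simp: Gs_def)
    ultimately have "(T ^^ k) (sr e) \<in> \<Gamma>1" for k by simp
    then show False using bd e unfolding BD_triple_def Gs_def by blast
  qed
qed

sublocale bd_mat "int CARD('n)" Gs em.vmap em.height "vx :: int \<Rightarrow> 'n"
proof (intro bd_mat.intro bd_mat_axioms.intro)
  show "bd_map (int CARD('n)) Gs em.vmap em.height" by (rule em.edge_map_bd_map)
  show "bij_betw vx {1..int CARD('n)} (UNIV :: 'n set)" by (rule vx_bij_betw)
qed

lemma pos_G1: "\<alpha> \<in> pos_roots_in \<Gamma>1 \<longleftrightarrow> (\<exists>i j. i < j \<and> seg i j \<and> \<alpha> = rt i j)"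
proof
  assume "\<alpha> \<in> pos_roots_in \<Gamma>1"
  then obtain i j where h: "1 \<le> i" "i < j" "j \<le> int CARD('n)" "\<alpha> = rt i j" "\<forall>e\<in>{i..<j}. sr e \<in> \<Gamma>1"
    using pos_roots_rt[OF G1_sub, of \<alpha>] by blast
  have "{i..<j} \<subseteq> Gs" using h by (auto simp: Gs_def)
  then have "seg i j" using h by (simp add: seg_def)
  then show "\<exists>i j. i < j \<and> seg i j \<and> \<alpha> = rt i j" using h by blast
next
  assume "\<exists>i j. i < j \<and> seg i j \<and> \<alpha> = rt i j"
  then obtain i j where h: "i < j" "seg i j" "\<alpha> = rt i j" by blast
  have "{i..<j} \<subseteq> Gs" using h by (simp add: seg_def)
  then have "1 \<le> i" "j \<le> int CARD('n)" "\<forall>e\<in>{i..<j}. (sr e :: 'n cvec) \<in> \<Gamma>1"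
    using seg_range[OF h(2)] by (auto simp: Gs_def)
  then show "\<alpha> \<in> pos_roots_in \<Gamma>1" using pos_roots_rt[OF G1_sub, of \<alpha>] h by blast
qed

lemma vmap_min: "e \<in> Gs \<Longrightarrow> min (em.vmap e) (em.vmap (e + 1)) = tt e"
  by (auto simp: em.vmap_edge)

lemma ext_seg:
  assumes "i < j" "seg i j"
  shows "ext T \<Gamma>1 (rt i j) = rt (min (em.vmap i) (em.vmap j)) (max (em.vmap i) (em.vmap j))"
proof -
  have m: "min i j = i" "max i j = j" using assms by auto
  have g: "{i..<j} \<subseteq> Gs" using assms unfolding seg_def by auto
  have r: "1 \<le> i" "j \<le> int CARD('n)" using seg_range[OF assms(2)] by auto
  have "ext T \<Gamma>1 (rt i j) = (\<Sum>e\<in>{i..<j}. T (sr e))"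
    by (rule ext_rt[OF G1_sub r(1) assms(1) r(2)]) (use g in \<open>auto simp: Gs_def\<close>)
  also have "\<dots> = (\<Sum>e\<in>{i..<j}. sr (min (em.vmap e) (em.vmap (e + 1))))"
    using g tt vmap_min by (intro sum.cong) auto
  also have "\<dots> = (\<Sum>f\<in>{min (em.vmap i) (em.vmap j)..<max (em.vmap i) (em.vmap j)}. sr f)"
    using seg_image[OF assms(2)] unfolding m by (simp add: sum.reindex)
  also have "\<dots> = rt (min (em.vmap i) (em.vmap j)) (max (em.vmap i) (em.vmap j))"
    by (rule rt_telescope[symmetric]) simp
  finally show ?thesis .
qed

text \<open>The iterates on roots are those on segments, except that the orientation is forgotten.\<close>

lemma rel_pow_iff:
  assumes ij: "i \<in> {1..int CARD('n)}" "j \<in> {1..int CARD('n)}" "i < j"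
  shows "(rt i j, \<beta>) \<in> {(\<gamma>, ext T \<Gamma>1 \<gamma>) | \<gamma>. \<gamma> \<in> pos_roots_in \<Gamma>1} ^^ k \<longleftrightarrow>
    (\<exists>u v. iter (int k) i j u v \<and> \<beta> = rt (min u v) (max u v))"
proof (induction k arbitrary: \<beta>)
  case 0
  have "iter 0 i j u v \<longleftrightarrow> u = i \<and> v = j" for u v using ij by (auto simp: iter_0)
  then show ?case using ij by auto
next
  case (Suc k)
  let ?RR = "{(\<gamma>, ext T \<Gamma>1 \<gamma>) | \<gamma>. \<gamma> \<in> pos_roots_in \<Gamma>1}"
  show ?case
  proof
    assume "(rt i j, \<beta>) \<in> ?RR ^^ Suc k"
    then obtain \<gamma> where g: "(rt i j, \<gamma>) \<in> ?RR ^^ k" "\<gamma> \<in> pos_roots_in \<Gamma>1" "\<beta> = ext T \<Gamma>1 \<gamma>" by auto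
    obtain u v where uv: "iter (int k) i j u v" "\<gamma> = rt (min u v) (max u v)" using g(1) Suc.IH by blast
    obtain a b where ab: "a < b" "seg a b" "\<gamma> = rt a b" using g(2) pos_G1 by blast
    have r: "u \<in> {1..int CARD('n)}" "v \<in> {1..int CARD('n)}" "u \<noteq> v" using iter_range[OF uv(1)] by auto
    have r2: "a \<in> {1..int CARD('n)}" "b \<in> {1..int CARD('n)}" using seg_range[OF ab(2)] by auto
    have eq: "(rt a b :: 'n cvec) = rt (min u v) (max u v)" using ab(3) uv(2) by simp
    have "a = min u v \<and> b = max u v" by (rule rt_inj[OF _ _ _ _ _ _ eq]) (use r r2 ab in auto)
    then have abuv: "(a = u \<and> b = v) \<or> (a = v \<and> b = u)" by (auto simp: min_def max_def)
    then have suv: "seg u v" using ab(2) seg_swap by blast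
    have "\<beta> = rt (min (em.vmap a) (em.vmap b)) (max (em.vmap a) (em.vmap b))"
      using g(3) ab ext_seg by simp
    also have "\<dots> = rt (min (em.vmap u) (em.vmap v)) (max (em.vmap u) (em.vmap v))"
      using abuv by (auto simp: min.commute max.commute)
    finally have "\<beta> = rt (min (em.vmap u) (em.vmap v)) (max (em.vmap u) (em.vmap v))" .
    moreover have "iter (int (Suc k)) i j (em.vmap u) (em.vmap v)"
      using uv(1) suv ij seg_step_iff unfolding iter_nonneg by auto
    ultimately show "\<exists>u v. iter (int (Suc k)) i j u v \<and> \<beta> = rt (min u v) (max u v)" by blast
  next
    assume "\<exists>u v. iter (int (Suc k)) i j u v \<and> \<beta> = rt (min u v) (max u v)"
    then obtain u v where uv: "iter (int (Suc k)) i j u v" "\<beta> = rt (min u v) (max u v)" by blast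
    then have "((i, j), (u, v)) \<in> seg_step ^^ Suc k" unfolding iter_nonneg by blast
    then obtain p r where pr: "((i, j), (p, r)) \<in> seg_step ^^ k" "((p, r), (u, v)) \<in> seg_step" by auto
    have s: "seg p r" "u = em.vmap p" "v = em.vmap r" using pr(2) by (auto simp: seg_step_iff)
    have m: "iter (int k) i j p r" using pr(1) ij unfolding iter_nonneg by auto
    have sm: "seg (min p r) (max p r)" "min p r < max p r" using s(1) seg_swap[of p r] by (auto simp: min_def max_def seg_def)
    have "(rt i j, rt (min p r) (max p r)) \<in> ?RR ^^ k" using Suc.IH m by blast
    moreover have "rt (min p r) (max p r) \<in> pos_roots_in \<Gamma>1" using pos_G1 sm by blast
    moreover have "\<beta> = ext T \<Gamma>1 (rt (min p r) (max p r))"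
      unfolding ext_seg[OF sm(2,1)] uv(2) s by (auto simp: min_def max_def)
    ultimately show "(rt i j, \<beta>) \<in> ?RR ^^ Suc k" by auto
  qed
qed

lemma maps_to_iff: "maps_to T \<Gamma>1 k \<alpha> \<beta> \<longleftrightarrow>
  (\<exists>i j u v. i < j \<and> iter (int k) i j u v \<and> \<alpha> = rt i j \<and> \<beta> = rt (min u v) (max u v))"
proof
  assume a: "maps_to T \<Gamma>1 k \<alpha> \<beta>"
  then obtain i j where h: "1 \<le> i" "i < j" "j \<le> int CARD('n)" "\<alpha> = rt i j"
    unfolding maps_to_def using pos_roots_rt[OF order_refl, of \<alpha>] by blast
  then have "\<exists>u v. iter (int k) i j u v \<and> \<beta> = rt (min u v) (max u v)"
    using a rel_pow_iff[of i j \<beta> k] unfolding maps_to_def by auto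
  then show "\<exists>i j u v. i < j \<and> iter (int k) i j u v \<and> \<alpha> = rt i j \<and> \<beta> = rt (min u v) (max u v)"
    using h by blast
next
  assume "\<exists>i j u v. i < j \<and> iter (int k) i j u v \<and> \<alpha> = rt i j \<and> \<beta> = rt (min u v) (max u v)"
  then obtain i j u v where h: "i < j" "iter (int k) i j u v" "\<alpha> = rt i j" "\<beta> = rt (min u v) (max u v)" by blast
  note r = iter_range[OF h(2)]
  have "\<alpha> \<in> pos_roots_in simple_roots"
    unfolding pos_roots_rt[OF order_refl] using h r
    by (intro exI[of _ i] exI[of _ j]) (auto simp: simple_roots_sr)
  then show "maps_to T \<Gamma>1 k \<alpha> \<beta>"
    unfolding maps_to_def using rel_pow_iff[of i j \<beta> k] h r by auto
qed

lemma maps_to_rt: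
  assumes "1 \<le> i" "i < j" "j \<le> int CARD('n)" "1 \<le> l" "l < m" "m \<le> int CARD('n)"
  shows "maps_to T \<Gamma>1 k (rt i j) (rt l m) \<longleftrightarrow> iter (int k) i j l m \<or> iter (int k) i j m l"
proof
  assume "maps_to T \<Gamma>1 k (rt i j) (rt l m)"
  then obtain i' j' u v where h: "i' < j'" "iter (int k) i' j' u v" "(rt i j :: 'n cvec) = rt i' j'"
    "(rt l m :: 'n cvec) = rt (min u v) (max u v)" unfolding maps_to_iff by blast
  note r = iter_range[OF h(2)]
  have "i = i' \<and> j = j'" by (rule rt_inj[OF _ _ _ _ _ _ h(3)]) (use assms r in auto)
  moreover have "l = min u v \<and> m = max u v" by (rule rt_inj[OF _ _ _ _ _ _ h(4)]) (use assms r in auto)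
  ultimately show "iter (int k) i j l m \<or> iter (int k) i j m l" using h(2) by (auto simp: min_def max_def split: if_splits)
next
  assume "iter (int k) i j l m \<or> iter (int k) i j m l"
  then show "maps_to T \<Gamma>1 k (rt i j) (rt l m)"
  proof
    assume "iter (int k) i j l m"
    then show ?thesis unfolding maps_to_iff using assms by (intro exI[of _ i] exI[of _ j] exI[of _ l] exI[of _ m]) auto
  next
    assume "iter (int k) i j m l"
    then show ?thesis unfolding maps_to_iff using assms by (intro exI[of _ i] exI[of _ j] exI[of _ m] exI[of _ l]) auto
  qed
qed

text \<open>The height sum grows by the length of the root in each step.\<close>

lemma maps_to_unique:
  assumes "maps_to T \<Gamma>1 k \<alpha> \<beta>" "maps_to T \<Gamma>1 k' \<alpha> \<beta>"
  shows "k = k'"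
proof -
  obtain i j u v where h: "i < j" "iter (int k) i j u v" "\<alpha> = rt i j" "\<beta> = rt (min u v) (max u v)"
    using assms(1) unfolding maps_to_iff by blast
  note r = iter_range[OF h(2)]
  have "maps_to T \<Gamma>1 k' (rt i j) (rt (min u v) (max u v))" using assms(2) h by simp
  then have "iter (int k') i j (min u v) (max u v) \<or> iter (int k') i j (max u v) (min u v)"
    by (subst (asm) maps_to_rt) (use r h in auto)
  then have "iter (int k') i j u v \<or> iter (int k') i j v u" by (auto simp: min_def max_def split: if_splits)
  then have "height_sum u v = height_sum i j + int k' * \<bar>i - j\<bar>" using iter_height height_sum_swap[of u v] by metis
  then have "(int k - int k') * \<bar>i - j\<bar> = 0" using iter_height[OF h(2)] by (simp add: algebra_simps)
  then show ?thesis using h(1) by simp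
qed

lemma M_dich': "iter p x y u v \<Longrightarrow> v - u = y - x \<or> v - u = x - y"
  by (erule iter_dich) auto

text \<open>
  For length at least two, the images of the first and the last edge tell a reflection from a
  translation.
\<close>

lemma reverses_iff:
  assumes m: "iter (int k) i j u v" and ij: "j - i \<ge> 2"
  shows "reverses T \<Gamma>1 k (rt i j) \<longleftrightarrow> v < u"
proof -
  note r = iter_range[OF m]
  have d: "\<bar>u - v\<bar> = j - i" using M_dich'[OF m] ij by auto
  have ne: "u \<noteq> v" "min u v \<noteq> max u v" using r by auto
  show ?thesis
  proof
    assume "reverses T \<Gamma>1 k (rt i j)"
    then obtain \<beta> a b l c where h: "maps_to T \<Gamma>1 k (rt i j) \<beta>" "root_ix (rt i j :: 'n cvec) = (a, b)"
      "root_ix \<beta> = (l, c)" "maps_to T \<Gamma>1 k (simple_root a) (simple_root (c - 1))"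
      unfolding reverses_def by blast
    obtain i' j' u' v' where h1: "i' < j'" "iter (int k) i' j' u' v'" "(rt i j :: 'n cvec) = rt i' j'" "\<beta> = rt (min u' v') (max u' v')"
      using h(1) unfolding maps_to_iff by blast
    note r' = iter_range[OF h1(2)]
    have ii: "i = i' \<and> j = j'" by (rule rt_inj[OF _ _ _ _ _ _ h1(3)]) (use r r' h1 ij in auto)
    have uv: "u' = u" "v' = v"
    proof -
      show "u' = u" using iter_vertex[OF h1(2), of j u v] m ii by simp
      show "v' = v" using M_vertex'[OF h1(2), of i u v] m ii by simp
    qed
    have "root_ix (rt i j :: 'n cvec) = (nat i, nat j)" by (rule root_ix_rt) (use r in auto)
    then have a: "a = nat i" using h(2) by simp
    have "root_ix \<beta> = (nat (min u v), nat (max u v))" unfolding h1(4) uv by (rule root_ix_rt) (use r in auto)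
    then have c: "c = nat (max u v)" using h(3) by simp
    have s: "simple_root a = (sr i :: 'n cvec)" "simple_root (c - 1) = (rt (max u v - 1) (max u v) :: 'n cvec)"
      using simple_root_sr[of i, where 'n = 'n] simple_root_sr[of "max u v - 1", where 'n = 'n] r a c
      by (auto simp: nat_diff_distrib')
    have "maps_to T \<Gamma>1 k (rt i (i + 1)) (rt (max u v - 1) (max u v))" using h(4) s by simp
    moreover have "1 \<le> max u v - 1" using r d ij by auto
    ultimately have "iter (int k) i (i + 1) (max u v - 1) (max u v) \<or> iter (int k) i (i + 1) (max u v) (max u v - 1)"
      by (subst (asm) maps_to_rt) (use r ij in auto)
    then have "u = max u v - 1 \<or> u = max u v" using iter_vertex[OF m] by blast
    then show "v < u" using d ij ne by auto
  next
    assume vu: "v < u"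
    have v: "v - u = i - j" using M_dich'[OF m] vu ij by auto
    have mm: "min u v = v" "max u v = u" using vu by auto
    have 1: "iter (int k) i (i + 1) u (u - 1)" using iter_refl_sub1[OF m v, of "i + 1"] ij by simp
    have "iter (int k) j i v u" using m iter_swap by blast
    from iter_refl_sub1[OF this, of "j - 1"] have "iter (int k) j (j - 1) v (v + 1)" using v ij by simp
    then have 2: "iter (int k) (j - 1) j (v + 1) v" using iter_swap by blast
    have s: "simple_root (nat i) = (sr i :: 'n cvec)" "simple_root (nat u - 1) = (rt (u - 1) u :: 'n cvec)"
      "simple_root (nat j - 1) = (rt (j - 1) j :: 'n cvec)" "simple_root (nat v) = (sr v :: 'n cvec)"
      using simple_root_sr[of i, where 'n = 'n] simple_root_sr[of "u - 1", where 'n = 'n]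
        simple_root_sr[of "j - 1", where 'n = 'n] simple_root_sr[of v, where 'n = 'n] r vu ij
      by (auto simp: nat_diff_distrib')
    have "maps_to T \<Gamma>1 k (rt i j) (rt v u)" by (subst maps_to_rt) (use r vu ij m in auto)
    moreover have "maps_to T \<Gamma>1 k (simple_root (nat i)) (simple_root (nat u - 1))"
      unfolding s by (subst maps_to_rt) (use r ij vu 1 iter_range[OF 1] in auto)
    moreover have "maps_to T \<Gamma>1 k (simple_root (nat j - 1)) (simple_root (nat v))"
      unfolding s by (subst maps_to_rt) (use r ij vu 2 iter_range[OF 2] in auto)
    moreover have "root_ix (rt i j :: 'n cvec) = (nat i, nat j)" "root_ix (rt v u :: 'n cvec) = (nat v, nat u)"
      by (rule root_ix_rt; use r ij in auto)+
    ultimately show "reverses T \<Gamma>1 k (rt i j)" unfolding reverses_def by blast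
  qed
qed

text \<open>The reversing steps on simple roots are the reflected edges, by \<open>vmap_reversed_iff\<close>.\<close>

lemma step_reverses_iff:
  assumes e: "e \<in> Gs"
  shows "simple_step_reverses T \<Gamma>1 (sr e) \<longleftrightarrow> em.vmap (e + 1) < em.vmap e"
proof -
  have M1: "iter (int 1) i j (em.vmap i) (em.vmap j)" if "seg i j" for i j
    using that seg_range[OF that] unfolding iter_nonneg by (auto simp: seg_step_iff seg_def)
  have rev: "reverses T \<Gamma>1 1 (rt i (i + 2)) \<longleftrightarrow> em.vmap (i + 2) < em.vmap i" if "seg i (i + 2)" for i
    using reverses_iff[OF M1[OF that]] by simp
  have seg2: "seg i (i + 2) \<longleftrightarrow> i \<in> Gs \<and> i + 1 \<in> Gs" for i
  proof -
    have "{min i (i + 2)..<max i (i + 2)} = {i, i + 1}" by auto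
    then show ?thesis by (simp add: seg_def)
  qed
  have "simple_step_reverses T \<Gamma>1 (sr e) \<longleftrightarrow>
    (\<exists>i. (e = i \<or> e = i + 1) \<and> i \<in> Gs \<and> i + 1 \<in> Gs \<and> em.vmap (i + 2) < em.vmap i)"
  proof
    assume "simple_step_reverses T \<Gamma>1 (sr e)"
    then obtain \<delta> a where h: "\<delta> \<in> pos_roots_in \<Gamma>1" "root_ix \<delta> = (a, a + 2)"
      "sr e = (simple_root a :: 'n cvec) \<or> sr e = (simple_root (a + 1) :: 'n cvec)" "reverses T \<Gamma>1 1 \<delta>"
      unfolding simple_step_reverses_def by blast
    obtain i j where ij: "i < j" "seg i j" "\<delta> = rt i j" using h(1) pos_G1 by blast
    note r = seg_range[OF ij(2)]
    have "root_ix \<delta> = (nat i, nat j)" unfolding ij(3) by (rule root_ix_rt) (use r ij in auto)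
    then have a: "a = nat i" "j = i + 2" using h(2) r ij(1) by auto
    have g: "i \<in> Gs" "i + 1 \<in> Gs" using ij(2) seg2 a by auto
    have s: "simple_root a = (sr i :: 'n cvec)" "simple_root (a + 1) = (sr (i + 1) :: 'n cvec)"
      using simple_root_sr[of i, where 'n = 'n] simple_root_sr[of "i + 1", where 'n = 'n] r a
      by (auto simp: nat_add_distrib)
    have "e = i \<or> e = i + 1" using h(3) sr_eq[of e i] sr_eq[of e "i + 1"] e g unfolding s by (auto simp: Gs_def)
    moreover have "em.vmap (i + 2) < em.vmap i" using rev[of i] ij h(4) a by simp
    ultimately show "\<exists>i. (e = i \<or> e = i + 1) \<and> i \<in> Gs \<and> i + 1 \<in> Gs \<and> em.vmap (i + 2) < em.vmap i"
      using g by blast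
  next
    assume "\<exists>i. (e = i \<or> e = i + 1) \<and> i \<in> Gs \<and> i + 1 \<in> Gs \<and> em.vmap (i + 2) < em.vmap i"
    then obtain i where h: "e = i \<or> e = i + 1" "i \<in> Gs" "i + 1 \<in> Gs" "em.vmap (i + 2) < em.vmap i" by blast
    have sg: "seg i (i + 2)" using seg2 h by blast
    note r = seg_range[OF sg]
    have "rt i (i + 2) \<in> pos_roots_in \<Gamma>1" using pos_G1 sg by (metis less_add_same_cancel1 zero_less_numeral)
    moreover have "root_ix (rt i (i + 2) :: 'n cvec) = (nat i, nat i + 2)"
      using root_ix_rt[of i "i + 2", where 'n = 'n] r by (simp add: nat_add_distrib)
    moreover have "simple_root (nat i) = (sr i :: 'n cvec)" "simple_root (nat i + 1) = (sr (i + 1) :: 'n cvec)"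
      using simple_root_sr[of i, where 'n = 'n] simple_root_sr[of "i + 1", where 'n = 'n] r
      by (auto simp: nat_add_distrib)
    moreover have "reverses T \<Gamma>1 1 (rt i (i + 2))" using rev[OF sg] h by simp
    ultimately show "simple_step_reverses T \<Gamma>1 (sr e)"
      unfolding simple_step_reverses_def using h(1)
      by (intro bexI[of _ "rt i (i + 2)"] exI[of _ "nat i"]) auto
  qed
  then show ?thesis using em.vmap_reversed_iff[OF e] by simp
qed

lemma odd_card_Suc: "odd (card {t. t < Suc k \<and> P t}) \<longleftrightarrow> (P k \<noteq> odd (card {t. t < k \<and> P t}))"
proof -
  have "{t. t < Suc k \<and> P t} = (if P k then insert k {t. t < k \<and> P t} else {t. t < k \<and> P t})"
    by (auto simp: less_Suc_eq)
  then show ?thesis by simp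
qed

text \<open>Each reversing step exchanges the order of the two end points of the edge.\<close>

lemma simple_parity:
  "iter (int k) e (e + 1) u v \<Longrightarrow>
    v < u \<longleftrightarrow> odd (card {t. t < k \<and> (\<exists>\<gamma>. maps_to T \<Gamma>1 t (sr e) \<gamma> \<and> simple_step_reverses T \<Gamma>1 \<gamma>)})"
proof (induction k arbitrary: u v)
  case 0
  then show ?case by (simp add: iter_0)
next
  case (Suc k)
  let ?P = "\<lambda>t. \<exists>\<gamma>. maps_to T \<Gamma>1 t (sr e) \<gamma> \<and> simple_step_reverses T \<Gamma>1 \<gamma>"
  have "((e, e + 1), (u, v)) \<in> seg_step ^^ Suc k" using Suc.prems unfolding iter_nonneg by blast
  then obtain p r where pr: "((e, e + 1), (p, r)) \<in> seg_step ^^ k" "((p, r), (u, v)) \<in> seg_step" by auto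
  have s: "seg p r" "u = em.vmap p" "v = em.vmap r" using pr(2) by (auto simp: seg_step_iff)
  note rg = iter_range[OF Suc.prems]
  have m: "iter (int k) e (e + 1) p r" using pr(1) rg unfolding iter_nonneg by auto
  have d: "r = p + 1 \<or> p = r + 1" using M_dich'[OF m] by auto
  define c where "c = min p r"
  have c: "c \<in> Gs" "max p r = c + 1" using s(1) d unfolding seg_def c_def by auto
  have "maps_to T \<Gamma>1 k (sr e) \<gamma> \<longleftrightarrow> \<gamma> = sr c" for \<gamma>
  proof
    assume "maps_to T \<Gamma>1 k (sr e) \<gamma>"
    then obtain i j a b where h: "i < j" "iter (int k) i j a b" "(sr e :: 'n cvec) = rt i j" "\<gamma> = rt (min a b) (max a b)"
      unfolding maps_to_iff by blast
    have "e = i \<and> e + 1 = j" by (rule rt_inj[OF _ _ _ _ _ _ h(3)]) (use rg iter_range[OF h(2)] in auto)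
    then have "a = p" "b = r" using iter_vertex[OF h(2), of "e + 1" p r] M_vertex'[OF h(2), of e p r] m by auto
    then show "\<gamma> = sr c" using h(4) c by (simp add: c_def)
  next
    assume "\<gamma> = sr c"
    then show "maps_to T \<Gamma>1 k (sr e) \<gamma>" unfolding maps_to_iff using m c(2)
      by (intro exI[of _ e] exI[of _ "e + 1"] exI[of _ p] exI[of _ r]) (auto simp: c_def)
  qed
  then have P: "?P k \<longleftrightarrow> em.vmap (c + 1) < em.vmap c" using step_reverses_iff[OF c(1)] by simp
  note cS = odd_card_Suc[of k ?P]
  have "em.vmap (c + 1) \<noteq> em.vmap c" using em.vmap_edge[OF c(1)] by auto
  then have "v < u \<longleftrightarrow> ((em.vmap (c + 1) < em.vmap c) \<noteq> (r < p))" using d s by (auto simp: c_def)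
  then show ?case unfolding cS P using Suc.IH[OF m] by blast
qed

lemma orient_C_rt:
  assumes m: "iter (int k) i j u v" and "i < j" "1 \<le> k"
  shows "orient_C T \<Gamma>1 (rt i j) (rt (min u v) (max u v)) = (if v < u then 1 else 0)"
proof -
  note r = iter_range[OF m]
  have mp: "maps_to T \<Gamma>1 k (rt i j) (rt (min u v) (max u v))" unfolding maps_to_iff using assms by blast
  have len: "root_len (rt i j :: 'n cvec) = nat (j - i)"
    using root_ix_rt[of i j, where 'n = 'n] r assms(2) by (simp add: root_len_def)
  have "orient_reversing T \<Gamma>1 k (rt i j) \<longleftrightarrow> v < u"
  proof (cases "j - i = 1")
    case True
    then have "j = i + 1" by simp
    then show ?thesis unfolding orient_reversing_def len using simple_parity[of k i u v] m by simp
  next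
    case False
    then have "j - i \<ge> 2" "nat (j - i) \<noteq> 1" using assms(2) by auto
    then show ?thesis unfolding orient_reversing_def len using reverses_iff[OF m] by simp
  qed
  moreover have "(\<exists>k\<ge>1. maps_to T \<Gamma>1 k (rt i j) (rt (min u v) (max u v)) \<and> orient_reversing T \<Gamma>1 k (rt i j))
    \<longleftrightarrow> orient_reversing T \<Gamma>1 k (rt i j)"
    using mp maps_to_unique[OF mp] assms(3) by blast
  ultimately show ?thesis unfolding orient_C_def by simp
qed

section \<open>Passing and straight vertices\<close>


text \<open>\<open>T\<^sup>k\<alpha> = \<beta>\<close> for \<open>\<alpha> = e\<^sub>i - e\<^sub>j\<close> and \<open>\<beta> = e\<^sub>l - e\<^sub>m\<close>.\<close>

definition tpair :: "nat \<Rightarrow> int \<Rightarrow> int \<Rightarrow> int \<Rightarrow> int \<Rightarrow> bool" where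
  "tpair k i j l m \<longleftrightarrow> i < j \<and> l < m \<and> (iter (int k) i j l m \<or> iter (int k) i j m l)"

lemma tpair_range:
  assumes "tpair k i j l m"
  shows "i \<in> {1..int CARD('n)}" "j \<in> {1..int CARD('n)}" "l \<in> {1..int CARD('n)}" "m \<in> {1..int CARD('n)}"
    "i < j" "l < m" "m - l = j - i"
proof -
  note a = assms[unfolded tpair_def]
  show "i \<in> {1..int CARD('n)}" "j \<in> {1..int CARD('n)}" "l \<in> {1..int CARD('n)}" "m \<in> {1..int CARD('n)}" "i < j" "l < m"
    using a iter_range by blast+
  show "m - l = j - i" using a M_dich'[of "int k" i j l m] M_dich'[of "int k" i j m l] by auto
qed

lemma maps_to_tpair: "maps_to T \<Gamma>1 k \<alpha> \<beta> \<longleftrightarrow> (\<exists>i j l m. tpair k i j l m \<and> \<alpha> = rt i j \<and> \<beta> = rt l m)"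
proof
  assume "maps_to T \<Gamma>1 k \<alpha> \<beta>"
  then obtain i j u v where h: "i < j" "iter (int k) i j u v" "\<alpha> = rt i j" "\<beta> = rt (min u v) (max u v)"
    unfolding maps_to_iff by blast
  have "u \<noteq> v" using iter_range[OF h(2)] by blast
  then have "tpair k i j (min u v) (max u v)" using h by (auto simp: tpair_def min_def max_def)
  then show "\<exists>i j l m. tpair k i j l m \<and> \<alpha> = rt i j \<and> \<beta> = rt l m" using h by blast
next
  assume "\<exists>i j l m. tpair k i j l m \<and> \<alpha> = rt i j \<and> \<beta> = rt l m"
  then obtain i j l m where h: "tpair k i j l m" "\<alpha> = rt i j" "\<beta> = rt l m" by blast
  note r = tpair_range[OF h(1)]
  show "maps_to T \<Gamma>1 k \<alpha> \<beta>" unfolding h(2,3) using maps_to_rt[of i j l m k] r h(1) by (auto simp: tpair_def)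
qed

lemma maps_to_tpair_rt:
  assumes "i \<in> {1..int CARD('n)}" "j \<in> {1..int CARD('n)}" "i \<noteq> j" "l \<in> {1..int CARD('n)}" "m \<in> {1..int CARD('n)}" "l \<noteq> m"
  shows "maps_to T \<Gamma>1 k (rt i j) (rt l m) \<longleftrightarrow> tpair k i j l m"
proof
  assume "maps_to T \<Gamma>1 k (rt i j) (rt l m)"
  then obtain i' j' l' m' where h: "tpair k i' j' l' m'" "(rt i j :: 'n cvec) = rt i' j'" "(rt l m :: 'n cvec) = rt l' m'"
    unfolding maps_to_tpair by blast
  note r = tpair_range[OF h(1)]
  have "i = i' \<and> j = j'" by (rule rt_inj[OF assms(1-3) _ _ _ h(2)]) (use r in auto)
  moreover have "l = l' \<and> m = m'" by (rule rt_inj[OF assms(4-6) _ _ _ h(3)]) (use r in auto)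
  ultimately show "tpair k i j l m" using h(1) by simp
qed (use maps_to_tpair in blast)

lemma tpair_unique:
  assumes "tpair k i j l m" "tpair k i j l' m'"
  shows "l = l' \<and> m = m'"
proof -
  have "\<exists>u v. iter (int k) i j u v \<and> l = min u v \<and> m = max u v" "\<exists>u v. iter (int k) i j u v \<and> l' = min u v \<and> m' = max u v"
    using assms unfolding tpair_def by (metis less_imp_le max.absorb1 max.absorb2 min.absorb1 min.absorb2)+
  then show ?thesis using iter_vertex M_vertex' by metis
qed

lemma tpair_order_unique:
  assumes "tpair k i j l m" "tpair k' i j l m"
  shows "k = k'"
  using maps_to_unique[of k "rt i j" "rt l m" k'] maps_to_tpair assms by blast

lemma orient_C_tpair:
  assumes "tpair k i j l m" "1 \<le> k"
  shows "orient_C T \<Gamma>1 (rt i j) (rt l m) = (if iter (int k) i j m l then 1 else 0)"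
proof -
  note a = assms(1)[unfolded tpair_def]
  show ?thesis
  proof (cases "iter (int k) i j m l")
    case True
    then show ?thesis using orient_C_rt[OF True] a assms(2) by simp
  next
    case False
    then have "iter (int k) i j l m" using a by blast
    from orient_C_rt[OF this] show ?thesis using a assms(2) False by simp
  qed
qed

lemma Ord_tpair:
  assumes "tpair k i j l m" "1 \<le> k"
  shows "Ord T \<Gamma>1 (rt l m, - rt i j) = k"
  unfolding Ord_def
proof (rule the_equality)
  have "maps_to T \<Gamma>1 k (rt i j) (rt l m)" using maps_to_tpair assms(1) by blast
  then show "1 \<le> k \<and> maps_to T \<Gamma>1 k (- snd (rt l m :: 'n cvec, - rt i j :: 'n cvec)) (fst (rt l m :: 'n cvec, - rt i j :: 'n cvec))"
    using assms(2) by simp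
  fix k' assume "1 \<le> k' \<and> maps_to T \<Gamma>1 k' (- snd (rt l m :: 'n cvec, - rt i j :: 'n cvec)) (fst (rt l m :: 'n cvec, - rt i j :: 'n cvec))"
  then show "k' = k" using maps_to_unique[of k' "rt i j" "rt l m" k] \<open>maps_to T \<Gamma>1 k (rt i j) (rt l m)\<close> by simp
qed

lemma PO_r_iff:
  assumes "i \<in> {1..int CARD('n)}" "j \<in> {1..int CARD('n)}" "i < j"
  shows "PO_r T \<Gamma>1 (rt i j) = Some k \<longleftrightarrow> k > 0 \<and> tpair k i j j (2 * j - i)"
proof -
  have ix: "root_ix (rt i j :: 'n cvec) = (nat i, nat j)" by (rule root_ix_rt) (use assms in auto)
  have b: "basis_vec (nat j) - basis_vec (2 * nat j - nat i) = (rt j (2 * j - i) :: 'n cvec)"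
    using assms by (simp add: rt_def nat_diff_distrib' nat_mult_distrib)
  have c: "2 * nat j - nat i \<le> CARD('n) \<longleftrightarrow> 2 * j - i \<le> int CARD('n)" using assms by auto
  define Q where "Q = (\<lambda>k. k > 0 \<and> 2 * nat j - nat i \<le> CARD('n) \<and> maps_to T \<Gamma>1 k (rt i j) (basis_vec (nat j) - basis_vec (2 * nat j - nat i)))"
  have Q: "Q k \<longleftrightarrow> k > 0 \<and> tpair k i j j (2 * j - i)" for k
  proof (cases "2 * j - i \<le> int CARD('n)")
    case True
    then show ?thesis unfolding Q_def b c using maps_to_tpair_rt[of i j j "2 * j - i" k] assms by auto
  next
    case False
    then show ?thesis unfolding Q_def c using tpair_range(4)[of k i j j "2 * j - i"] by auto
  qed
  have u: "Q k \<Longrightarrow> Q k' \<Longrightarrow> k = k'" for k k' unfolding Q using tpair_order_unique by blast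
  have "PO_r T \<Gamma>1 (rt i j) = (if \<exists>k. Q k then Some (THE k. Q k) else None)"
    unfolding PO_r_def ix Q_def by (simp add: Let_def)
  moreover have "(THE k. Q k) = k" if "Q k" for k using that u by blast
  ultimately show ?thesis unfolding Q[symmetric] by auto
qed

lemma PO_l_iff:
  assumes "i \<in> {1..int CARD('n)}" "j \<in> {1..int CARD('n)}" "i < j"
  shows "PO_l T \<Gamma>1 (rt i j) = Some k \<longleftrightarrow> k > 0 \<and> tpair k i j (2 * i - j) i"
proof -
  have ix: "root_ix (rt i j :: 'n cvec) = (nat i, nat j)" by (rule root_ix_rt) (use assms in auto)
  have b: "basis_vec (2 * nat i - nat j) - basis_vec (nat i) = (rt (2 * i - j) i :: 'n cvec)"
    using assms by (simp add: rt_def nat_diff_distrib' nat_mult_distrib)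
  have c: "nat j < 2 * nat i \<longleftrightarrow> 1 \<le> 2 * i - j" using assms by auto
  define Q where "Q = (\<lambda>k. k > 0 \<and> nat j < 2 * nat i \<and> maps_to T \<Gamma>1 k (rt i j) (basis_vec (2 * nat i - nat j) - basis_vec (nat i)))"
  have Q: "Q k \<longleftrightarrow> k > 0 \<and> tpair k i j (2 * i - j) i" for k
  proof (cases "1 \<le> 2 * i - j")
    case True
    then show ?thesis unfolding Q_def b c using maps_to_tpair_rt[of i j "2 * i - j" i k] assms by auto
  next
    case False
    then show ?thesis unfolding Q_def c using tpair_range(3)[of k i j "2 * i - j" i] by auto
  qed
  have u: "Q k \<Longrightarrow> Q k' \<Longrightarrow> k = k'" for k k' unfolding Q using tpair_order_unique by blast
  have "PO_l T \<Gamma>1 (rt i j) = (if \<exists>k. Q k then Some (THE k. Q k) else None)"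
    unfolding PO_l_def ix Q_def by (simp add: Let_def)
  moreover have "(THE k. Q k) = k" if "Q k" for k using that u by blast
  ultimately show ?thesis unfolding Q[symmetric] by auto
qed

lemma if_1_0_eq_iff: "(if A then 1 else 0 :: nat) = (if B then 1 else 0) \<longleftrightarrow> (A \<longleftrightarrow> B)" by simp

text \<open>
  If \<open>T\<^sup>k\<^sup>-\<^sup>t\<close> carries \<open>i..j\<close> to \<open>j..(2j - i)\<close> with the orientation of \<open>T\<^sup>k\<close>, then \<open>T\<^sup>t\<close> carries
  \<open>j..(2j - i)\<close> to \<open>l..m\<close> by a translation, so \<open>j\<close> goes straight to \<open>l\<close>. Conversely, if \<open>j\<close> goes
  straight to \<open>l\<close> under \<open>T\<^sup>t\<close>, the segment that \<open>T\<^sup>t\<close> carries to \<open>l..m\<close> must be \<open>j..(2j - i)\<close>.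
\<close>

lemma straight_r_iff:
  assumes p: "tpair k i j l m" and t: "1 \<le> t" "t < k"
  shows "straight (int t) j l \<longleftrightarrow> tpair (k - t) i j j (2 * j - i) \<and>
    orient_C T \<Gamma>1 (rt i j) (rt l m) = orient_C T \<Gamma>1 (rt i j) (rt j (2 * j - i))"
proof -
  note r = tpair_range[OF p]
  have kt: "int t + int (k - t) = int k" using t by simp
  have k1: "1 \<le> k" "1 \<le> k - t" using t by auto
  have comp: "iter (int t) a b u v \<longleftrightarrow> iter (int k) i j u v" if "iter (int (k - t)) i j a b" for a b u v
    using iter_compose[OF that, of "int t" u v] unfolding kt by blast
  have excl: "\<not> (iter (int k) i j l m \<and> iter (int k) i j m l)" using iter_vertex[of "int k" i j l m j m l] r by auto
  show ?thesis
  proof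
    assume V: "straight (int t) j l"
    then obtain b d where V': "iter (int t) j b l d" unfolding straight_def by blast
    from p consider "iter (int k) i j l m" | "iter (int k) i j m l" unfolding tpair_def by blast
    then show "tpair (k - t) i j j (2 * j - i) \<and> orient_C T \<Gamma>1 (rt i j) (rt l m) = orient_C T \<Gamma>1 (rt i j) (rt j (2 * j - i))"
    proof cases
      case 1
      obtain a c where ac: "iter (int (k - t)) i j a c" using iter_defined_at_mono[of "k - t" t i j l m] 1 t by auto
      have m: "iter (int t) a c l m" using comp[OF ac] 1 by blast
      have "a = j" using iter_inj[OF m V'] .
      then have "c = 2 * j - i" using straight_iter[OF V, of c l m] m r by auto
      then have tp: "tpair (k - t) i j j (2 * j - i)" "iter (int (k - t)) i j j (2 * j - i)" using ac \<open>a = j\<close> r by (auto simp: tpair_def)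
      have "\<not> iter (int (k - t)) i j (2 * j - i) j" using iter_vertex[OF tp(2), of j "2 * j - i" j] r by auto
      then show ?thesis using orient_C_tpair[OF tp(1) k1(2)] orient_C_tpair[OF p k1(1)] 1 excl tp by auto
    next
      case 2
      obtain a c where ac: "iter (int (k - t)) i j a c" using iter_defined_at_mono[of "k - t" t i j m l] 2 t by auto
      have m: "iter (int t) c a l m" using comp[OF ac] 2 iter_swap by blast
      have "c = j" using iter_inj[OF m V'] .
      then have "a = 2 * j - i" using straight_iter[OF V, of a l m] m r by auto
      then have tp: "tpair (k - t) i j j (2 * j - i)" "iter (int (k - t)) i j (2 * j - i) j" using ac \<open>c = j\<close> r by (auto simp: tpair_def)
      then show ?thesis using orient_C_tpair[OF tp(1) k1(2)] orient_C_tpair[OF p k1(1)] 2 by auto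
    qed
  next
    assume a: "tpair (k - t) i j j (2 * j - i) \<and> orient_C T \<Gamma>1 (rt i j) (rt l m) = orient_C T \<Gamma>1 (rt i j) (rt j (2 * j - i))"
    then have tp: "tpair (k - t) i j j (2 * j - i)" by blast
    have eq: "iter (int k) i j m l \<longleftrightarrow> iter (int (k - t)) i j (2 * j - i) j"
      using conjunct2[OF a] unfolding orient_C_tpair[OF tp k1(2)] orient_C_tpair[OF p k1(1)] if_1_0_eq_iff .
    show "straight (int t) j l"
    proof (cases "iter (int (k - t)) i j (2 * j - i) j")
      case True
      then have "iter (int t) (2 * j - i) j m l" using comp[OF True] eq by blast
      then have "iter (int t) j (2 * j - i) l m" using iter_swap by blast
      moreover have "m - l = 2 * j - i - j" using r by simp
      ultimately show ?thesis unfolding straight_def by blast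
    next
      case False
      then have "iter (int (k - t)) i j j (2 * j - i)" "iter (int k) i j l m" using tp eq p by (auto simp: tpair_def)
      then have "iter (int t) j (2 * j - i) l m" using comp by blast
      moreover have "m - l = 2 * j - i - j" using r by simp
      ultimately show ?thesis unfolding straight_def by blast
    qed
  qed
qed

text \<open>The mirror image of \<open>straight_r_iff\<close>, with the segment \<open>(2i - j)..i\<close>.\<close>

lemma straight_l_iff:
  assumes p: "tpair k i j l m" and t: "1 \<le> t" "t < k"
  shows "straight (int t) i m \<longleftrightarrow> tpair (k - t) i j (2 * i - j) i \<and>
    orient_C T \<Gamma>1 (rt i j) (rt l m) = orient_C T \<Gamma>1 (rt i j) (rt (2 * i - j) i)"
proof -
  note r = tpair_range[OF p]
  have kt: "int t + int (k - t) = int k" using t by simp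
  have k1: "1 \<le> k" "1 \<le> k - t" using t by auto
  have comp: "iter (int t) a b u v \<longleftrightarrow> iter (int k) i j u v" if "iter (int (k - t)) i j a b" for a b u v
    using iter_compose[OF that, of "int t" u v] unfolding kt by blast
  have excl: "\<not> (iter (int k) i j l m \<and> iter (int k) i j m l)" using iter_vertex[of "int k" i j l m j m l] r by auto
  show ?thesis
  proof
    assume V: "straight (int t) i m"
    then obtain b d where V': "iter (int t) i b m d" unfolding straight_def by blast
    from p consider "iter (int k) i j l m" | "iter (int k) i j m l" unfolding tpair_def by blast
    then show "tpair (k - t) i j (2 * i - j) i \<and> orient_C T \<Gamma>1 (rt i j) (rt l m) = orient_C T \<Gamma>1 (rt i j) (rt (2 * i - j) i)"
    proof cases
      case 1
      obtain a c where ac: "iter (int (k - t)) i j a c" using iter_defined_at_mono[of "k - t" t i j l m] 1 t by auto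
      have m: "iter (int t) c a m l" using comp[OF ac] 1 iter_swap by blast
      have "c = i" using iter_inj[OF m V'] .
      then have "a = 2 * i - j" using straight_iter[OF V, of a m l] m r by auto
      then have tp: "tpair (k - t) i j (2 * i - j) i" "iter (int (k - t)) i j (2 * i - j) i" using ac \<open>c = i\<close> r by (auto simp: tpair_def)
      have "\<not> iter (int (k - t)) i j i (2 * i - j)" using iter_vertex[OF tp(2), of j i "2 * i - j"] r by auto
      then show ?thesis using orient_C_tpair[OF tp(1) k1(2)] orient_C_tpair[OF p k1(1)] 1 excl tp(1) by auto
    next
      case 2
      obtain a c where ac: "iter (int (k - t)) i j a c" using iter_defined_at_mono[of "k - t" t i j m l] 2 t by auto
      have m: "iter (int t) a c m l" using comp[OF ac] 2 by blast
      have "a = i" using iter_inj[OF m V'] .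
      then have "c = 2 * i - j" using straight_iter[OF V, of c m l] m r by auto
      then have tp: "tpair (k - t) i j (2 * i - j) i" "iter (int (k - t)) i j i (2 * i - j)" using ac \<open>a = i\<close> r by (auto simp: tpair_def)
      then show ?thesis using orient_C_tpair[OF tp(1) k1(2)] orient_C_tpair[OF p k1(1)] 2 by auto
    qed
  next
    assume a: "tpair (k - t) i j (2 * i - j) i \<and> orient_C T \<Gamma>1 (rt i j) (rt l m) = orient_C T \<Gamma>1 (rt i j) (rt (2 * i - j) i)"
    then have tp: "tpair (k - t) i j (2 * i - j) i" by blast
    have eq: "iter (int k) i j m l \<longleftrightarrow> iter (int (k - t)) i j i (2 * i - j)"
      using conjunct2[OF a] unfolding orient_C_tpair[OF tp k1(2)] orient_C_tpair[OF p k1(1)] if_1_0_eq_iff .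
    show "straight (int t) i m"
    proof (cases "iter (int (k - t)) i j i (2 * i - j)")
      case True
      then have "iter (int t) i (2 * i - j) m l" using comp[OF True] eq by blast
      moreover have "l - m = 2 * i - j - i" using r by simp
      ultimately show ?thesis unfolding straight_def by blast
    next
      case False
      then have "iter (int (k - t)) i j (2 * i - j) i" "iter (int k) i j l m" using tp eq p by (auto simp: tpair_def)
      then have "iter (int t) (2 * i - j) i l m" using comp by blast
      then have "iter (int t) i (2 * i - j) m l" using iter_swap by blast
      moreover have "l - m = 2 * i - j - i" using r by simp
      ultimately show ?thesis unfolding straight_def by blast
    qed
  qed
qed

text \<open>
  A common form of both kinds of passing: \<open>l0..m0\<close> is the neighbouring segment of \<open>i..j\<close>, and
  \<open>a\<close>, \<open>b\<close> are the ends that have to be compared. Being half passed means \<open>a = b\<close>, being passed means that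
  \<open>a\<close> goes straight to \<open>b\<close> under an earlier power of \<open>T\<close>. Since the order of a pair is unique, this happens
  for at most one power, and not if \<open>a = b\<close>.
\<close>

lemma Pval_weight:
  assumes p: "tpair k i j l m" and k: "1 \<le> k"
    and PO: "\<And>k'. PO (rt i j) = Some k' \<longleftrightarrow> k' > 0 \<and> tpair k' i j l0 m0"
    and V: "\<And>t. 1 \<le> t \<Longrightarrow> t < k \<Longrightarrow> straight (int t) a b \<longleftrightarrow> tpair (k - t) i j l0 m0 \<and>
      orient_C T \<Gamma>1 (rt i j) (rt l m) = orient_C T \<Gamma>1 (rt i j) (rt l0 m0)"
    and half: "tpair k i j l0 m0 \<longleftrightarrow> a = b"
  shows "Pval T \<Gamma>1 PO (rt l m, - rt i j) = (if a = b then 1 / 2 else 0) + (if \<exists>t\<in>{1..<int k}. straight t a b then 1 else 0)"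
    and "\<exists>t0. \<forall>t\<in>{1..<int k}. straight t a b \<longrightarrow> t = t0"
proof -
  have O: "Ord T \<Gamma>1 (rt l m, - rt i j) = k" by (rule Ord_tpair[OF p k])
  have hp: "half_passed T \<Gamma>1 PO (rt l m, - rt i j) \<longleftrightarrow> a = b"
    unfolding half_passed_def O using PO[of k] half k by simp
  have ex: "(\<exists>t\<in>{1..<int k}. straight t a b) \<longleftrightarrow> (\<exists>t. 1 \<le> t \<and> t < k \<and> straight (int t) a b)"
  proof
    assume "\<exists>t\<in>{1..<int k}. straight t a b"
    then obtain t where "t \<in> {1..<int k}" "straight t a b" by blast
    then show "\<exists>t. 1 \<le> t \<and> t < k \<and> straight (int t) a b" by (intro exI[of _ "nat t"]) auto
  next
    assume "\<exists>t. 1 \<le> t \<and> t < k \<and> straight (int t) a b"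
    then obtain t where "1 \<le> t" "t < k" "straight (int t) a b" by blast
    then show "\<exists>t\<in>{1..<int k}. straight t a b" by (intro bexI[of _ "int t"]) auto
  qed
  have ps: "passed T \<Gamma>1 PO (rt l m, - rt i j) \<longleftrightarrow> (\<exists>t. 1 \<le> t \<and> t < k \<and> straight (int t) a b)"
  proof
    assume "passed T \<Gamma>1 PO (rt l m, - rt i j)"
    then obtain k0 \<gamma> where h: "PO (rt i j) = Some k0" "k0 < k" "maps_to T \<Gamma>1 k0 (rt i j) \<gamma>"
      "orient_C T \<Gamma>1 (rt i j) (rt l m) = orient_C T \<Gamma>1 (rt i j) \<gamma>"
      unfolding passed_def O[unfolded Ord_def] by (auto simp: Let_def O)
    have k0: "k0 > 0" "tpair k0 i j l0 m0" using h(1) PO by auto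
    obtain i' j' l' m' where q: "tpair k0 i' j' l' m'" "(rt i j :: 'n cvec) = rt i' j'" "\<gamma> = rt l' m'"
      using h(3) unfolding maps_to_tpair by blast
    note r = tpair_range[OF p] and r' = tpair_range[OF q(1)]
    have "i = i' \<and> j = j'" by (rule rt_inj[OF _ _ _ _ _ _ q(2)]) (use r r' in auto)
    then have "\<gamma> = rt l0 m0" using tpair_unique[OF k0(2), of l' m'] q by simp
    then have "straight (int (k - k0)) a b" using V[of "k - k0"] k0 h by simp
    then show "\<exists>t. 1 \<le> t \<and> t < k \<and> straight (int t) a b" using k0 h by (intro exI[of _ "k - k0"]) auto
  next
    assume "\<exists>t. 1 \<le> t \<and> t < k \<and> straight (int t) a b"
    then obtain t where t: "1 \<le> t" "t < k" "straight (int t) a b" by blast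
    then have v: "tpair (k - t) i j l0 m0" "orient_C T \<Gamma>1 (rt i j) (rt l m) = orient_C T \<Gamma>1 (rt i j) (rt l0 m0)"
      using V by auto
    have "PO (rt i j) = Some (k - t)" using PO v(1) t by auto
    moreover have "maps_to T \<Gamma>1 (k - t) (rt i j) (rt l0 m0)" using maps_to_tpair v(1) by blast
    ultimately show "passed T \<Gamma>1 PO (rt l m, - rt i j)" unfolding passed_def Let_def using v(2) t O by auto
  qed
  have not_both: "\<not> ((\<exists>t. 1 \<le> t \<and> t < k \<and> straight (int t) a b) \<and> a = b)"
  proof
    assume "(\<exists>t. 1 \<le> t \<and> t < k \<and> straight (int t) a b) \<and> a = b"
    then obtain t where t: "1 \<le> t" "t < k" "straight (int t) a b" "a = b" by blast
    then have "k - t = k" using V[OF t(1,2)] half tpair_order_unique by blast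
    then show False using t by simp
  qed
  show "Pval T \<Gamma>1 PO (rt l m, - rt i j) = (if a = b then 1 / 2 else 0) + (if \<exists>t\<in>{1..<int k}. straight t a b then 1 else 0)"
    unfolding Pval_def ps hp ex using not_both by auto
  show "\<exists>t0. \<forall>t\<in>{1..<int k}. straight t a b \<longrightarrow> t = t0"
  proof (cases "\<exists>t\<in>{1..<int k}. straight t a b")
    case True
    then obtain t0 where t0: "t0 \<in> {1..<int k}" "straight t0 a b" by blast
    have "t = t0" if "t \<in> {1..<int k}" "straight t a b" for t
    proof -
      have "tpair (k - nat t) i j l0 m0" using V[of "nat t"] that by auto
      moreover have "tpair (k - nat t0) i j l0 m0" using V[of "nat t0"] t0 by auto
      ultimately have "k - nat t = k - nat t0" by (rule tpair_order_unique)
      then show ?thesis using that t0 by auto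
    qed
    then show ?thesis by blast
  qed blast
qed

lemma prod_single:
  fixes f :: "int \<Rightarrow> 'a::comm_monoid_mult"
  assumes "\<forall>t\<in>A. P t \<longrightarrow> t = t0" "finite A"
  shows "(\<Prod>t\<in>A. if P t then c else 1) = (if \<exists>t\<in>A. P t then c else (1 :: 'a))"
proof (cases "\<exists>t\<in>A. P t")
  case True
  then have t0: "t0 \<in> A" "P t0" using assms(1) by auto
  have "(\<Prod>t\<in>A. if P t then c else 1) = c * (\<Prod>t\<in>A - {t0}. if P t then c else 1)"
    using prod.remove[OF assms(2) t0(1), of "\<lambda>t. if P t then c else 1"] t0 by simp
  also have "(\<Prod>t\<in>A - {t0}. if P t then c else 1) = 1" using assms(1) by (intro prod.neutral) auto
  finally show ?thesis using True by simp
next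
  case False
  then have "(\<Prod>t\<in>A. if P t then c else 1) = 1" by (intro prod.neutral) auto
  then show ?thesis using False by simp
qed

lemma weights_tpair:
  assumes p: "tpair k i j l m" and k: "1 \<le> k"
  shows "lev_wt (int k) j l = qpow (Pval T \<Gamma>1 (PO_r T \<Gamma>1) (rt l m, - rt i j))"
    and "lev_wti (int k) i m = qpow (- Pval T \<Gamma>1 (PO_l T \<Gamma>1) (rt l m, - rt i j))"
proof -
  note r = tpair_range[OF p]
  have hr: "tpair k i j j (2 * j - i) \<longleftrightarrow> j = l"
  proof
    assume "tpair k i j j (2 * j - i)" then show "j = l" using tpair_unique[OF p] by auto
  next
    assume "j = l"
    moreover then have "2 * j - i = m" using r by simp
    ultimately show "tpair k i j j (2 * j - i)" using p by simp
  qed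
  have hl: "tpair k i j (2 * i - j) i \<longleftrightarrow> i = m"
  proof
    assume "tpair k i j (2 * i - j) i" then show "i = m" using tpair_unique[OF p] by auto
  next
    assume "i = m"
    moreover then have "2 * i - j = l" using r by simp
    ultimately show "tpair k i j (2 * i - j) i" using p by simp
  qed
  have R: "Pval T \<Gamma>1 (PO_r T \<Gamma>1) (rt l m, - rt i j) = (if j = l then 1 / 2 else 0) + (if \<exists>t\<in>{1..<int k}. straight t j l then 1 else 0)"
    "\<exists>t0. \<forall>t\<in>{1..<int k}. straight t j l \<longrightarrow> t = t0"
    by (rule Pval_weight[where PO = "PO_r T \<Gamma>1", OF p k PO_r_iff[OF r(1,2,5)] straight_r_iff[OF p] hr]; assumption)+
  have L: "Pval T \<Gamma>1 (PO_l T \<Gamma>1) (rt l m, - rt i j) = (if i = m then 1 / 2 else 0) + (if \<exists>t\<in>{1..<int k}. straight t i m then 1 else 0)"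
    "\<exists>t0. \<forall>t\<in>{1..<int k}. straight t i m \<longrightarrow> t = t0"
    by (rule Pval_weight[where PO = "PO_l T \<Gamma>1", OF p k PO_l_iff[OF r(1,2,5)] straight_l_iff[OF p] hl]; assumption)+
  obtain t0 where t0: "\<forall>t\<in>{1..<int k}. straight t j l \<longrightarrow> t = t0" using R(2) by blast
  have "(\<Prod>t\<in>{1..<int k}. swt t j l) = (if \<exists>t\<in>{1..<int k}. straight t j l then q else 1)"
    unfolding swt_def by (rule prod_single[OF t0]) simp
  then show "lev_wt (int k) j l = qpow (Pval T \<Gamma>1 (PO_r T \<Gamma>1) (rt l m, - rt i j))"
    unfolding lev_wt_def half_wt_def R(1) by (auto simp: qpow_add q_qpow qpow_0)
  obtain t1 where t1: "\<forall>t\<in>{1..<int k}. straight t i m \<longrightarrow> t = t1" using L(2) by blast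
  have "(\<Prod>t\<in>{1..<int k}. swti t i m) = (if \<exists>t\<in>{1..<int k}. straight t i m then inverse q else 1)"
    unfolding swti_def by (rule prod_single[OF t1]) simp
  then show "lev_wti (int k) i m = qpow (- Pval T \<Gamma>1 (PO_l T \<Gamma>1) (rt l m, - rt i j))"
    unfolding lev_wti_def half_wti_def L(1) by (auto simp: qpow_add qi_qpow qpow_0)
qed

end

section \<open>The twist and the standard \<open>R\<close>-matrix in coordinates\<close>

lemma flip_sum: "flip (sum f S) = (\<Sum>a\<in>S. flip (f a :: ('a::comm_monoid_add, 'n::finite) tmat))"
  by (simp add: flip_def vec_eq_iff)

context bd_setup
begin

lemma pairs_ix_n: "(x, y) \<in> pairs_ix \<longleftrightarrow> x \<in> {1..int CARD('n)} \<and> y \<in> {1..int CARD('n)}"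
  by (simp add: pairs_ix_def)

lemma entry_sum: "entry (sum f S) x y z w = (\<Sum>a\<in>S. entry (f a :: ('a::comm_monoid_add, 'n) tmat) x y z w)"
  by (cases "(x, y) \<in> pairs_ix \<and> (z, w) \<in> pairs_ix") (auto simp: entry_def intro!: sum.neutral[symmetric])

lemma entry_scale: "entry (c *\<^sub>m A) x y z w = c * entry (A :: ('a::mult_zero, 'n) tmat) x y z w"
  by (simp add: entry_def mscale_def)

lemma idx_vx_eq: "i \<in> {1..CARD('n)} \<Longrightarrow> x \<in> {1..int CARD('n)} \<Longrightarrow> (vx x :: 'n) = idx i \<longleftrightarrow> x = int i"
  using vx_eq[of x "int i", where 'n = 'n] by (auto simp: vx_def)

lemma entry_units:
  assumes "a \<in> {1..CARD('n)}" "b \<in> {1..CARD('n)}" "c \<in> {1..CARD('n)}" "d \<in> {1..CARD('n)}"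
  shows "entry (mat_unit a b \<otimes> mat_unit c d :: ('a::semiring_1, 'n) tmat) x y z w =
    (if x = int a \<and> y = int c \<and> z = int b \<and> w = int d then 1 else 0)"
proof (cases "(x, y) \<in> pairs_ix \<and> (z, w) \<in> pairs_ix")
  case True
  then show ?thesis
    using assms by (auto simp: entry_def tensor_def mat_unit_def pairs_ix_n idx_vx_eq)
next
  case False
  then show ?thesis using assms by (auto simp: entry_def pairs_ix_n)
qed

lemma root_mat_rt:
  assumes "i \<in> {1..int CARD('n)}" "j \<in> {1..int CARD('n)}" "i \<noteq> j"
  shows "root_mat (rt i j :: 'n cvec) = mat_unit (nat i) (nat j)"
  using root_ix_rt[OF assms] by (simp add: root_mat_def)

lemma root_mat_minus_rt:
  assumes "i \<in> {1..int CARD('n)}" "j \<in> {1..int CARD('n)}" "i \<noteq> j"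
  shows "root_mat (- rt i j :: 'n cvec) = mat_unit (nat j) (nat i)"
  using root_mat_rt[of j i] assms by (simp add: rt_uminus)

text \<open>The entry determines the pair: \<open>\<beta> = e\<^sub>x - e\<^sub>z\<close> and \<open>\<alpha> = e\<^sub>w - e\<^sub>y\<close>.\<close>

lemma entry_pair_sum:
  fixes c :: "'n cvec \<Rightarrow> 'n cvec \<Rightarrow> 'a::comm_ring_1"
  assumes "\<And>\<alpha> \<beta>. P \<alpha> \<beta> \<longleftrightarrow> (\<exists>k\<in>A. maps_to T \<Gamma>1 k \<alpha> \<beta>)"
    and fin: "finite {(\<alpha>, \<beta>). P \<alpha> \<beta>}"
  shows "entry (\<Sum>(\<alpha>, \<beta>) | P \<alpha> \<beta>. c \<alpha> \<beta> *\<^sub>m (root_mat \<beta> \<otimes> root_mat (- \<alpha>))) x y z w =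
    (if \<exists>k\<in>A. tpair k w y x z then c (rt w y) (rt x z) else 0)"
proof -
  have t: "entry (c \<alpha> \<beta> *\<^sub>m (root_mat \<beta> \<otimes> root_mat (- \<alpha>))) x y z w =
    (if \<alpha> = rt w y \<and> \<beta> = rt x z \<and> (\<exists>k\<in>A. tpair k w y x z) then c \<alpha> \<beta> else 0)" if Pab: "P \<alpha> \<beta>" for \<alpha> \<beta>
  proof -
    obtain k i j l m where h: "k \<in> A" "tpair k i j l m" "\<alpha> = rt i j" "\<beta> = rt l m"
      using Pab unfolding assms(1) maps_to_tpair by blast
    note r = tpair_range[OF h(2)]
    have e: "entry (c \<alpha> \<beta> *\<^sub>m (root_mat \<beta> \<otimes> root_mat (- \<alpha>))) x y z w =
      (if x = l \<and> y = j \<and> z = m \<and> w = i then c \<alpha> \<beta> else 0)"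
      unfolding entry_scale h(3,4) root_mat_rt[OF r(3,4) less_imp_neq[OF r(6)]] root_mat_minus_rt[OF r(1,2) less_imp_neq[OF r(5)]]
      by (subst entry_units) (use r in auto)
    show ?thesis
    proof (cases "x = l \<and> y = j \<and> z = m \<and> w = i")
      case True
      then show ?thesis unfolding e using h by auto
    next
      case False
      have "\<not> (\<alpha> = rt w y \<and> \<beta> = rt x z \<and> (\<exists>k\<in>A. tpair k w y x z))"
      proof
        assume a: "\<alpha> = rt w y \<and> \<beta> = rt x z \<and> (\<exists>k\<in>A. tpair k w y x z)"
        then obtain k' where t: "tpair k' w y x z" by blast
        note r' = tpair_range[OF t]
        have eq: "(rt i j :: 'n cvec) = rt w y" "(rt l m :: 'n cvec) = rt x z" using a h by auto
        have "i = w \<and> j = y" by (rule rt_inj[OF _ _ _ _ _ _ eq(1)]) (use r r' in auto)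
        moreover have "l = x \<and> m = z" by (rule rt_inj[OF _ _ _ _ _ _ eq(2)]) (use r r' in auto)
        ultimately show False using False by auto
      qed
      then show ?thesis unfolding e using False by auto
    qed
  qed
  have "entry (\<Sum>(\<alpha>, \<beta>) | P \<alpha> \<beta>. c \<alpha> \<beta> *\<^sub>m (root_mat \<beta> \<otimes> root_mat (- \<alpha>))) x y z w =
    (\<Sum>(\<alpha>, \<beta>) | P \<alpha> \<beta>. if \<alpha> = rt w y \<and> \<beta> = rt x z \<and> (\<exists>k\<in>A. tpair k w y x z) then c \<alpha> \<beta> else 0)"
    unfolding entry_sum by (intro sum.cong refl) (use t in auto)
  also have "\<dots> = (case (rt w y, rt x z) of (\<alpha>, \<beta>) \<Rightarrow>
    if \<alpha> = rt w y \<and> \<beta> = rt x z \<and> (\<exists>k\<in>A. tpair k w y x z) then c \<alpha> \<beta> else 0)"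
  proof (rule sum_eq_single[OF fin])
    show "(case u of (\<alpha>, \<beta>) \<Rightarrow> if \<alpha> = rt w y \<and> \<beta> = rt x z \<and> (\<exists>k\<in>A. tpair k w y x z) then c \<alpha> \<beta> else 0) = 0"
      if "u \<noteq> (rt w y, rt x z)" for u using that by (auto split: prod.splits)
    assume "(rt w y, rt x z) \<notin> {(\<alpha>, \<beta>). P \<alpha> \<beta>}"
    then have "\<not> (\<exists>k\<in>A. maps_to T \<Gamma>1 k (rt w y) (rt x z))" unfolding assms(1) by simp
    then have "\<not> (\<exists>k\<in>A. tpair k w y x z)" using maps_to_tpair by blast
    then show "(case (rt w y, rt x z) of (\<alpha>, \<beta>) \<Rightarrow> if \<alpha> = rt w y \<and> \<beta> = rt x z \<and> (\<exists>k\<in>A. tpair k w y x z) then c \<alpha> \<beta> else 0) = 0"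
      by simp
  qed
  finally show ?thesis by simp
qed

lemma finite_roots: "finite {rt i j :: 'n cvec | i j. (i, j) \<in> pairs_ix}"
proof -
  have "{rt i j :: 'n cvec | i j. (i, j) \<in> pairs_ix} = (\<lambda>(i, j). rt i j) ` pairs_ix" by auto
  then show ?thesis using finite_pairs_ix by simp
qed

lemma maps_to_roots: "maps_to T \<Gamma>1 k \<alpha> \<beta> \<Longrightarrow> (\<alpha>, \<beta>) \<in> {rt i j | i j. (i, j) \<in> pairs_ix} \<times> {rt i j | i j. (i, j) \<in> pairs_ix}"
  unfolding maps_to_tpair using tpair_range by (fastforce simp: pairs_ix_n)

lemma finite_maps_to: "finite {(\<alpha>, \<beta>). \<exists>k\<in>A. maps_to T \<Gamma>1 k \<alpha> \<beta>}"
  by (rule finite_subset[OF _ finite_cartesian_product[OF finite_roots finite_roots]]) (use maps_to_roots in blast)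

lemma tpair_coeff:
  assumes "tpair k w y x z" "1 \<le> k"
  shows "(- q) powi (- int (orient_C T \<Gamma>1 (rt w y) (rt x z) * (root_len (rt w y :: 'n cvec) - 1)))
    * qpow (P_a T \<Gamma>1 (rt x z, - rt w y)) * hq = lev_wt (int k) y x * entry (Tmat (int k)) y x w z * lev_wti (int k) w z"
proof -
  note r = tpair_range[OF assms(1)]
  have len: "root_len (rt w y :: 'n cvec) = nat (y - w)"
    using root_ix_rt[of w y, where 'n = 'n] r by (simp add: root_len_def)
  have q0: "q \<noteq> 0" by (metis mult_zero_left q_inverse(1) zero_neq_one)
  have pw: "(- q) powi (- int n) = (- inverse q) ^ n" for n
    by (simp add: power_int_def power_inverse[symmetric] fps_inverse_minus)
  have E: "entry (Tmat (int k)) y x w z = hq * (if iter (int k) w y z x then (- inverse q) ^ (nat (y - w) - 1) else 1)"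
  proof -
    have "\<not> (iter (int k) w y x z \<and> iter (int k) w y z x)" using iter_vertex[of "int k" w y x z y z x] r by auto
    then show ?thesis using assms(1) r unfolding entry_Tmat tpair_def by auto
  qed
  have P: "qpow (P_a T \<Gamma>1 (rt x z, - rt w y)) = lev_wt (int k) y x * lev_wti (int k) w z"
    unfolding weights_tpair[OF assms] qpow_add P_a_def by simp
  show ?thesis
    unfolding P E orient_C_tpair[OF assms] len pw by (simp add: mult_ac)
qed

lemma J_factor_flip:
  assumes "1 \<le> k"
  shows "J_factor T \<Gamma>1 k = flip (Jlev (int k))"
proof (rule mat_eqI)
  fix x y z w assume I: "(x, y) \<in> pairs_ix" "(z, w) \<in> pairs_ix"
  have "entry (J_factor T \<Gamma>1 k) x y z w = (if x = z \<and> y = w then 1 else 0) +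
    (if tpair k w y x z then lev_wt (int k) y x * entry (Tmat (int k)) y x w z * lev_wti (int k) w z else 0)"
    unfolding J_factor_def entry_add entry_one
    by (subst entry_pair_sum[where A = "{k}"])
      (use I finite_maps_to[of "{k}"] tpair_coeff[OF _ assms] in auto)
  also have "\<dots> = lev_wt (int k) y x * (entry (mat 1) y x w z + entry (Tmat (int k)) y x w z) * lev_wti (int k) w z"
  proof (cases "tpair k w y x z")
    case True
    then have "w < y" unfolding tpair_def by blast
    then show ?thesis using True by (simp add: entry_one)
  next
    case False
    then have "entry (Tmat (int k)) y x w z = 0" by (auto simp: entry_Tmat tpair_def)
    then show ?thesis using False I by (auto simp: entry_one lev_wt_lev_wti pairs_ix_n)
  qed
  finally show "entry (J_factor T \<Gamma>1 k) x y z w = entry (flip (Jlev (int k))) x y z w"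
    by (simp add: entry_flip Jlev_def entry_dmat_left entry_dmat_right entry_add)
qed

lemma flip_one: "flip (mat 1) = (mat 1 :: ('a::zero_neq_one, 'n) tmat)"
  by (rule mat_eqI) (auto simp: entry_flip entry_one pairs_ix_n)

lemma J_foldr_flip:
  "(\<And>k. k \<in> set ks \<Longrightarrow> 1 \<le> k) \<Longrightarrow> foldr (\<lambda>k X. J_factor T \<Gamma>1 k ** X) ks (mat 1) = flip (Jlevs ks)"
  by (induction ks) (auto simp: Jlevs_def flip_one flip_mult J_factor_flip)

lemma J_prod_flip: "J_prod T \<Gamma>1 = flip (Jlevs [1..<Suc (max_ord T \<Gamma>1)])"
  unfolding J_prod_def by (rule J_foldr_flip) auto

lemma tpair_le_max_ord:
  assumes "tpair k i j l m" "1 \<le> k"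
  shows "k \<le> max_ord T \<Gamma>1"
proof -
  have x: "(rt l m, - rt i j) \<in> TP_plus T \<Gamma>1"
  proof -
    have "maps_to T \<Gamma>1 k (rt i j) (rt l m)" using maps_to_tpair assms(1) by blast
    then show ?thesis unfolding TP_plus_def using assms(2) by blast
  qed
  have "TP_plus T \<Gamma>1 = (\<lambda>(\<alpha>, \<beta>). (\<beta>, - \<alpha>)) ` {(\<alpha>, \<beta>). \<exists>k\<in>{1..}. maps_to T \<Gamma>1 k \<alpha> \<beta>}"
    unfolding TP_plus_def by (auto simp: image_iff)
  then have "finite (TP_plus T \<Gamma>1)" using finite_maps_to by simp
  then have "Ord T \<Gamma>1 (rt l m, - rt i j) \<le> Max (Ord T \<Gamma>1 ` TP_plus T \<Gamma>1)" using x by simp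
  then show ?thesis using x unfolding max_ord_def Ord_tpair[OF assms] by auto
qed

lemma Tmat_beyond_max_ord:
  assumes "p > int (max_ord T \<Gamma>1)"
  shows "Tmat p = 0"
proof (rule mat_eqI)
  fix x y z w
  have p: "int (nat p) = p" "1 \<le> nat p" using assms by auto
  have "\<not> tpair (nat p) z x y w" using tpair_le_max_ord[of "nat p" z x y w] assms p by auto
  then show "entry (Tmat p) x y z w = entry 0 x y z w" unfolding tpair_def p(1) by (auto simp: entry_Tmat entry_zero)
qed

lemma entry_diag_units:
  "entry (\<Sum>i=1..CARD('n). mat_unit i i \<otimes> mat_unit i i :: ('a::comm_ring_1, 'n) tmat) x y z w =
    (if x = y \<and> x = z \<and> x = w \<and> (x, y) \<in> pairs_ix then 1 else 0)"
proof -
  have "entry (\<Sum>i=1..CARD('n). mat_unit i i \<otimes> mat_unit i i :: ('a, 'n) tmat) x y z w =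
    (\<Sum>i=1..CARD('n). if x = int i \<and> y = int i \<and> z = int i \<and> w = int i then 1 else 0)"
    unfolding entry_sum by (intro sum.cong refl) (simp add: entry_units)
  also have "\<dots> = (if x = y \<and> x = z \<and> x = w \<and> (x, y) \<in> pairs_ix then 1 else 0)"
  proof (cases "(x, y) \<in> pairs_ix")
    case True
    then have x: "nat x \<in> {1..CARD('n)}" "int (nat x) = x" by (auto simp: pairs_ix_n)
    show ?thesis
      by (subst sum_eq_single[where a = "nat x"]) (use x True in auto)
  next
    case False
    then show ?thesis by (auto simp: pairs_ix_n intro!: sum.neutral)
  qed
  finally show ?thesis .
qed

lemma entry_pair_units:
  assumes "\<And>i j. P i j \<Longrightarrow> i \<in> {1..CARD('n)} \<and> j \<in> {1..CARD('n)}"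
  shows "entry (\<Sum>(i, j) \<in> {(i, j). P i j}. mat_unit i i \<otimes> mat_unit j j :: ('a::comm_ring_1, 'n) tmat) x y z w =
    (if x = z \<and> y = w \<and> (x, y) \<in> pairs_ix \<and> P (nat x) (nat y) then 1 else 0)"
    and "entry (\<Sum>(i, j) \<in> {(i, j). P i j}. mat_unit i j \<otimes> mat_unit j i :: ('a::comm_ring_1, 'n) tmat) x y z w =
    (if x = w \<and> y = z \<and> (x, y) \<in> pairs_ix \<and> P (nat x) (nat y) then 1 else 0)"
proof -
  have fin: "finite {(i, j). P i j}"
    by (rule finite_subset[of _ "{1..CARD('n)} \<times> {1..CARD('n)}"]) (use assms in auto)
  have "entry (\<Sum>(i, j) \<in> {(i, j). P i j}. mat_unit i i \<otimes> mat_unit j j :: ('a, 'n) tmat) x y z w =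
    (\<Sum>(i, j)\<in>{(i, j). P i j}. if x = int i \<and> y = int j \<and> z = int i \<and> w = int j then 1 else 0)"
    unfolding entry_sum by (intro sum.cong refl) (use assms in \<open>auto simp: entry_units\<close>)
  also have "\<dots> = (if x = z \<and> y = w \<and> (x, y) \<in> pairs_ix \<and> P (nat x) (nat y) then 1 else 0)"
  proof (cases "(x, y) \<in> pairs_ix \<and> P (nat x) (nat y)")
    case True
    then have x: "int (nat x) = x" "int (nat y) = y" "P (nat x) (nat y)" by (auto simp: pairs_ix_n)
    show ?thesis
      by (subst sum_eq_single[OF fin, where a = "(nat x, nat y)"]) (use x True in \<open>auto split: prod.splits\<close>)
  next
    case False
    then show ?thesis using assms by (auto simp: pairs_ix_n intro!: sum.neutral)
  qed
  finally show "entry (\<Sum>(i, j) \<in> {(i, j). P i j}. mat_unit i i \<otimes> mat_unit j j :: ('a, 'n) tmat) x y z w =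
    (if x = z \<and> y = w \<and> (x, y) \<in> pairs_ix \<and> P (nat x) (nat y) then 1 else 0)" .
  have "entry (\<Sum>(i, j) \<in> {(i, j). P i j}. mat_unit i j \<otimes> mat_unit j i :: ('a, 'n) tmat) x y z w =
    (\<Sum>(i, j)\<in>{(i, j). P i j}. if x = int i \<and> y = int j \<and> z = int j \<and> w = int i then 1 else 0)"
    unfolding entry_sum by (intro sum.cong refl) (use assms in \<open>auto simp: entry_units\<close>)
  also have "\<dots> = (if x = w \<and> y = z \<and> (x, y) \<in> pairs_ix \<and> P (nat x) (nat y) then 1 else 0)"
  proof (cases "(x, y) \<in> pairs_ix \<and> P (nat x) (nat y)")
    case True
    then have x: "int (nat x) = x" "int (nat y) = y" "P (nat x) (nat y)" by (auto simp: pairs_ix_n)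
    show ?thesis
      by (subst sum_eq_single[OF fin, where a = "(nat x, nat y)"]) (use x True in \<open>auto split: prod.splits\<close>)
  next
    case False
    then show ?thesis using assms by (auto simp: pairs_ix_n intro!: sum.neutral)
  qed
  finally show "entry (\<Sum>(i, j) \<in> {(i, j). P i j}. mat_unit i j \<otimes> mat_unit j i :: ('a, 'n) tmat) x y z w =
    (if x = w \<and> y = z \<and> (x, y) \<in> pairs_ix \<and> P (nat x) (nat y) then 1 else 0)" .
qed

lemma R_st_Rmat: "R_st = Rmat"
proof (rule mat_eqI)
  fix x y z w assume I: "(x, y) \<in> pairs_ix" "(z, w) \<in> pairs_ix"
  have "int CARD('n) \<ge> 2" using n2 by simp
  note R = entry_Rmat[OF this]
  note 1 = entry_pair_units(1)[of "\<lambda>i j. i \<in> {1..CARD('n)} \<and> j \<in> {1..CARD('n)} \<and> i \<noteq> j", where 'a = "complex fps"]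
  note 2 = entry_pair_units(2)[of "\<lambda>i j. i \<in> {1..CARD('n)} \<and> j \<in> {1..CARD('n)} \<and> i > j", where 'a = "complex fps"]
  have "entry R_st x y z w = q * (if x = y \<and> x = z \<and> x = w \<and> (x, y) \<in> pairs_ix then 1 else 0)
    + (if x = z \<and> y = w \<and> (x, y) \<in> pairs_ix \<and> nat x \<in> {1..CARD('n)} \<and> nat y \<in> {1..CARD('n)} \<and> nat x \<noteq> nat y then 1 else 0)
    + hq * (if x = w \<and> y = z \<and> (x, y) \<in> pairs_ix \<and> nat x \<in> {1..CARD('n)} \<and> nat y \<in> {1..CARD('n)} \<and> nat x > nat y then 1 else 0)"
    unfolding R_st_def entry_add entry_scale entry_diag_units using 1 2 by simp
  also have "\<dots> = entry Rmat x y z w" 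
  proof -
    have n: "nat x \<in> {1..CARD('n)}" "nat y \<in> {1..CARD('n)}" "nat x = nat y \<longleftrightarrow> x = y" "nat y < nat x \<longleftrightarrow> y < x"
      using I(1) by (auto simp: pairs_ix_n)
    consider "x = y" | "x \<noteq> y" "x = z" "y = w" | "x \<noteq> y" "x = w" "y = z" | "x \<noteq> y" "\<not> (x = z \<and> y = w)" "\<not> (x = w \<and> y = z)"
      by blast
    then show ?thesis unfolding R n(3,4) using n(1,2) I(1) by cases (auto simp del: atLeastAtMost_iff)
  qed
  finally show "entry R_st x y z w = entry Rmat x y z w" .
qed

end

section \<open>Expansion modulo \<open>\<hbar>\<^sup>3\<close>\<close>

text \<open>The coefficient of \<open>\<hbar>\<^sup>i\<close> of a matrix of power series.\<close>

definition hcoeff :: "nat \<Rightarrow> complex fps ^ 'm::finite ^ 'm \<Rightarrow> complex ^ 'm ^ 'm" where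
  "hcoeff i A = (\<chi> r c. fps_nth (A $ r $ c) i)"

lemma hcoeff_add: "hcoeff i (A + B) = hcoeff i A + hcoeff i B"
  by (simp add: hcoeff_def vec_eq_iff)

lemma hcoeff_mult: "hcoeff i (A ** B) = (\<Sum>j\<le>i. hcoeff j A ** hcoeff (i - j) B)"
proof -
  have "fps_nth (\<Sum>k\<in>UNIV. A $ r $ k * B $ k $ c) i = (\<Sum>j\<le>i. \<Sum>k\<in>UNIV. fps_nth (A $ r $ k) j * fps_nth (B $ k $ c) (i - j))" for r c
    unfolding fps_sum_nth fps_mult_nth by (subst sum.swap) (simp add: atLeast0AtMost)
  then show ?thesis by (simp add: hcoeff_def matrix_matrix_mult_def vec_eq_iff)
qed

lemma hcoeff_mult_0: "hcoeff 0 (A ** B) = hcoeff 0 A ** hcoeff 0 B"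
  and hcoeff_mult_1: "hcoeff 1 (A ** B) = hcoeff 0 A ** hcoeff 1 B + hcoeff 1 A ** hcoeff 0 B"
  and hcoeff_mult_2: "hcoeff 2 (A ** B) = hcoeff 0 A ** hcoeff 2 B + hcoeff 1 A ** hcoeff 1 B + hcoeff 2 A ** hcoeff 0 B"
  by (simp_all add: hcoeff_mult numeral_2_eq_2)

lemma hcoeff_one: "hcoeff i (mat 1) = (if i = 0 then mat 1 else 0)"
  by (simp add: hcoeff_def mat_def vec_eq_iff fps_one_nth)

lemma hcoeff_flip: "hcoeff i (flip A) = flip (hcoeff i A)"
  by (simp add: hcoeff_def flip_def vec_eq_iff)

lemma fps_X_cube_dvd: "fps_X ^ 3 dvd (f :: complex fps) \<longleftrightarrow> (\<forall>i<3. fps_nth f i = 0)"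
proof
  assume "fps_X ^ 3 dvd f"
  then obtain h where "f = fps_X ^ 3 * h" by (elim dvdE)
  then show "\<forall>i<3. fps_nth f i = 0" by (simp add: fps_X_power_mult_nth)
next
  assume a: "\<forall>i<3. fps_nth f i = 0"
  have "f = fps_X ^ 3 * fps_shift 3 f"
    using a by (intro fps_ext) (simp add: fps_X_power_mult_nth)
  then show "fps_X ^ 3 dvd f" by (rule dvdI)
qed

lemma expansion_iff:
  fixes r :: "complex ^ 'm::finite ^ 'm"
  shows "(\<forall>u v. fps_X ^ 3 dvd (R - (mat 1 + (2 * fps_X) *\<^sub>m to_fps r + (2 * fps_X ^ 2) *\<^sub>m to_fps (r ** r))) $ u $ v) \<longleftrightarrow>
    hcoeff 0 R = mat 1 \<and> hcoeff 1 R = r + r \<and> hcoeff 2 R = r ** r + r ** r"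
proof -
  have 2: "(2 :: complex fps) = fps_const 2" by (simp add: numeral_fps_const)
  have c: "fps_nth ((mat 1 + (2 * fps_X) *\<^sub>m to_fps r + (2 * fps_X ^ 2) *\<^sub>m to_fps (r ** r)) $ u $ v) i =
    (if i = 0 then mat 1 else if i = 1 then r + r else if i = 2 then r ** r + r ** r else 0) $ u $ v" for u v i
    by (auto simp: mscale_def to_fps_def 2 mult.assoc mat_def fps_X_power_nth fps_one_nth)
  have "(\<forall>u v. fps_X ^ 3 dvd (R - (mat 1 + (2 * fps_X) *\<^sub>m to_fps r + (2 * fps_X ^ 2) *\<^sub>m to_fps (r ** r))) $ u $ v) \<longleftrightarrow>
    (\<forall>u v. \<forall>i<3. hcoeff i R $ u $ v = (if i = 0 then mat 1 else if i = 1 then r + r else if i = 2 then r ** r + r ** r else 0) $ u $ v)"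
    unfolding fps_X_cube_dvd vector_minus_component fps_sub_nth c by (simp add: hcoeff_def)
  also have "\<dots> \<longleftrightarrow> (\<forall>i<3. hcoeff i R = (if i = 0 then mat 1 else if i = 1 then r + r else if i = 2 then r ** r + r ** r else 0))"
    unfolding vec_eq_iff by blast
  finally show ?thesis by (simp add: eval_nat_numeral All_less_Suc conj_ac)
qed

lemma matrix_inv_right:
  assumes "\<exists>I. A ** I = mat 1 \<and> I ** A = mat 1"
  shows "A ** matrix_inv A = mat 1"
  using someI_ex[OF assms] unfolding matrix_inv_def by blast

context bd_setup
begin

lemma entry_hcoeff: "entry (hcoeff i A) x y z w = fps_nth (entry A x y z w) i"
  by (simp add: entry_def hcoeff_def)

lemma nth_hq: "fps_nth hq 0 = 0" "fps_nth hq 1 = 2" "fps_nth hq 2 = 0"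
  unfolding qi_qpow by (simp_all add: q_qpow qpow_def)

text \<open>
  The terms of \<open>a\<close> in \<open>e\<^sub>\<beta> \<otimes> e\<^sub>-\<^sub>\<alpha>\<close>, with the opposite sign. They are half the coefficient of
  \<open>\<hbar>\<close> in \<open>J\<close> (\<open>hcoeff_J_prod\<close>).
\<close>

definition a_half :: "(complex, 'n) tmat" where
  "a_half = (\<Sum>(\<alpha>, \<beta>) | prec T \<Gamma>1 \<alpha> \<beta>.
     (-1) ^ (orient_C T \<Gamma>1 \<alpha> \<beta> * (root_len \<alpha> - 1)) *\<^sub>m (root_mat \<beta> \<otimes> root_mat (- \<alpha>)))"

lemma a_cl_half: "a_cl T \<Gamma>1 = flip a_half - a_half"
proof -
  have t: "c *\<^sub>m (A \<otimes> B - B \<otimes> A) = flip (c *\<^sub>m (B \<otimes> A)) - c *\<^sub>m (B \<otimes> A)" for c and A B :: "complex ^ 'n ^ 'n"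
    by (simp add: mscale_def flip_def tensor_def vec_eq_iff algebra_simps)
  show ?thesis
    unfolding a_cl_def a_half_def flip_sum sum_subtractf[symmetric]
    by (intro sum.cong refl) (auto simp: t)
qed

lemma prec_tpair: "prec T \<Gamma>1 \<alpha> \<beta> \<longleftrightarrow> (\<exists>k\<in>{1..}. maps_to T \<Gamma>1 k \<alpha> \<beta>)"
  by (auto simp: prec_def)

lemma hcoeff_J_factor:
  assumes "1 \<le> k"
  shows "hcoeff 0 (J_factor T \<Gamma>1 k) = mat 1"
    and "entry (hcoeff 1 (J_factor T \<Gamma>1 k)) x y z w = (if tpair k w y x z
      then 2 * (-1) ^ (orient_C T \<Gamma>1 (rt w y) (rt x z) * (root_len (rt w y :: 'n cvec) - 1)) else 0)"
proof -
  have e: "entry (J_factor T \<Gamma>1 k) x y z w = (if x = z \<and> y = w \<and> (x, y) \<in> pairs_ix then 1 else 0) +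
    (if tpair k w y x z then ((- q) powi (- int (orient_C T \<Gamma>1 (rt w y) (rt x z) * (root_len (rt w y :: 'n cvec) - 1)))
    * qpow (P_a T \<Gamma>1 (rt x z, - rt w y))) * hq else 0)" for x y z w
    unfolding J_factor_def entry_add entry_one
    by (subst entry_pair_sum[where A = "{k}"]) (use finite_maps_to[of "{k}"] in auto)
  have n0: "fps_nth ((- q) powi (- int n)) 0 = (- 1) ^ n" for n
  proof -
    have "(- q) powi (- int n) = (- inverse q) ^ n"
      by (simp add: power_int_def power_inverse[symmetric] fps_inverse_minus)
    also have "- inverse q = fps_const (- 1) * qpow (- 1)"
      unfolding qi_qpow by (simp add: fps_const_neg[symmetric] del: fps_const_neg)
    finally have "(- q) powi (- int n) = fps_const ((- 1) ^ n) * qpow (- 1) ^ n" 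
      by (simp add: power_mult_distrib fps_const_power)
    then show ?thesis by (simp add: qpow_power) (simp add: qpow_def)
  qed
  have nq: "fps_nth (qpow y) 0 = 1" for y by (simp add: qpow_def)
  have f0: "fps_nth (f * hq) 0 = 0" "fps_nth (f * hq) 1 = 2 * fps_nth f 0" for f
    using nth_hq by (simp_all add: fps_mult_nth)
  show "hcoeff 0 (J_factor T \<Gamma>1 k) = mat 1"
    by (rule mat_eqI) (simp add: entry_hcoeff e f0 entry_one del: fps_mult_nth_0)
  show "entry (hcoeff 1 (J_factor T \<Gamma>1 k)) x y z w = (if tpair k w y x z
      then 2 * (-1) ^ (orient_C T \<Gamma>1 (rt w y) (rt x z) * (root_len (rt w y :: 'n cvec) - 1)) else 0)"
  proof (cases "tpair k w y x z")
    case True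
    then have "\<not> (x = z \<and> y = w)" by (auto simp: tpair_def)
    then show ?thesis using True unfolding entry_hcoeff e by (simp add: f0 n0 nq del: One_nat_def of_nat_mult)
  next
    case False
    then show ?thesis unfolding entry_hcoeff e by simp
  qed
qed

lemma hcoeff_J_foldr:
  assumes "\<And>k. k \<in> set ks \<Longrightarrow> 1 \<le> k"
  shows "hcoeff 0 (foldr (\<lambda>k X. J_factor T \<Gamma>1 k ** X) ks (mat 1)) = mat 1"
    and "hcoeff 1 (foldr (\<lambda>k X. J_factor T \<Gamma>1 k ** X) ks (mat 1)) = (\<Sum>k\<leftarrow>ks. hcoeff 1 (J_factor T \<Gamma>1 k))"
  using assms
proof (induction ks)
  case Nil
  { case 1 show ?case by (simp add: hcoeff_one) next case 2 show ?case by (simp add: hcoeff_one) }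
next
  case (Cons k ks)
  { case 1 then show ?case using Cons.IH(1) by (simp add: hcoeff_mult_0 hcoeff_J_factor(1))
  next case 2 then show ?case using Cons.IH by (simp add: hcoeff_mult_1 hcoeff_J_factor(1) add.commute del: One_nat_def) }
qed

text \<open>
  The factors \<open>J\<^sub>k\<close> contribute the pairs of order \<open>k\<close>, and every pair has exactly one order, so the sum
  over \<open>k\<close> is the sum over all pairs.
\<close>

lemma hcoeff_J_prod:
  "hcoeff 0 (J_prod T \<Gamma>1) = mat 1" "hcoeff 1 (J_prod T \<Gamma>1) = a_half + a_half"
proof -
  let ?m = "max_ord T \<Gamma>1"
  have ks: "k \<in> set [1..<Suc ?m] \<Longrightarrow> 1 \<le> k" for k by auto
  show "hcoeff 0 (J_prod T \<Gamma>1) = mat 1" unfolding J_prod_def by (rule hcoeff_J_foldr(1)) (rule ks)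
  have "hcoeff 1 (J_prod T \<Gamma>1) = (\<Sum>k\<leftarrow>[1..<Suc ?m]. hcoeff 1 (J_factor T \<Gamma>1 k))"
    unfolding J_prod_def by (rule hcoeff_J_foldr(2)) (rule ks)
  then have J1: "hcoeff 1 (J_prod T \<Gamma>1) = (\<Sum>k\<in>{1..?m}. hcoeff 1 (J_factor T \<Gamma>1 k))"
    by (simp add: sum_list_distinct_conv_sum_set atLeastLessThanSuc_atLeastAtMost del: upt_Suc)
  show "hcoeff 1 (J_prod T \<Gamma>1) = a_half + a_half"
  proof (rule mat_eqI)
    fix x y z w
    let ?c = "(-1 :: complex) ^ (orient_C T \<Gamma>1 (rt w y) (rt x z) * (root_len (rt w y :: 'n cvec) - 1))"
    have h: "entry a_half x y z w = (if \<exists>k\<in>{1..}. tpair k w y x z then ?c else 0)"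
      unfolding a_half_def
      by (rule entry_pair_sum) (use prec_tpair finite_maps_to[of "{1..}"] in auto)
    have "entry (hcoeff 1 (J_prod T \<Gamma>1)) x y z w = (\<Sum>k\<in>{1..?m}. if tpair k w y x z then 2 * ?c else 0)"
      unfolding J1 entry_sum by (intro sum.cong refl hcoeff_J_factor(2)) auto
    also have "\<dots> = 2 * (if \<exists>k\<in>{1..}. tpair k w y x z then ?c else 0)"
    proof (cases "\<exists>k\<in>{1..}. tpair k w y x z")
      case True
      then obtain k where k: "1 \<le> k" "tpair k w y x z" by auto
      have "(\<Sum>k\<in>{1..?m}. if tpair k w y x z then 2 * ?c else 0) = (if tpair k w y x z then 2 * ?c else 0)"
        by (rule sum_eq_single) (use k tpair_order_unique tpair_le_max_ord[OF k(2,1)] in auto)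
      then show ?thesis using k True by simp
    next
      case False
      then have "(\<Sum>k\<in>{1..?m}. if tpair k w y x z then 2 * ?c else 0) = 0" by (intro sum.neutral) auto
      then show ?thesis using False by simp
    qed
    finally show "entry (hcoeff 1 (J_prod T \<Gamma>1)) x y z w = entry (a_half + a_half) x y z w"
      unfolding entry_add h by simp
  qed
qed

lemma entry_r_st: "entry r_st x y z w = (if x = y \<and> x = z \<and> x = w \<and> (x, y) \<in> pairs_ix then 1 / 2
    else if z < x \<and> y = z \<and> w = x \<and> (x, y) \<in> pairs_ix then 1 else 0)"
proof -
  have pr: "\<alpha> \<in> pos_roots_in (simple_roots :: 'n cvec set) \<longleftrightarrow> (\<exists>i j. 1 \<le> i \<and> i < j \<and> j \<le> int CARD('n) \<and> \<alpha> = rt i j)" for \<alpha>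
  proof -
    have "\<forall>e\<in>{i..<j}. (sr e :: 'n cvec) \<in> simple_roots" if "1 \<le> i" "j \<le> int CARD('n)" for i j
      using that by (auto simp: simple_roots_sr)
    then show ?thesis unfolding pos_roots_rt[OF order_refl] by blast
  qed
  have fin: "finite (pos_roots_in (simple_roots :: 'n cvec set))"
  proof (rule finite_subset[OF _ finite_roots], rule subsetI)
    fix \<alpha> assume "\<alpha> \<in> pos_roots_in (simple_roots :: 'n cvec set)"
    then obtain i j where "1 \<le> i" "i < j" "j \<le> int CARD('n)" "\<alpha> = rt i j" unfolding pr by blast
    then show "\<alpha> \<in> {rt i j | i j. (i, j) \<in> pairs_ix}" by (intro CollectI exI[of _ i] exI[of _ j]) (simp add: pairs_ix_n)
  qed
  have t: "entry (root_mat (- \<alpha>) \<otimes> root_mat \<alpha> :: (complex, 'n) tmat) x y z w =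
    (if \<alpha> = rt z x \<and> z < x \<and> y = z \<and> w = x \<and> (x, y) \<in> pairs_ix then 1 else 0)" if al: "\<alpha> \<in> pos_roots_in simple_roots" for \<alpha>
  proof -
    obtain i j where ij: "1 \<le> i" "i < j" "j \<le> int CARD('n)" "\<alpha> = rt i j" using al unfolding pr by blast
    have r: "i \<in> {1..int CARD('n)}" "j \<in> {1..int CARD('n)}" "i \<noteq> j" using ij by auto
    have e: "entry (root_mat (- \<alpha>) \<otimes> root_mat \<alpha> :: (complex, 'n) tmat) x y z w = (if x = j \<and> y = i \<and> z = i \<and> w = j then 1 else 0)"
      unfolding ij(4) root_mat_rt[OF r] root_mat_minus_rt[OF r] by (subst entry_units) (use r in auto)
    have "(x = j \<and> y = i \<and> z = i \<and> w = j) = (\<alpha> = rt z x \<and> z < x \<and> y = z \<and> w = x \<and> (x, y) \<in> pairs_ix)"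
    proof
      assume "x = j \<and> y = i \<and> z = i \<and> w = j"
      then show "\<alpha> = rt z x \<and> z < x \<and> y = z \<and> w = x \<and> (x, y) \<in> pairs_ix" using ij r by (simp add: pairs_ix_n)
    next
      assume a: "\<alpha> = rt z x \<and> z < x \<and> y = z \<and> w = x \<and> (x, y) \<in> pairs_ix"
      then have eq: "(rt z x :: 'n cvec) = rt i j" using ij(4) by simp
      have "z = i \<and> x = j" by (rule rt_inj[OF _ _ _ r eq]) (use a in \<open>auto simp: pairs_ix_n\<close>)
      then show "x = j \<and> y = i \<and> z = i \<and> w = j" using a by simp
    qed
    then show ?thesis unfolding e by (simp only:)
  qed
  have "entry (\<Sum>\<alpha>\<in>pos_roots_in simple_roots. root_mat (- \<alpha>) \<otimes> root_mat \<alpha> :: (complex, 'n) tmat) x y z w =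
    (\<Sum>\<alpha>\<in>pos_roots_in (simple_roots :: 'n cvec set). if \<alpha> = rt z x \<and> z < x \<and> y = z \<and> w = x \<and> (x, y) \<in> pairs_ix then 1 else 0)"
    unfolding entry_sum by (intro sum.cong refl t)
  also have "\<dots> = (if z < x \<and> y = z \<and> w = x \<and> (x, y) \<in> pairs_ix then 1 else 0)"
    by (subst sum_eq_single[OF fin, where a = "rt z x"]) (auto simp: pr pairs_ix_n)
  finally show ?thesis unfolding r_st_def entry_add entry_scale entry_diag_units by auto
qed

lemma hcoeff_Rmat: "hcoeff 0 Rmat = mat 1" "hcoeff 1 Rmat = r_st + r_st"
proof -
  have "int CARD('n) \<ge> 2" using n2 by simp
  note R = entry_Rmat[OF this]
  have n: "fps_nth q 0 = 1" "fps_nth q (Suc 0) = 1" "fps_nth hq 0 = 0" "fps_nth (inverse q) (Suc 0) = - 1"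
    unfolding qi_qpow by (simp_all add: q_qpow qpow_def)
  show "hcoeff 0 Rmat = mat 1" by (rule mat_eqI) (auto simp: entry_hcoeff R n(1,3) entry_one)
  show "hcoeff 1 Rmat = r_st + r_st"
    by (rule mat_eqI, unfold entry_add entry_hcoeff R entry_r_st) (auto simp: n fps_one_nth)
qed

text \<open>
  Orders \<open>0\<close> and \<open>1\<close> follow from \<open>J X = R\<^sub>s\<^sub>t J\<^sup>2\<^sup>1\<close>. At order \<open>2\<close> the quadratic relation of
  \<open>twisted_matrix_properties\<close> determines the symmetric part of the coefficient, and the coefficient is
  symmetric.
\<close>

theorem twisted_matrix_expansion:
  defines "X \<equiv> matrix_inv (J_prod T \<Gamma>1) ** R_st ** flip (J_prod T \<Gamma>1)"
    and "\<rho> \<equiv> a_cl T \<Gamma>1 + r_st"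
  shows "GGS_form (entry X x y z w)"
    and "hcoeff 0 X = mat 1" "hcoeff 1 X = \<rho> + \<rho>" "hcoeff 2 X = \<rho> ** \<rho> + \<rho> ** \<rho>"
proof -
  let ?J = "J_prod T \<Gamma>1"
  have N: "int CARD('n) \<ge> 2" using n2 by simp
  have inv: "\<exists>I. ?J ** I = mat 1 \<and> I ** ?J = mat 1"
    unfolding J_prod_flip by (rule Jlevs_invertible)
  have JX: "?J ** X = Rmat ** flip ?J"
    unfolding X_def by (simp add: matrix_mul_assoc matrix_inv_right[OF inv] R_st_Rmat)
  note cm = twisted_matrix_properties[OF N Tmat_beyond_max_ord J_prod_flip JX]
  show "GGS_form (entry X x y z w)" by (rule cm(1))
  show X0: "hcoeff 0 X = mat 1"
    using arg_cong[OF JX, of "hcoeff 0"] by (simp add: hcoeff_mult_0 hcoeff_J_prod hcoeff_Rmat hcoeff_flip flip_one)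
  have "hcoeff 1 X + (a_half + a_half) = flip (a_half + a_half) + (r_st + r_st)"
    using arg_cong[OF JX, of "hcoeff 1"] by (simp add: hcoeff_mult_1 hcoeff_J_prod hcoeff_Rmat hcoeff_flip flip_one X0 del: One_nat_def)
  moreover have "flip (a_half + a_half) = flip a_half + flip a_half" by (simp add: flip_def vec_eq_iff)
  ultimately show X1: "hcoeff 1 X = \<rho> + \<rho>"
    unfolding \<rho>_def a_cl_half by (simp add: algebra_simps eq_diff_eq)
  have hflip: "hcoeff 0 hflip = 0" "hcoeff 2 hflip = 0"
    by (rule mat_eqI, use nth_hq in \<open>simp add: entry_hcoeff entry_hflip entry_zero\<close>)+
  have sym: "flip (hcoeff 2 X) = hcoeff 2 X"
    by (rule mat_eqI) (simp add: entry_flip entry_hcoeff cm(2))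
  have "flip (hcoeff 1 X) + hcoeff 1 X = hcoeff 1 hflip"
    using arg_cong[OF cm(3), of "hcoeff 1"] by (simp add: hcoeff_mult_1 hcoeff_add hcoeff_flip hcoeff_one X0 hflip flip_one add.commute del: One_nat_def)
  then have P1: "hcoeff 1 hflip = flip (hcoeff 1 X) + hcoeff 1 X" by simp
  have "hcoeff 2 X + flip (hcoeff 1 X) ** hcoeff 1 X + flip (hcoeff 2 X) = hcoeff 1 hflip ** hcoeff 1 X"
    using arg_cong[OF cm(3), of "hcoeff 2"] by (simp add: hcoeff_mult_2 hcoeff_add hcoeff_flip hcoeff_one X0 hflip flip_one del: One_nat_def)
  then have "hcoeff 2 X + hcoeff 2 X = hcoeff 1 X ** hcoeff 1 X"
    unfolding P1 sym by (simp add: matrix_add_rdistrib algebra_simps)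
  then have "hcoeff 2 X + hcoeff 2 X = (\<rho> ** \<rho> + \<rho> ** \<rho>) + (\<rho> ** \<rho> + \<rho> ** \<rho>)"
    unfolding X1 by (simp only: matrix_add_ldistrib matrix_add_rdistrib add.assoc)
  moreover have dbl: "A = B" if "A + A = B + B" for A B :: "(complex, 'n) tmat"
    using that by (simp add: vec_eq_iff)
  ultimately show "hcoeff 2 X = \<rho> ** \<rho> + \<rho> ** \<rho>" by blast
qed

section \<open>Comparison with the GGS matrix\<close>


lemma hh_diagonal:
  assumes "s \<in> hh"
  obtains c where "s = dmat c"
proof -
  obtain c where s: "s = (\<Sum>i=1..CARD('n). \<Sum>j=1..CARD('n). c i j *\<^sub>m (mat_unit i i \<otimes> mat_unit j j))"
    using assms unfolding hh_def by blast
  have "s = dmat (\<lambda>x y. c (nat x) (nat y))"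
  proof (rule mat_eqI)
    fix x y z w assume I: "(x, y) \<in> pairs_ix" "(z, w) \<in> pairs_ix"
    have n: "nat x \<in> {1..CARD('n)}" "nat y \<in> {1..CARD('n)}" "int (nat x) = x" "int (nat y) = y"
      using I(1) by (auto simp: pairs_ix_n)
    have "entry s x y z w = (\<Sum>i=1..CARD('n). \<Sum>j=1..CARD('n). c i j * (if x = int i \<and> y = int j \<and> z = int i \<and> w = int j then 1 else 0))"
      unfolding s entry_sum entry_scale by (intro sum.cong refl) (simp add: entry_units)
    also have "\<dots> = (\<Sum>j=1..CARD('n). c (nat x) j * (if x = int (nat x) \<and> y = int j \<and> z = int (nat x) \<and> w = int j then 1 else 0))"
      by (rule sum_eq_single) (use n in \<open>auto intro!: sum.neutral\<close>)
    also have "\<dots> = c (nat x) (nat y) * (if x = int (nat x) \<and> y = int (nat y) \<and> z = int (nat x) \<and> w = int (nat y) then 1 else 0)"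
      by (rule sum_eq_single) (use n in auto)
    also have "\<dots> = entry (dmat (\<lambda>x y. c (nat x) (nat y))) x y z w"
      using n(3,4) I by (simp add: entry_dmat)
    finally show "entry s x y z w = entry (dmat (\<lambda>x y. c (nat x) (nat y))) x y z w" .
  qed
  then show ?thesis by (rule that)
qed

lemma mpow_dmat: "mpow (dmat c) m = dmat (\<lambda>x y. (c x y :: complex) ^ m)"
  by (induction m) (simp_all add: dmat_one[symmetric] dmat_mult)

lemma q_pow_mat_dmat: "q_pow_mat (dmat c) = dmat (\<lambda>x y. qpow (c x y))"
proof (rule mat_eqI)
  fix x y z w assume "(x, y) \<in> pairs_ix" "(z, w) \<in> pairs_ix"
  then have "entry (q_pow_mat (dmat c)) x y z w = Abs_fps (\<lambda>m. entry (mpow (dmat c) m) x y z w / fact m)"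
    by (simp add: q_pow_mat_def entry_def)
  also have "\<dots> = entry (dmat (\<lambda>x y. qpow (c x y))) x y z w"
    unfolding mpow_dmat entry_dmat by (auto simp: qpow_def fps_exp_def fps_eq_iff)
  finally show "entry (q_pow_mat (dmat c)) x y z w = entry (dmat (\<lambda>x y. qpow (c x y))) x y z w" .
qed

lemma hcoeff_q_pow_mat:
  "hcoeff 0 (q_pow_mat (dmat c)) = mat 1" "hcoeff 1 (q_pow_mat (dmat c)) = dmat c"
  "hcoeff 2 (q_pow_mat (dmat c)) + hcoeff 2 (q_pow_mat (dmat c)) = dmat c ** dmat c"
  unfolding q_pow_mat_dmat dmat_mult
  by (rule mat_eqI; unfold entry_add entry_hcoeff entry_dmat; simp add: entry_one qpow_def power2_eq_square)+

lemma R_J_expansion: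
  assumes "s \<in> hh"
  shows "GGS_form (entry (R_J T \<Gamma>1 s) x y z w)"
    and "hcoeff 0 (R_J T \<Gamma>1 s) = mat 1"
    and "hcoeff 1 (R_J T \<Gamma>1 s) = r_cl T \<Gamma>1 s + r_cl T \<Gamma>1 s"
    and "hcoeff 2 (R_J T \<Gamma>1 s) = r_cl T \<Gamma>1 s ** r_cl T \<Gamma>1 s + r_cl T \<Gamma>1 s ** r_cl T \<Gamma>1 s"
proof -
  obtain c where s: "s = dmat c" using hh_diagonal[OF assms] .
  define X where "X = matrix_inv (J_prod T \<Gamma>1) ** R_st ** flip (J_prod T \<Gamma>1)"
  define \<rho> where "\<rho> = a_cl T \<Gamma>1 + r_st"
  note X = twisted_matrix_expansion[folded X_def \<rho>_def]
  have R: "R_J T \<Gamma>1 s = q_pow_mat s ** X ** q_pow_mat s"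
    by (simp add: R_J_def X_def matrix_mul_assoc)
  have r: "r_cl T \<Gamma>1 s = s + \<rho>" by (simp add: r_cl_def \<rho>_def add.assoc)
  note Q = hcoeff_q_pow_mat[of c, folded s]
  show "GGS_form (entry (R_J T \<Gamma>1 s) x y z w)"
    unfolding R unfolding s q_pow_mat_dmat entry_dmat_left entry_dmat_right
    by (intro GGS_mult_qpow' GGS_mult_qpow X(1))
  show "hcoeff 0 (R_J T \<Gamma>1 s) = mat 1" unfolding R by (simp add: hcoeff_mult_0 Q X)
  show "hcoeff 1 (R_J T \<Gamma>1 s) = r_cl T \<Gamma>1 s + r_cl T \<Gamma>1 s"
    unfolding R r hcoeff_mult_1 hcoeff_mult_0 Q X by (simp only: matrix_mul_lid matrix_mul_rid ac_simps)
  have "hcoeff 2 (R_J T \<Gamma>1 s) = (hcoeff 2 (q_pow_mat s) + hcoeff 2 (q_pow_mat s)) + hcoeff 2 X + s ** hcoeff 1 X + (s + hcoeff 1 X) ** s"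
    unfolding R hcoeff_mult_2 hcoeff_mult_1 hcoeff_mult_0 Q(1,2) X(2)
    by (simp only: matrix_mul_lid matrix_mul_rid ac_simps)
  also have "\<dots> = r_cl T \<Gamma>1 s ** r_cl T \<Gamma>1 s + r_cl T \<Gamma>1 s ** r_cl T \<Gamma>1 s"
    unfolding Q(3)[folded s] X(3,4) r s[symmetric]
    by (simp only: matrix_add_ldistrib matrix_add_rdistrib ac_simps)
  finally show "hcoeff 2 (R_J T \<Gamma>1 s) = r_cl T \<Gamma>1 s ** r_cl T \<Gamma>1 s + r_cl T \<Gamma>1 s ** r_cl T \<Gamma>1 s" .
qed

lemma entry_all_units:
  fixes P :: "nat \<Rightarrow> nat \<Rightarrow> nat \<Rightarrow> nat \<Rightarrow> complex fps"
  assumes I: "(x, y) \<in> pairs_ix" "(z, w) \<in> pairs_ix"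
  shows "entry (\<Sum>i=1..CARD('n). \<Sum>j=1..CARD('n). \<Sum>k=1..CARD('n). \<Sum>l=1..CARD('n).
    P i j k l *\<^sub>m (mat_unit i j \<otimes> mat_unit k l)) x y z w = P (nat x) (nat z) (nat y) (nat w)"
proof -
  have n: "nat x \<in> {1..CARD('n)}" "nat y \<in> {1..CARD('n)}" "nat z \<in> {1..CARD('n)}" "nat w \<in> {1..CARD('n)}"
    "int (nat x) = x" "int (nat y) = y" "int (nat z) = z" "int (nat w) = w"
    using I by (auto simp: pairs_ix_n)
  let ?f = "\<lambda>i j k l. P i j k l * (if x = int i \<and> y = int k \<and> z = int j \<and> w = int l then 1 else 0)"
  have "entry (\<Sum>i=1..CARD('n). \<Sum>j=1..CARD('n). \<Sum>k=1..CARD('n). \<Sum>l=1..CARD('n).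
    P i j k l *\<^sub>m (mat_unit i j \<otimes> mat_unit k l)) x y z w =
    (\<Sum>i=1..CARD('n). \<Sum>j=1..CARD('n). \<Sum>k=1..CARD('n). \<Sum>l=1..CARD('n). ?f i j k l)"
    unfolding entry_sum entry_scale by (intro sum.cong refl) (simp add: entry_units)
  also have "\<dots> = (\<Sum>j=1..CARD('n). \<Sum>k=1..CARD('n). \<Sum>l=1..CARD('n). ?f (nat x) j k l)"
    by (rule sum_eq_single) (use n in \<open>auto intro!: sum.neutral\<close>)
  also have "\<dots> = (\<Sum>k=1..CARD('n). \<Sum>l=1..CARD('n). ?f (nat x) (nat z) k l)"
    by (rule sum_eq_single) (use n in \<open>auto intro!: sum.neutral\<close>)
  also have "\<dots> = (\<Sum>l=1..CARD('n). ?f (nat x) (nat z) (nat y) l)"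
    by (rule sum_eq_single) (use n in \<open>auto intro!: sum.neutral\<close>)
  also have "\<dots> = ?f (nat x) (nat z) (nat y) (nat w)"
    by (rule sum_eq_single) (use n in auto)
  finally show ?thesis using n(5-8) by simp
qed

text \<open>
  Entries of the form \<open>x q\<^sup>y (q - q\<^sup>-\<^sup>1)\<^sup>z\<close> are determined modulo \<open>\<hbar>\<^sup>3\<close>, so a matrix with such entries
  and the right expansion is the one described by \<open>R_GGS\<close>.
\<close>

lemma R_GGS_eqI:
  assumes form: "\<And>x y z w. GGS_form (entry Y x y z w)"
    and Y: "hcoeff 0 Y = mat 1" "hcoeff 1 Y = r + r" "hcoeff 2 Y = r ** r + r ** r"
  shows "R_GGS r = Y"
  unfolding R_GGS_def
proof (rule the_equality)
  define P where "P = (\<lambda>i j k l. entry Y (int i) (int k) (int j) (int l))"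
  have "Y = (\<Sum>i=1..CARD('n). \<Sum>j=1..CARD('n). \<Sum>k=1..CARD('n). \<Sum>l=1..CARD('n).
    P i j k l *\<^sub>m (mat_unit i j \<otimes> mat_unit k l))"
  proof (rule mat_eqI)
    fix x y z w assume I: "(x, y) \<in> pairs_ix" "(z, w) \<in> pairs_ix"
    then show "entry Y x y z w = entry (\<Sum>i=1..CARD('n). \<Sum>j=1..CARD('n). \<Sum>k=1..CARD('n). \<Sum>l=1..CARD('n).
      P i j k l *\<^sub>m (mat_unit i j \<otimes> mat_unit k l)) x y z w"
      unfolding entry_all_units[OF I] by (simp add: P_def pairs_ix_n)
  qed
  moreover have "\<forall>i\<in>{1..CARD('n)}. \<forall>j\<in>{1..CARD('n)}. \<forall>k\<in>{1..CARD('n)}. \<forall>l\<in>{1..CARD('n)}. GGS_form (P i j k l)"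
    unfolding P_def using form by blast
  ultimately show "(\<exists>P. (\<forall>i\<in>{1..CARD('n)}. \<forall>j\<in>{1..CARD('n)}. \<forall>k\<in>{1..CARD('n)}. \<forall>l\<in>{1..CARD('n)}. GGS_form (P i j k l)) \<and>
      Y = (\<Sum>i=1..CARD('n). \<Sum>j=1..CARD('n). \<Sum>k=1..CARD('n). \<Sum>l=1..CARD('n).
        P i j k l *\<^sub>m (mat_unit i j \<otimes> mat_unit k l))) \<and>
    (\<forall>u v. fps_X ^ 3 dvd (Y - (mat 1 + (2 * fps_X) *\<^sub>m to_fps r + (2 * fps_X ^ 2) *\<^sub>m to_fps (r ** r))) $ u $ v)"
    unfolding expansion_iff using Y by blast
next
  fix Y'
  assume "(\<exists>P. (\<forall>i\<in>{1..CARD('n)}. \<forall>j\<in>{1..CARD('n)}. \<forall>k\<in>{1..CARD('n)}. \<forall>l\<in>{1..CARD('n)}. GGS_form (P i j k l)) \<and>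
      Y' = (\<Sum>i=1..CARD('n). \<Sum>j=1..CARD('n). \<Sum>k=1..CARD('n). \<Sum>l=1..CARD('n).
        P i j k l *\<^sub>m (mat_unit i j \<otimes> mat_unit k l))) \<and>
    (\<forall>u v. fps_X ^ 3 dvd (Y' - (mat 1 + (2 * fps_X) *\<^sub>m to_fps r + (2 * fps_X ^ 2) *\<^sub>m to_fps (r ** r))) $ u $ v)"
  then obtain P where P: "\<forall>i\<in>{1..CARD('n)}. \<forall>j\<in>{1..CARD('n)}. \<forall>k\<in>{1..CARD('n)}. \<forall>l\<in>{1..CARD('n)}. GGS_form (P i j k l)"
    "Y' = (\<Sum>i=1..CARD('n). \<Sum>j=1..CARD('n). \<Sum>k=1..CARD('n). \<Sum>l=1..CARD('n).
        P i j k l *\<^sub>m (mat_unit i j \<otimes> mat_unit k l))"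
    and Y': "hcoeff 0 Y' = mat 1" "hcoeff 1 Y' = r + r" "hcoeff 2 Y' = r ** r + r ** r"
    unfolding expansion_iff by blast
  have hcoeff: "hcoeff i Y' = hcoeff i Y" if "i < 3" for i
    using that Y Y' by (auto simp: less_Suc_eq numeral_eq_Suc)
  show "Y' = Y"
  proof (rule mat_eqI)
    fix x y z w assume I: "(x, y) \<in> pairs_ix" "(z, w) \<in> pairs_ix"
    show "entry Y' x y z w = entry Y x y z w"
    proof (rule GGS_form_unique)
      show "GGS_form (entry Y' x y z w)"
        unfolding P(2) entry_all_units[OF I]
        using P(1)[rule_format, of "nat x" "nat z" "nat y" "nat w"] I by (auto simp: pairs_ix_n nat_le_iff Suc_le_eq)
      have "fps_nth (entry Y' x y z w) i = fps_nth (entry Y x y z w) i" if "i < 3" for i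
        using hcoeff[OF that] entry_hcoeff by metis
      then show "fps_X ^ 3 dvd entry Y' x y z w - entry Y x y z w"
        unfolding fps_X_cube_dvd by simp
    qed (rule form)
  qed
qed

end

theorem theorem1p2:
  fixes T :: "complex ^ 'n::finite \<Rightarrow> complex ^ 'n"
    and \<Gamma>1 \<Gamma>2 :: "(complex ^ 'n) set"
    and s :: "(complex, 'n) tmat"
  assumes "CARD('n) \<ge> 2"
    and "BD_triple T \<Gamma>1 \<Gamma>2"
    and "s \<in> h_wedge_h"
    and "\<forall>\<alpha>\<in>\<Gamma>1. hfun_tensor1 (\<alpha> - T \<alpha>) s = (1 / 2) *\<^sub>m hfun_tensor1 (\<alpha> + T \<alpha>) P0"
  shows "R_J T \<Gamma>1 s = R_GGS (r_cl T \<Gamma>1 s)"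
proof -
  interpret bd_setup T \<Gamma>1 \<Gamma>2 using assms(1,2) by unfold_locales
  have "s \<in> hh" using assms(3) by (simp add: h_wedge_h_def)
  then show ?thesis using R_GGS_eqI[OF R_J_expansion] by metis
qed

end
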